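(* Let $\Omega$ be a domain in $\mathbb C$. Suppose $u=(u_1,\ldots,u_N):\Omega\to\mathbb C^N$ belongs to $H^1_{loc}(\Omega)$ and satisfies $$|\bar\partial u|\le V|u|\quad\text{a.e. in }\Omega$$ for some $V\in L^2_{loc}(\Omega)$. If $u$ vanishes to infinite order at some point $z_0\in\Omega$, then $u$ vanishes identically on $\Omega$.
   Context: A domain is a connected open set. $H^1_{loc}(\Omega)$ is the local Sobolev space of functions whose weak derivatives up to order $1$ are in $L^2_{loc}(\Omega)$ (componentwise for vector-valued functions). Here $\bar\partial u=(\partial u_1/\partial\bar z,\ldots,\partial u_N/\partial\bar z)$ in the weak sense, $|\bar\partial u|=\left(\sum_{k=1}^N|\partial u_k/\partial\bar z|^2\right)^{1/2}$ and $|u|=\left(\sum_{k=1}^N|u_k|^2\right)^{1/2}$. A square-integrable function $u$ is said to vanish to infinite order (or to be flat) at $z_0$ if for all $m\ge 0$, $$\lim_{r\to 0}r^{-m}\int_{|z-z_0|<r}|u(z)|^2\,dv_z=0,$$ where $dv_z$ is Lebesgue measure. "Vanishes identically" means $u=0$ as an element of $H^1_{loc}(\Omega)$, i.e. almost everywhere. *)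

theory Defs
  imports "HOL-Analysis.Analysis"
begin

text \<open>\<open>k\<close> times continuously differentiable on the whole space, over the reals: total
  differentiability together with recursively \<open>k - 1\<close> times continuously differentiable partial
  derivatives. For functions on \<^typ>\<open>complex\<close>, the basis \<^term>\<open>Basis\<close> is \<open>{1, \<i>}\<close>, so this is real,
  not complex, differentiability.\<close>

primrec Ck :: "nat \<Rightarrow> ('a::euclidean_space \<Rightarrow> 'b::real_normed_vector) \<Rightarrow> bool" where
  "Ck 0 f \<longleftrightarrow> continuous_on UNIV f"
| "Ck (Suc k) f \<longleftrightarrow> (\<forall>x. f differentiable (at x)) \<and>
      (\<forall>b\<in>Basis. Ck k (\<lambda>x. frechet_derivative f (at x) b))"

definition test_fun :: "'a::euclidean_space set \<Rightarrow> ('a \<Rightarrow> complex) \<Rightarrow> bool" where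
  "test_fun \<Omega> \<phi> \<longleftrightarrow> (\<forall>k. Ck k \<phi>) \<and>
      compact (closure {x. \<phi> x \<noteq> 0}) \<and> closure {x. \<phi> x \<noteq> 0} \<subseteq> \<Omega>"

definition L1_loc :: "'a::euclidean_space set \<Rightarrow> ('a \<Rightarrow> complex) \<Rightarrow> bool" where
  "L1_loc \<Omega> f \<longleftrightarrow> (\<forall>K. compact K \<and> K \<subseteq> \<Omega> \<longrightarrow> set_integrable lebesgue K f)"

definition L2_loc :: "'a::euclidean_space set \<Rightarrow> ('a \<Rightarrow> 'b::real_normed_vector) \<Rightarrow> bool" where
  "L2_loc \<Omega> f \<longleftrightarrow> f \<in> borel_measurable (lebesgue_on \<Omega>) \<and>
      (\<forall>K. compact K \<and> K \<subseteq> \<Omega> \<longrightarrow> set_integrable lebesgue K (\<lambda>x. (norm (f x))\<^sup>2))"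

definition has_weak_partial ::
    "'a::euclidean_space set \<Rightarrow> 'a \<Rightarrow> ('a \<Rightarrow> complex) \<Rightarrow> ('a \<Rightarrow> complex) \<Rightarrow> bool" where
  "has_weak_partial \<Omega> b f g \<longleftrightarrow> L1_loc \<Omega> f \<and> L1_loc \<Omega> g \<and>
      (\<forall>\<phi>. test_fun \<Omega> \<phi> \<longrightarrow>
        (LINT x:\<Omega>|lebesgue. f x * frechet_derivative \<phi> (at x) b) = - (LINT x:\<Omega>|lebesgue. g x * \<phi> x))"

definition H1_loc :: "'a::euclidean_space set \<Rightarrow> ('a \<Rightarrow> complex) \<Rightarrow> bool" where
  "H1_loc \<Omega> f \<longleftrightarrow> L2_loc \<Omega> f \<and> (\<forall>b\<in>Basis. \<exists>g. L2_loc \<Omega> g \<and> has_weak_partial \<Omega> b f g)"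

definition H1_loc_vec :: "'a::euclidean_space set \<Rightarrow> ('a \<Rightarrow> complex^'n) \<Rightarrow> bool" where
  "H1_loc_vec \<Omega> u \<longleftrightarrow> (\<forall>k. H1_loc \<Omega> (\<lambda>x. u x $ k))"

text \<open>The classical operator \<open>\<partial>/\<partial>\<bar>z\<close>, meaningful where \<open>\<phi>\<close> is real-differentiable.\<close>

definition dbar :: "(complex \<Rightarrow> complex) \<Rightarrow> complex \<Rightarrow> complex" where
  "dbar \<phi> z = (frechet_derivative \<phi> (at z) 1 + \<i> * frechet_derivative \<phi> (at z) \<i>) / 2"

definition has_weak_dbar :: "complex set \<Rightarrow> (complex \<Rightarrow> complex) \<Rightarrow> (complex \<Rightarrow> complex) \<Rightarrow> bool" where
  "has_weak_dbar \<Omega> f g \<longleftrightarrow> L1_loc \<Omega> f \<and> L1_loc \<Omega> g \<and>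
      (\<forall>\<phi>. test_fun \<Omega> \<phi> \<longrightarrow>
        (LINT z:\<Omega>|lebesgue. f z * dbar \<phi> z) = - (LINT z:\<Omega>|lebesgue. g z * \<phi> z))"

definition has_weak_dbar_vec ::
    "complex set \<Rightarrow> (complex \<Rightarrow> complex^'n) \<Rightarrow> (complex \<Rightarrow> complex^'n) \<Rightarrow> bool" where
  "has_weak_dbar_vec \<Omega> u w \<longleftrightarrow> (\<forall>k. has_weak_dbar \<Omega> (\<lambda>z. u z $ k) (\<lambda>z. w z $ k))"

text \<open>Only to be used for \<open>u\<close> square-integrable near \<open>z0\<close>, since the integral of a non-integrable
  function is \<open>0\<close> by convention. The norm on \<^typ>\<open>complex^'n\<close> is the Euclidean one.\<close>

definition flat_at :: "(complex \<Rightarrow> complex^'n) \<Rightarrow> complex \<Rightarrow> bool" where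
  "flat_at u z0 \<longleftrightarrow>
      (\<forall>m::nat. ((\<lambda>r. (LINT z:ball z0 r|lebesgue. (norm (u z))\<^sup>2) / r ^ m) \<longlongrightarrow> 0) (at_right 0))"

end

theory Submission
  imports Defs
begin

text \<open>
  The proof is a Carleman estimate whose weight is made from the potential \<open>V\<close> itself. For a real
  function \<open>\<psi>\<close> and a compactly supported \<open>w\<close>, integration by parts gives
  \<open>\<integral> \<psi>\<^bsub>z\<bar>z\<^esub> |w|\<^sup>2 e\<^sup>\<psi> \<le> \<integral> |\<partial>w/\<partial>\<bar>z|\<^sup>2 e\<^sup>\<psi>\<close> (\<open>carleman_C2\<close>). If \<open>\<psi>\<^bsub>z\<bar>z\<^esub> \<ge> 4(V\<^sup>2 + 1)\<close>, then for
  \<open>w = \<eta>u\<close> with a cutoff \<open>\<eta>\<close> the term \<open>V|u|\<close> produced by the differential inequality is absorbed by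
  the left-hand side, and \<open>\<integral> |\<eta>|\<^sup>2 |u|\<^sup>2 e\<^sup>\<psi> \<le> \<integral> |\<partial>\<eta>/\<partial>\<bar>z|\<^sup>2 |u|\<^sup>2 e\<^sup>\<psi>\<close> remains (\<open>vector_carleman\<close>).
  Vector-valued \<open>u\<close> costs nothing because the estimate is summed over the components.
  Since \<open>V\<^sup>2\<close> is merely integrable, \<open>\<psi>\<close> is a logarithmic potential of an integrable
  function: it is bounded above on bounded sets, so that \<open>e\<^sup>\<psi> \<le> 1\<close> after normalisation, and it is finite
  almost everywhere, so that \<open>e\<^sup>\<psi> > 0\<close> almost everywhere. That is all the argument asks of the weight.

  Holomorphic factors commute with \<open>\<partial>/\<partial>\<bar>z\<close>. Hence \<open>\<eta>\<close> may carry the factor \<open>(z - z0)\<^bsup>-m\<^esup>\<close>, as long as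
  it vanishes near \<open>z0\<close>. Let \<open>\<eta>\<close> be cut off at the radii \<open>\<epsilon> < 2\<epsilon>\<close> and \<open>r < R\<close>. The contribution of the
  inner transition region is at most a constant times \<open>\<epsilon>\<^bsup>-2m-2\<^esup> \<integral>\<^bsub>|z - z0| < 2\<epsilon>\<^esub> |u|\<^sup>2\<close>, which flatness sends to
  \<open>0\<close>; the outer one is \<open>O(r\<^bsup>-2m\<^esup>)\<close>, while \<open>|\<eta>|\<^sup>2 \<ge> s\<^bsup>-2m\<^esup>\<close> on
  \<open>2\<epsilon> \<le> |z - z0| < s\<close>, where \<open>s < r\<close>. Letting first \<open>\<epsilon>\<close> tend to \<open>0\<close> and then \<open>m\<close> to
  infinity gives \<open>u = 0\<close> there (\<open>flat_weighted_zero\<close>). As \<open>s < r < R\<close> were arbitrary below the radius of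
  any closed disc about \<open>z0\<close> in \<open>\<Omega>\<close>, \<open>u\<close> vanishes on all such discs. A function that vanishes near a
  point is flat there, so discs can be chained through the connected set \<open>\<Omega>\<close>.

  Two approximations make this rigorous. The weight: \<open>V\<^sup>2 + 1\<close> is dominated almost everywhere by a
  countable sum of indicators of discs with \<open>\<Sum> \<rho>\<^sub>j\<^sup>2 < \<infinity>\<close> (\<open>ball_majorant\<close>), and each disc has the explicit
  smooth potential \<open>16 \<rho>\<^sup>2 ln (|z - a|\<^sup>2 + \<rho>\<^sup>2)\<close>; partial sums of these potentials are smooth and decrease
  to \<open>\<psi>\<close>. The function: \<open>u\<close> is mollified; on the right-hand side Jensen's inequality is enough, and on
  the left Fatou's lemma, given almost everywhere convergence along a subsequence.
\<close>

section \<open>Wirtinger derivatives and the Carleman inequality for smooth functions\<close>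

text \<open>The real derivative of a function on the plane is written as \<open>h \<mapsto> p h + q \<bar>h\<close>, where \<open>p = \<partial>f/\<partial>z\<close> and
  \<open>q = \<partial>f/\<partial>\<bar>z\<close>. Carrying both coefficients as explicit functions turns differentiation into rewriting.\<close>

definition wirtinger :: "(complex \<Rightarrow> complex) \<Rightarrow> (complex \<Rightarrow> complex) \<Rightarrow> (complex \<Rightarrow> complex) \<Rightarrow> bool" where
  "wirtinger f p q \<longleftrightarrow> (\<forall>z. (f has_derivative (\<lambda>h. p z * h + q z * cnj h)) (at z))"

text \<open>Twice continuously differentiable. The same function \<open>r\<close> is demanded as \<open>\<partial>p/\<partial>\<bar>z\<close> and as \<open>\<partial>q/\<partial>z\<close>, which builds
  in the symmetry of the mixed derivatives that the integration by parts below relies on.\<close>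

definition wirtinger2 :: "(complex \<Rightarrow> complex) \<Rightarrow> (complex \<Rightarrow> complex) \<Rightarrow> (complex \<Rightarrow> complex) \<Rightarrow> bool" where
  "wirtinger2 f p q \<longleftrightarrow> wirtinger f p q \<and> (\<exists>a r c. wirtinger p a r \<and> wirtinger q r c \<and>
     continuous_on UNIV a \<and> continuous_on UNIV r \<and> continuous_on UNIV c)"

lemma wirtinger_continuous: "wirtinger f p q \<Longrightarrow> continuous_on UNIV f"
  unfolding wirtinger_def by (meson has_derivative_continuous continuous_at_imp_continuous_on)

lemma wirtinger_mult:
  assumes "wirtinger f p q" "wirtinger g p' q'"
  shows "wirtinger (\<lambda>z. f z * g z) (\<lambda>z. p z * g z + f z * p' z) (\<lambda>z. q z * g z + f z * q' z)"
  unfolding wirtinger_def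
proof
  fix z
  have f: "(f has_derivative (\<lambda>h. p z * h + q z * cnj h)) (at z)"
    and g: "(g has_derivative (\<lambda>h. p' z * h + q' z * cnj h)) (at z)"
    using assms unfolding wirtinger_def by auto
  show "((\<lambda>z. f z * g z) has_derivative (\<lambda>h. (p z * g z + f z * p' z) * h + (q z * g z + f z * q' z) * cnj h)) (at z)"
    by (rule has_derivative_eq_rhs[OF has_derivative_mult[OF f g]]) (auto simp: algebra_simps)
qed

lemma wirtinger_add:
  assumes "wirtinger f p q" "wirtinger g p' q'"
  shows "wirtinger (\<lambda>z. f z + g z) (\<lambda>z. p z + p' z) (\<lambda>z. q z + q' z)"
  unfolding wirtinger_def
proof
  fix z
  have f: "(f has_derivative (\<lambda>h. p z * h + q z * cnj h)) (at z)"
    and g: "(g has_derivative (\<lambda>h. p' z * h + q' z * cnj h)) (at z)"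
    using assms unfolding wirtinger_def by auto
  show "((\<lambda>z. f z + g z) has_derivative (\<lambda>h. (p z + p' z) * h + (q z + q' z) * cnj h)) (at z)"
    by (rule has_derivative_eq_rhs[OF has_derivative_add[OF f g]]) (auto simp: algebra_simps)
qed

lemma wirtinger_cnj:
  assumes "wirtinger f p q"
  shows "wirtinger (\<lambda>z. cnj (f z)) (\<lambda>z. cnj (q z)) (\<lambda>z. cnj (p z))"
  unfolding wirtinger_def
proof
  fix z
  have f: "(f has_derivative (\<lambda>h. p z * h + q z * cnj h)) (at z)"
    using assms unfolding wirtinger_def by auto
  show "((\<lambda>z. cnj (f z)) has_derivative (\<lambda>h. cnj (q z) * h + cnj (p z) * cnj h)) (at z)"
    by (rule has_derivative_eq_rhs[OF has_derivative_cnj[OF f]]) (auto simp: algebra_simps)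
qed

lemma wirtinger_const: "wirtinger (\<lambda>z. k) (\<lambda>z. 0) (\<lambda>z. 0)"
  unfolding wirtinger_def by simp

lemma wirtinger_ident: "wirtinger (\<lambda>z. z) (\<lambda>z. 1) (\<lambda>z. 0)"
  unfolding wirtinger_def by simp

lemma wirtinger_comp_holo:
  assumes "wirtinger f p q" "\<And>z. (g has_field_derivative g' z) (at (f z))"
  shows "wirtinger (\<lambda>z. g (f z)) (\<lambda>z. g' z * p z) (\<lambda>z. g' z * q z)"
  unfolding wirtinger_def
proof
  fix z
  have f: "(f has_derivative (\<lambda>h. p z * h + q z * cnj h)) (at z)"
    using assms unfolding wirtinger_def by auto
  have g: "(g has_derivative (*) (g' z)) (at (f z))" 
    using assms(2) by (simp add: has_field_derivative_def)
  show "((\<lambda>z. g (f z)) has_derivative (\<lambda>h. g' z * p z * h + g' z * q z * cnj h)) (at z)"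
    by (rule has_derivative_eq_rhs[OF has_derivative_compose[OF f g]]) (auto simp: algebra_simps)
qed

lemma wirtinger_cong:
  assumes "wirtinger f p q" "\<And>z. f z = f' z" "\<And>z. p z = p' z" "\<And>z. q z = q' z"
  shows "wirtinger f' p' q'"
proof -
  have "f = f'" "p = p'" "q = q'" using assms by auto
  then show ?thesis using assms(1) by simp
qed

lemma wirtinger2_mult:
  assumes "wirtinger2 f p q" "wirtinger2 g p' q'"
  shows "wirtinger2 (\<lambda>z. f z * g z) (\<lambda>z. p z * g z + f z * p' z) (\<lambda>z. q z * g z + f z * q' z)"
proof -
  obtain a r c where 1: "wirtinger f p q" "wirtinger p a r" "wirtinger q r c" "continuous_on UNIV a" "continuous_on UNIV r" "continuous_on UNIV c"
    using assms(1) unfolding wirtinger2_def by blast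
  obtain a' r' c' where 2: "wirtinger g p' q'" "wirtinger p' a' r'" "wirtinger q' r' c'" "continuous_on UNIV a'" "continuous_on UNIV r'" "continuous_on UNIV c'"
    using assms(2) unfolding wirtinger2_def by blast
  note cont = 1(4-6) 2(4-6) 1(1-3)[THEN wirtinger_continuous] 2(1-3)[THEN wirtinger_continuous]
  have A: "wirtinger (\<lambda>z. p z * g z + f z * p' z) (\<lambda>z. a z * g z + p z * p' z + p z * p' z + f z * a' z) (\<lambda>z. r z * g z + p z * q' z + q z * p' z + f z * r' z)"
    by (rule wirtinger_cong[OF wirtinger_add[OF wirtinger_mult[OF 1(2) 2(1)] wirtinger_mult[OF 1(1) 2(2)]]]) auto
  have B: "wirtinger (\<lambda>z. q z * g z + f z * q' z) (\<lambda>z. r z * g z + p z * q' z + q z * p' z + f z * r' z) (\<lambda>z. c z * g z + q z * q' z + q z * q' z + f z * c' z)"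
    by (rule wirtinger_cong[OF wirtinger_add[OF wirtinger_mult[OF 1(3) 2(1)] wirtinger_mult[OF 1(1) 2(3)]]]) auto
  show ?thesis unfolding wirtinger2_def
    apply (rule conjI[OF wirtinger_mult[OF 1(1) 2(1)]])
    apply (rule exI)+
    apply (rule conjI[OF A], rule conjI[OF B])
    by (intro conjI continuous_intros cont)
qed

text \<open>The support of a derivative lies in the support of the function.\<close>

lemma wirtinger_zero_outside:
  assumes "wirtinger f p q" "open S" "\<And>z. z \<in> S \<Longrightarrow> f z = 0" "z \<in> S"
  shows "p z = 0" "q z = 0"
proof -
  have f: "(f has_derivative (\<lambda>h. p z * h + q z * cnj h)) (at z)"
    using assms(1) unfolding wirtinger_def by auto
  have "((\<lambda>z. 0) has_derivative (\<lambda>h. p z * h + q z * cnj h)) (at z)"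
    by (rule has_derivative_transform_within_open[OF f assms(2,4)]) (use assms(3) in auto)
  then have "(\<lambda>h. p z * h + q z * cnj h) = (\<lambda>h. 0)"
    by (rule has_derivative_unique) simp
  from fun_cong[OF this, of 1] fun_cong[OF this, of "\<i>"]
  have "p z + q z = 0" "p z - q z = 0" by (auto simp: algebra_simps)
  then show "p z = 0" "q z = 0" by (auto simp: add_eq_0_iff)
qed

lemma wirtinger_dbar: "wirtinger f p q \<Longrightarrow> dbar f z = q z"
  unfolding wirtinger_def dbar_def
  by (drule spec[of _ z], drule frechet_derivative_at[symmetric]) (auto simp: algebra_simps)

lemma compact_support_integrable:
  fixes f :: "complex \<Rightarrow> 'b::{banach,second_countable_topology}"
  assumes "continuous_on UNIV f" "\<And>z. R < norm z \<Longrightarrow> f z = 0"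
  shows "integrable lborel f"
proof -
  have "integrable lborel (\<lambda>z. indicator (cball 0 R) z *\<^sub>R f z)"
    using borel_integrable_compact[OF compact_cball, of 0 R f] continuous_on_subset[OF assms(1)] by (simp add: set_integrable_def)
  moreover have "(\<lambda>z. indicator (cball 0 R) z *\<^sub>R f z) = f"
    using assms(2) by (auto simp: indicator_def fun_eq_iff)
  ultimately show ?thesis by simp
qed

lemma compact_support_bounded:
  fixes f :: "complex \<Rightarrow> 'b::real_normed_vector"
  assumes "continuous_on UNIV f" "\<And>z. R < norm z \<Longrightarrow> f z = 0"
  obtains C where "C > 0" "\<And>z. norm (f z) \<le> C"
proof -
  have "bounded (f ` cball 0 R)"
    by (intro compact_imp_bounded compact_continuous_image continuous_on_subset[OF assms(1)]) auto
  then obtain C where C: "C > 0" "\<And>z. z \<in> cball 0 R \<Longrightarrow> norm (f z) \<le> C"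
    unfolding bounded_pos by auto
  show ?thesis
  proof (rule that[OF C(1)])
    fix z show "norm (f z) \<le> C"
      using C assms(2)[of z] by (cases "norm z \<le> R") (auto simp: not_le)
  qed
qed

text \<open>Translation invariance makes the integral of every difference quotient vanish; the quotients
  are dominated by a bounded function with bounded support and converge to the derivative.\<close>

lemma integral_directional_zero:
  fixes f :: "complex \<Rightarrow> complex"
  assumes d: "\<And>z. (f has_derivative D z) (at z)"
    and c: "continuous_on UNIV (\<lambda>z. D z b)"
    and s: "\<And>z. R < norm z \<Longrightarrow> f z = 0"
    and s': "\<And>z. R < norm z \<Longrightarrow> D z b = 0"
  shows "(LINT z|lborel. D z b) = 0"
proof -
  have fc: "continuous_on UNIV f"
    using d by (meson has_derivative_continuous continuous_at_imp_continuous_on)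
  have fi: "integrable lborel f" by (rule compact_support_integrable[OF fc s])
  obtain C where C: "C > 0" "\<And>z. norm (D z b) \<le> C"
    using compact_support_bounded[OF c s'] by blast
  define t where "t n = 1 / real (Suc n)" for n
  have t0: "t n > 0" "t n \<le> 1" for n by (auto simp: t_def)
  have tl: "t \<longlonglongrightarrow> 0" unfolding t_def by (rule LIMSEQ_Suc) (rule lim_1_over_n)
  define g where "g n z = (f (z + t n *\<^sub>R b) - f z) /\<^sub>R t n" for n z
  have shift: "integrable lborel (\<lambda>z. f (a + z))" "(LINT z|lborel. f (a + z)) = (LINT z|lborel. f z)" for a
  proof -
    have m: "f \<in> borel_measurable borel" using fc by (rule borel_measurable_continuous_onI)
    have "integrable (distr lborel borel ((+) a)) f"
      using fi by (simp add: lborel_distr_plus)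
    then show "integrable lborel (\<lambda>z. f (a + z))"
      by (subst (asm) integrable_distr_eq) (use m in auto)
    have "(LINT z|lborel. f z) = (LINT z|distr lborel borel ((+) a). f z)"
      by (simp add: lborel_distr_plus)
    also have "\<dots> = (LINT z|lborel. f (a + z))"
      by (rule integral_distr) (use m in auto)
    finally show "(LINT z|lborel. f (a + z)) = (LINT z|lborel. f z)" by simp
  qed
  have gi: "(LINT z|lborel. g n z) = 0" for n
    using shift[of "t n *\<^sub>R b"] fi by (simp add: g_def add.commute)
  have pw: "(\<lambda>n. g n z) \<longlonglongrightarrow> D z b" for z
  proof -
    have "((\<lambda>s. f (z + s *\<^sub>R b)) has_derivative (\<lambda>s. D z (s *\<^sub>R b))) (at 0)"
      by (rule has_derivative_compose[where g=f and f="\<lambda>s. z + s *\<^sub>R b"])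
         (use d[of z] in \<open>auto intro!: derivative_eq_intros\<close>)
    moreover have "D z (s *\<^sub>R b) = s *\<^sub>R D z b" for s
      using d[of z] by (simp add: has_derivative_def linear_simps)
    ultimately have "((\<lambda>s. f (z + s *\<^sub>R b)) has_derivative (\<lambda>s. s *\<^sub>R D z b)) (at 0)"
      by simp
    then have L: "((\<lambda>s. norm (f (z + s *\<^sub>R b) - f z - s *\<^sub>R D z b) / norm s) \<longlongrightarrow> 0) (at 0)"
      by (simp add: has_derivative_at)
    have "((\<lambda>s. norm ((f (z + s *\<^sub>R b) - f z) /\<^sub>R s - D z b)) \<longlongrightarrow> 0) (at 0)"
    proof (rule Lim_transform_eventually[OF L])
      have "norm (f (z + s *\<^sub>R b) - f z - s *\<^sub>R D z b) / norm s = norm ((f (z + s *\<^sub>R b) - f z) /\<^sub>R s - D z b)"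
        if "s \<noteq> 0" for s :: real
      proof -
        have "(f (z + s *\<^sub>R b) - f z) /\<^sub>R s - D z b = (f (z + s *\<^sub>R b) - f z - s *\<^sub>R D z b) /\<^sub>R s"
          using that by (simp add: scaleR_diff_right)
        then show ?thesis by (simp only: norm_scaleR) (simp add: divide_inverse_commute)
      qed
      then show "\<forall>\<^sub>F s in at 0. norm (f (z + s *\<^sub>R b) - f z - s *\<^sub>R D z b) / norm s = norm ((f (z + s *\<^sub>R b) - f z) /\<^sub>R s - D z b)"
        by (auto simp: eventually_at_filter)
    qed
    then have "((\<lambda>s. (f (z + s *\<^sub>R b) - f z) /\<^sub>R s) \<longlongrightarrow> D z b) (at 0)"
      using tendsto_norm_zero_iff Lim_null by blast
    then show ?thesis unfolding g_def
      by (rule filterlim_compose) (use tl t0 in \<open>auto simp: filterlim_at intro!: always_eventually less_imp_neq[symmetric]\<close>)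
  qed
  have bd: "norm (f (z + s *\<^sub>R b) - f z) \<le> C * s" if "s > 0" for z s
  proof -
    have "norm (f (z + s *\<^sub>R b) - f (z + 0 *\<^sub>R b)) \<le> C * norm (s - 0)"
    proof (rule differentiable_bound[where S="{0..s}" and f="\<lambda>s. f (z + s *\<^sub>R b)" and f'="\<lambda>s x. x *\<^sub>R D (z + s *\<^sub>R b) b"])
      fix x
      have "((\<lambda>s. f (z + s *\<^sub>R b)) has_derivative (\<lambda>s. D (z + x *\<^sub>R b) (s *\<^sub>R b))) (at x)"
        by (rule has_derivative_compose[where g=f and f="\<lambda>s. z + s *\<^sub>R b"])
           (use d in \<open>auto intro!: derivative_eq_intros\<close>)
      moreover have "D (z + x *\<^sub>R b) (s *\<^sub>R b) = s *\<^sub>R D (z + x *\<^sub>R b) b" for s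
        using d[of "z + x *\<^sub>R b"] by (simp add: has_derivative_def linear_simps)
      ultimately show "((\<lambda>s. f (z + s *\<^sub>R b)) has_derivative (\<lambda>y. y *\<^sub>R D (z + x *\<^sub>R b) b)) (at x within {0..s})"
        by (auto intro: has_derivative_at_withinI)
      show "onorm (\<lambda>y. y *\<^sub>R D (z + x *\<^sub>R b) b) \<le> C"
        by (rule onorm_bound) (use C in \<open>auto simp: mult.commute[of C] intro: mult_left_mono\<close>)
    qed (use that in auto)
    then show ?thesis using that by simp
  qed
  have gb: "norm (g n z) \<le> C * indicator (cball 0 (R + norm b)) z" for n z
  proof (cases "norm z \<le> R + norm b")
    case True
    have "norm (g n z) \<le> C * t n / t n"
      unfolding g_def norm_scaleR using bd[OF t0(1), of z n] t0(1)[of n] by (simp add: divide_inverse_commute mult_left_mono)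
    then show ?thesis using True t0(1)[of n] by simp
  next
    case False
    have "norm (t n *\<^sub>R b) \<le> norm b"
      using t0[of n] by (simp add: mult_left_le_one_le)
    then have "R < norm (z + t n *\<^sub>R b)"
      using norm_triangle_ineq[of "z + t n *\<^sub>R b" "- (t n *\<^sub>R b)"] False by simp
    moreover have "R < norm z" using False norm_ge_zero[of b] by linarith
    ultimately show ?thesis using s False by (simp add: g_def)
  qed
  have "(\<lambda>n. (LINT z|lborel. g n z)) \<longlonglongrightarrow> (LINT z|lborel. D z b)"
  proof (rule integral_dominated_convergence)
    show "(\<lambda>z. D z b) \<in> borel_measurable lborel"
      using c by (simp add: borel_measurable_continuous_onI)
    show "g n \<in> borel_measurable lborel" for n unfolding g_def
      by (simp, intro borel_measurable_continuous_onI) (intro continuous_intros continuous_on_compose2[OF fc] subset_UNIV)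
    show "integrable lborel (\<lambda>z. C * indicator (cball 0 (R + norm b)) z :: real)"
      by (intro integrable_mult_right integrable_real_indicator)
         (use emeasure_bounded_finite[OF bounded_cball] in auto)
  qed (use pw gb in auto)
  then show ?thesis using gi LIMSEQ_unique[of "\<lambda>n. 0::complex" 0] by auto
qed

lemma integral_wirtinger_zero:
  assumes w: "wirtinger f p q" and c: "continuous_on UNIV p" "continuous_on UNIV q"
    and s: "\<And>z. R < norm z \<Longrightarrow> f z = 0"
  shows "(LINT z|lborel. p z) = 0" "(LINT z|lborel. q z) = 0"
proof -
  have o: "open {z::complex. R < norm z}"
    by (intro open_Collect_less continuous_intros)
  have s': "p z = 0" "q z = 0" if "R < norm z" for z
    using wirtinger_zero_outside[OF w o, of z] s that by auto
  have i: "integrable lborel p" "integrable lborel q"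
    using compact_support_integrable[OF c(1) s'(1)] compact_support_integrable[OF c(2) s'(2)] by auto
  note D = integral_directional_zero[where f=f and D="\<lambda>z h. p z * h + q z * cnj h" and R=R,
      OF w[unfolded wirtinger_def, rule_format] _ s]
  have 1: "(LINT z|lborel. p z + q z) = 0"
    using D[of 1] c s' by (simp add: continuous_intros)
  have 2: "(LINT z|lborel. p z * \<i> - q z * \<i>) = 0"
    using D[of "\<i>"] c s' by (simp add: continuous_intros)
  have "(LINT z|lborel. p z) + (LINT z|lborel. q z) = 0" using 1 i by simp
  moreover have "(LINT z|lborel. p z) - (LINT z|lborel. q z) = 0"
    using 2 i by (simp flip: left_diff_distrib)
  ultimately show "(LINT z|lborel. p z) = 0" "(LINT z|lborel. q z) = 0"
    by (auto simp: add_eq_0_iff)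
qed

text \<open>With \<open>\<delta>w = w\<^sub>z + \<psi>\<^sub>z w\<close>, \<open>A = e\<^sup>\<psi> w \<cdot> cnj w\<^sub>\<bar>z\<close> and \<open>B = e\<^sup>\<psi> w \<cdot> cnj (\<delta>w)\<close>, a direct computation gives the pointwise
  identity \<open>A\<^sub>\<bar>z - B\<^sub>z = e\<^sup>\<psi> (|w\<^sub>\<bar>z|\<^sup>2 - |\<delta>w|\<^sup>2 - \<psi>\<^bsub>z\<bar>z\<^esub> |w|\<^sup>2)\<close>. Both derivatives integrate to \<open>0\<close>, and \<open>|\<delta>w|\<^sup>2\<close> is
  dropped. Here \<open>l = \<psi>\<^sub>z\<close>, and \<open>g = \<psi>\<^bsub>z\<bar>z\<^esub>\<close> is a quarter of the Laplacian of \<open>\<psi>\<close>.\<close>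

lemma carleman_C2:
  fixes \<psi> g :: "complex \<Rightarrow> real"
  assumes w: "wirtinger2 w p q"
    and s: "\<And>z. R < norm z \<Longrightarrow> w z = 0"
    and psi: "wirtinger (\<lambda>z. of_real (\<psi> z)) l (\<lambda>z. cnj (l z))" "wirtinger l m (\<lambda>z. of_real (g z))"
    and cont: "continuous_on UNIV m" "continuous_on UNIV g"
  shows "(LINT z|lborel. g z * (norm (w z))^2 * exp (\<psi> z)) \<le> (LINT z|lborel. (norm (q z))^2 * exp (\<psi> z))"
proof -
  obtain a r c where 1: "wirtinger w p q" "wirtinger p a r" "wirtinger q r c" "continuous_on UNIV a" "continuous_on UNIV r" "continuous_on UNIV c"
    using w unfolding wirtinger2_def by blast
  define E where "E z = exp (of_real (\<psi> z) :: complex)" for z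
  have E: "wirtinger E (\<lambda>z. E z * l z) (\<lambda>z. E z * cnj (l z))"
    unfolding E_def by (rule wirtinger_comp_holo[OF psi(1)]) (auto intro!: derivative_eq_intros)
  have Er: "E z = of_real (exp (\<psi> z))" for z by (simp add: E_def exp_of_real)
  note cont' = 1(4-6) cont 1(1-3)[THEN wirtinger_continuous] E[THEN wirtinger_continuous] psi[THEN wirtinger_continuous]
  have lc: "continuous_on UNIV l" using psi(2) by (rule wirtinger_continuous)
  define A where "A z = E z * (w z * cnj (q z))" for z
  define B where "B z = E z * (w z * cnj (p z + l z * w z))" for z
  define Ap where "Ap z = E z * l z * (w z * cnj (q z)) + E z * (p z * cnj (q z) + w z * cnj (c z))" for z
  define Aq where "Aq z = E z * cnj (l z) * (w z * cnj (q z)) + E z * (q z * cnj (q z) + w z * cnj (r z))" for z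
  have A: "wirtinger A Ap Aq" unfolding A_def
    by (rule wirtinger_cong[OF wirtinger_mult[OF E wirtinger_mult[OF 1(1) wirtinger_cnj[OF 1(3)]]]]) (auto simp: Ap_def Aq_def)
  define Bp where "Bp z = E z * l z * (w z * cnj (p z + l z * w z)) + E z * (p z * cnj (p z + l z * w z) + w z * cnj (r z + (of_real (g z) * w z + l z * q z)))" for z
  define Bq where "Bq z = E z * cnj (l z) * (w z * cnj (p z + l z * w z)) + E z * (q z * cnj (p z + l z * w z) + w z * cnj (a z + (m z * w z + l z * p z)))" for z
  have B: "wirtinger B Bp Bq" unfolding B_def
    by (rule wirtinger_cong[OF wirtinger_mult[OF E wirtinger_mult[OF 1(1) wirtinger_cnj[OF wirtinger_add[OF 1(2) wirtinger_mult[OF psi(2) 1(1)]]]]]]) (auto simp: Bp_def Bq_def)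
  have cc: "continuous_on UNIV Ap" "continuous_on UNIV Aq" "continuous_on UNIV Bp" "continuous_on UNIV Bq"
    unfolding Ap_def Aq_def Bp_def Bq_def by (intro continuous_intros cont' lc)+
  have s': "R < norm z \<Longrightarrow> A z = 0" "R < norm z \<Longrightarrow> B z = 0" for z
    using s by (auto simp: A_def B_def)
  have IA: "(LINT z|lborel. Aq z) = 0" by (rule integral_wirtinger_zero(2)[OF A cc(1,2) s'(1)])
  have IB: "(LINT z|lborel. Bp z) = 0" by (rule integral_wirtinger_zero(1)[OF B cc(3,4) s'(2)])
  have o: "open {z::complex. R < norm z}"
    by (intro open_Collect_less continuous_intros)
  have pq0: "p z = 0" "q z = 0" if "R < norm z" for z
    using wirtinger_zero_outside[OF 1(1) o, of z] s that by auto
  have AB0: "Aq z = 0" "Bp z = 0" if "R < norm z" for z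
    using pq0[OF that] s[OF that] by (auto simp: Aq_def Bp_def)
  have iAB: "integrable lborel Aq" "integrable lborel Bp"
    using compact_support_integrable[OF cc(2) AB0(1)] compact_support_integrable[OF cc(3) AB0(2)] by auto
  let ?Q = "\<lambda>z. (norm (q z))^2 * exp (\<psi> z)" 
  let ?G = "\<lambda>z. g z * (norm (w z))^2 * exp (\<psi> z)" 
  let ?P = "\<lambda>z. (norm (p z + l z * w z))^2 * exp (\<psi> z)"
  \<comment> \<open>The terms with mixed second derivatives of \<open>w\<close> cancel between \<open>Aq\<close> and \<open>Bp\<close>.\<close>
  have id: "Aq z - Bp z = of_real (?Q z - ?P z - ?G z)" for z
  proof -
    have sq: "(of_real (norm x))^2 = x * cnj x" for x :: complex
      by (metis complex_norm_square of_real_power)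
    show ?thesis
      unfolding Aq_def Bp_def Er of_real_diff of_real_mult of_real_power sq
      by (simp add: algebra_simps)
  qed
  have ec: "continuous_on UNIV \<psi>"
    using continuous_on_Re[OF wirtinger_continuous[OF psi(1)]] by simp
  have i: "integrable lborel ?Q" "integrable lborel ?G" "integrable lborel ?P"
    by (rule compact_support_integrable[where R=R];
        (intro continuous_intros cont' lc ec | (use pq0 s in auto)))+
  have "of_real (LINT z|lborel. ?Q z - ?P z - ?G z) = (LINT z|lborel. Aq z - Bp z)"
    unfolding id integral_complex_of_real by (rule refl)
  also have "\<dots> = 0" using IA IB iAB by simp
  finally have "(LINT z|lborel. ?Q z - ?P z - ?G z) = 0"
    by (simp only: of_real_eq_0_iff)
  then have "(LINT z|lborel. ?Q z) - (LINT z|lborel. ?P z) - (LINT z|lborel. ?G z) = 0"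
    using i by simp
  moreover have "(LINT z|lborel. ?P z) \<ge> 0" by (intro integral_nonneg_AE) auto
  ultimately show ?thesis by linarith
qed

section \<open>Smooth mollifiers\<close>

text \<open>The usual building block of bump functions, \<open>exp (-1/t)\<close> continued by \<open>0\<close>, with a polynomial in \<open>1/t\<close> in
  front: the factor makes the family closed under differentiation, so that a single derivative formula
  yields derivatives of all orders.\<close>

definition flatexp :: "real poly \<Rightarrow> real \<Rightarrow> real" where
  "flatexp P t = (if t > 0 then poly P (1 / t) * exp (- (1 / t)) else 0)"

lemma poly_over_exp_tendsto_0: "((\<lambda>x::real. poly P x * exp (- x)) \<longlongrightarrow> 0) at_top"
proof -
  have "((\<lambda>x::real. \<Sum>i\<le>degree P. coeff P i * (x ^ i / exp x)) \<longlongrightarrow> (\<Sum>i\<le>degree P. coeff P i * 0)) at_top"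
    by (intro tendsto_intros tendsto_power_div_exp_0)
  then show ?thesis
    by (simp add: poly_altdef sum_distrib_right exp_minus divide_inverse mult.assoc)
qed

lemma flatexp_tendsto_0: "(flatexp P \<longlongrightarrow> 0) (at 0)"
proof -
  have "((\<lambda>t::real. poly P (inverse t) * exp (- inverse t)) \<longlongrightarrow> 0) (at_right 0)"
    by (rule filterlim_compose[OF poly_over_exp_tendsto_0 filterlim_inverse_at_top_right])
  moreover have "\<forall>\<^sub>F t in at_right 0. poly P (inverse t) * exp (- inverse t) = flatexp P t"
    by (auto simp: eventually_at_filter flatexp_def divide_inverse)
  ultimately have "(flatexp P \<longlongrightarrow> 0) (at_right 0)"
    by (rule Lim_transform_eventually)
  moreover have "(flatexp P \<longlongrightarrow> 0) (at_left 0)"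
    by (rule tendsto_eventually) (auto simp: eventually_at_filter flatexp_def)
  ultimately show ?thesis by (simp add: filterlim_split_at)
qed

lemma flatexp_deriv:
  "(flatexp P has_real_derivative flatexp ([:0,0,1:] * (P - pderiv P)) t) (at t)"
proof (cases t "0::real" rule: linorder_cases)
  case less
  show ?thesis
    by (rule has_field_derivative_transform_within_open[where S="{..<0}" and f="\<lambda>_. 0"])
       (use less in \<open>auto simp: flatexp_def\<close>)
next
  case greater
  have "((\<lambda>t. poly P (1 / t) * exp (- (1 / t))) has_real_derivative
     (poly (pderiv P) (1/t) * (- (1 / t^2))) * exp (- (1 / t)) + (exp (- (1 / t)) * (1 / t^2)) * poly P (1/t)) (at t)"
    by (rule derivative_eq_intros DERIV_chain2[OF poly_DERIV] refl | use greater in \<open>simp add: power2_eq_square\<close>)+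
  moreover have "(poly (pderiv P) (1/t) * (- (1 / t^2))) * exp (- (1 / t)) + (exp (- (1 / t)) * (1 / t^2)) * poly P (1/t)
     = flatexp ([:0,0,1:] * (P - pderiv P)) t"
    using greater by (simp add: flatexp_def power2_eq_square field_simps)
  ultimately have "((\<lambda>t. poly P (1 / t) * exp (- (1 / t))) has_real_derivative flatexp ([:0,0,1:] * (P - pderiv P)) t) (at t)"
    by simp
  then show ?thesis
    by (rule has_field_derivative_transform_within_open[where S="{0<..}"])
       (use greater in \<open>auto simp: flatexp_def\<close>)
next
  case equal
  have "((\<lambda>h. flatexp P h / h) \<longlongrightarrow> 0) (at 0)"
  proof (rule Lim_transform_eventually[OF flatexp_tendsto_0[of "pCons 0 P"]])
    show "\<forall>\<^sub>F h in at 0. flatexp (pCons 0 P) h = flatexp P h / h"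
      by (auto simp: eventually_at_filter flatexp_def)
  qed
  then show ?thesis
    using equal by (simp add: DERIV_def flatexp_def)
qed

lemma wirtinger_cmult: "wirtinger f p q \<Longrightarrow> wirtinger (\<lambda>z. k * f z) (\<lambda>z. k * p z) (\<lambda>z. k * q z)"
  by (rule wirtinger_cong[OF wirtinger_mult[OF wirtinger_const[of k]]]) auto

lemma of_real_mult_Re:
  "complex_of_real (x * Re (d * h)) = d / 2 * of_real x * h + cnj d / 2 * of_real x * cnj h"
  by (simp add: complex_eq_iff field_simps)

lemma flatexp_smult: "flatexp (smult k P) t = k * flatexp P t"
  by (simp add: flatexp_def)

text \<open>Composition with a real affine function of the plane. Products of such ridge functions are compactly
  supported bumps, and reflecting or translating them stays within the family.\<close>

lemma wirtinger_flatexp: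
  "wirtinger (\<lambda>z. of_real (flatexp P (c + Re (d * z))))
     (\<lambda>z. d / 2 * of_real (flatexp ([:0,0,1:] * (P - pderiv P)) (c + Re (d * z))))
     (\<lambda>z. cnj d / 2 * of_real (flatexp ([:0,0,1:] * (P - pderiv P)) (c + Re (d * z))))"
  unfolding wirtinger_def
proof
  fix z
  let ?Q = "[:0,0,1:] * (P - pderiv P)"
  have l: "((\<lambda>z. c + Re (d * z)) has_derivative (\<lambda>h. Re (d * h))) (at z)"
    by (auto intro!: derivative_eq_intros)
  have "(flatexp P has_derivative (*) (flatexp ?Q (c + Re (d * z)))) (at (c + Re (d * z)))"
    using flatexp_deriv by (simp add: has_field_derivative_def)
  from has_derivative_compose[OF l this]
  have "((\<lambda>z. flatexp P (c + Re (d * z))) has_derivative (\<lambda>h. flatexp ?Q (c + Re (d * z)) * Re (d * h))) (at z)" .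
  from has_derivative_of_real[OF this]
  have "((\<lambda>z. complex_of_real (flatexp P (c + Re (d * z)))) has_derivative (\<lambda>h. complex_of_real (flatexp ?Q (c + Re (d * z)) * Re (d * h)))) (at z)" .
  moreover have "complex_of_real (flatexp ?Q (c + Re (d * z)) * Re (d * h)) =
     d / 2 * of_real (flatexp ?Q (c + Re (d * z))) * h + cnj d / 2 * of_real (flatexp ?Q (c + Re (d * z))) * cnj h" for h
    by (rule of_real_mult_Re)
  ultimately show "((\<lambda>z. complex_of_real (flatexp P (c + Re (d * z)))) has_derivative
      (\<lambda>h. d / 2 * of_real (flatexp ?Q (c + Re (d * z))) * h + cnj d / 2 * of_real (flatexp ?Q (c + Re (d * z))) * cnj h)) (at z)"
    by simp
qed

lemma wirtinger2_flatexp: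
  "\<exists>p q. wirtinger2 (\<lambda>z. of_real (flatexp P (c + Re (d * z)))) p q"
proof -
  let ?S = "\<lambda>P. [:0,0,1:] * (P - pderiv P)"
  let ?F = "\<lambda>P z. complex_of_real (flatexp P (c + Re (d * z)))"
  note W = wirtinger_flatexp[of _ c d]
  have "continuous_on UNIV (?F (?S (?S P)))" by (rule wirtinger_continuous[OF W])
  then have c: "continuous_on UNIV (\<lambda>z. k * ?F (?S (?S P)) z)" for k
    by (rule continuous_on_mult_left)
  have 1: "wirtinger (\<lambda>z. d/2 * ?F (?S P) z) (\<lambda>z. (d/2 * (d/2)) * ?F (?S (?S P)) z) (\<lambda>z. (d/2 * (cnj d/2)) * ?F (?S (?S P)) z)"
    by (rule wirtinger_cong[OF wirtinger_cmult[OF W[of "?S P"], of "d/2"]]) (auto simp: mult.assoc)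
  have 2: "wirtinger (\<lambda>z. cnj d/2 * ?F (?S P) z) (\<lambda>z. (d/2 * (cnj d/2)) * ?F (?S (?S P)) z) (\<lambda>z. (cnj d/2 * (cnj d/2)) * ?F (?S (?S P)) z)"
    by (rule wirtinger_cong[OF wirtinger_cmult[OF W[of "?S P"], of "cnj d/2"]]) (auto simp: mult_ac)
  show ?thesis unfolding wirtinger2_def using W[of P] 1 2 c by blast
qed

lemma Ck_Suc_imp: "Ck (Suc k) f \<Longrightarrow> Ck k f"
proof (induction k arbitrary: f)
  case 0
  then show ?case
    by (auto intro!: continuous_at_imp_continuous_on differentiable_imp_continuous_within)
next
  case (Suc k)
  then show ?case by simp
qed

lemma Ck_add: "Ck k f \<Longrightarrow> Ck k g \<Longrightarrow> Ck k (\<lambda>x. f x + g x)"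
proof (induction k arbitrary: f g)
  case 0
  then show ?case by (auto intro: continuous_intros)
next
  case (Suc k)
  have "frechet_derivative (\<lambda>x. f x + g x) (at x) b = frechet_derivative f (at x) b + frechet_derivative g (at x) b" for x b
    using Suc.prems
    by (subst frechet_derivative_at[symmetric, OF has_derivative_add])
       (auto simp flip: frechet_derivative_works)
  then show ?case using Suc by (auto intro!: derivative_intros)
qed

lemma Ck_mult:
  fixes f g :: "'a::euclidean_space \<Rightarrow> 'b::real_normed_algebra"
  shows "Ck k f \<Longrightarrow> Ck k g \<Longrightarrow> Ck k (\<lambda>x. f x * g x)"
proof (induction k arbitrary: f g)
  case 0
  then show ?case by (auto intro: continuous_intros)
next
  case (Suc k)
  have "frechet_derivative (\<lambda>x. f x * g x) (at x) b = f x * frechet_derivative g (at x) b + frechet_derivative f (at x) b * g x" for x b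
    using Suc.prems
    by (subst frechet_derivative_at[symmetric, OF has_derivative_mult])
       (auto simp flip: frechet_derivative_works)
  then show ?case using Suc Ck_Suc_imp[OF Suc.prems(1)] Ck_Suc_imp[OF Suc.prems(2)]
    by (auto intro!: derivative_intros Ck_add)
qed

text \<open>The directional derivative only multiplies by the constant \<open>Re (d b)\<close>, which the polynomial absorbs.\<close>

lemma Ck_flatexp: "Ck k (\<lambda>z. complex_of_real (flatexp P (c + Re (d * z))))"
proof (induction k arbitrary: P)
  case 0
  then show ?case using wirtinger_continuous[OF wirtinger_flatexp] by (simp only: Ck.simps)
next
  case (Suc k)
  let ?f = "\<lambda>z. complex_of_real (flatexp P (c + Re (d * z)))"
  have D: "(?f has_derivative (\<lambda>h. d / 2 * of_real (flatexp ([:0,0,1:] * (P - pderiv P)) (c + Re (d * z))) * h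
      + cnj d / 2 * of_real (flatexp ([:0,0,1:] * (P - pderiv P)) (c + Re (d * z))) * cnj h)) (at z)" for z
    using wirtinger_flatexp[of P c d] unfolding wirtinger_def by blast
  have "frechet_derivative ?f (at z) b =
     of_real (flatexp (smult (Re (d * b)) ([:0,0,1:] * (P - pderiv P))) (c + Re (d * z)))" for z b
    unfolding frechet_derivative_at[OF D, symmetric] flatexp_smult
    by (subst mult.commute, rule of_real_mult_Re[symmetric])
  then have "Ck k (\<lambda>x. frechet_derivative ?f (at x) b)" for b
    using Suc by simp
  moreover have "?f differentiable (at z)" for z
    using D by (auto simp: differentiable_def)
  ultimately show ?case by simp
qed

lemma wirtinger2_const: "wirtinger2 (\<lambda>z. k) (\<lambda>z. 0) (\<lambda>z. 0)"
  unfolding wirtinger2_def using wirtinger_const continuous_on_const by blast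

lemma Ck_const: "Ck k (\<lambda>x. c)"
  by (induction k arbitrary: c) auto

text \<open>The product of four ridge functions is supported in the open square \<open>|x|, |y| < \<epsilon>/2\<close>, which lies in
  the disc of radius \<open>\<epsilon>\<close>.\<close>

lemma mollifier_exists:
  assumes "\<epsilon> > 0"
  obtains \<kappa> :: "complex \<Rightarrow> real" and p q where "\<And>z. 0 \<le> \<kappa> z" "\<And>z. \<epsilon> \<le> norm z \<Longrightarrow> \<kappa> z = 0"
    "integrable lborel \<kappa>" "(LINT z|lborel. \<kappa> z) = 1"
    "wirtinger2 (\<lambda>z. of_real (\<kappa> z)) p q"
    "\<And>k w. Ck k (\<lambda>\<zeta>. complex_of_real (\<kappa> (w - \<zeta>)))"
proof -
  define s where "s = 2 / \<epsilon>"
  have s: "s > 0" using assms by (simp add: s_def)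
  define f where "f d z = flatexp 1 (1 + Re (d * z))" for d z
  define \<kappa>0 where "\<kappa>0 z = f s z * f (- s) z * (f (s * \<i>) z * f (- s * \<i>) z)" for z
  have f0: "f d z \<ge> 0" for d z by (simp add: f_def flatexp_def)
  then have nn: "\<kappa>0 z \<ge> 0" for z by (simp add: \<kappa>0_def)
  have supp: "\<kappa>0 z = 0" if "\<epsilon> \<le> norm z" for z
  proof -
    have "\<bar>Re z\<bar> \<ge> \<epsilon>/2 \<or> \<bar>Im z\<bar> \<ge> \<epsilon>/2"
      using cmod_le[of z] that by linarith
    then have "\<bar>s * Re z\<bar> \<ge> 1 \<or> \<bar>s * Im z\<bar> \<ge> 1"
      using assms by (auto simp: s_def abs_mult field_simps)
    then have "1 + s * Re z \<le> 0 \<or> 1 - s * Re z \<le> 0 \<or> 1 + s * Im z \<le> 0 \<or> 1 - s * Im z \<le> 0"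
      by linarith
    then show ?thesis by (auto simp: \<kappa>0_def f_def flatexp_def)
  qed
  obtain pf qf where pq: "\<And>d. wirtinger2 (\<lambda>z. of_real (f d z)) (pf d) (qf d)"
    unfolding f_def using wirtinger2_flatexp[of 1 1] by metis
  have "\<exists>p q. wirtinger2 (\<lambda>z. of_real (\<kappa>0 z)) p q"
    unfolding \<kappa>0_def of_real_mult using wirtinger2_mult[OF wirtinger2_mult[OF pq[of "of_real s"] pq[of "of_real (- s)"]] wirtinger2_mult[OF pq[of "of_real s * \<i>"] pq[of "of_real (- s) * \<i>"]]] by blast
  then obtain p0 q0 where w0: "wirtinger2 (\<lambda>z. of_real (\<kappa>0 z)) p0 q0" by blast
  have cont: "continuous_on UNIV \<kappa>0"
  proof -
    have "continuous_on UNIV (\<lambda>z. complex_of_real (\<kappa>0 z))" using w0 wirtinger_continuous unfolding wirtinger2_def by blast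
    from continuous_on_Re[OF this] show ?thesis by simp
  qed
  have int: "integrable lborel \<kappa>0"
    by (rule compact_support_integrable[OF cont, of \<epsilon>]) (use supp in auto)
  define I where "I = (LINT z|lborel. \<kappa>0 z)"
  have "I \<noteq> 0"
  proof
    assume "I = 0"
    then have "AE z in lborel. \<kappa>0 z = 0"
      using integral_nonneg_eq_0_iff_AE[OF int] nn by (simp add: I_def)
    then have "{z. \<kappa>0 z \<noteq> 0} \<in> null_sets lborel"
      using int by (subst (asm) AE_iff_null) auto
    then have "negligible {z. \<kappa>0 z \<noteq> 0}"
      by (simp add: negligible_iff_null_sets null_sets_completionI)
    moreover have "open {z. \<kappa>0 z \<noteq> 0}" using cont by (intro open_Collect_neq continuous_intros) 
    ultimately have "{z. \<kappa>0 z \<noteq> 0} = {}" 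
      using open_not_negligible by blast
    then have "\<kappa>0 0 = 0" by blast
    then show False by (simp add: \<kappa>0_def f_def flatexp_def)
  qed
  moreover have "I \<ge> 0" unfolding I_def using nn by (intro integral_nonneg_AE) auto
  ultimately have I: "I > 0" by simp
  show ?thesis
  proof (rule that[of "\<lambda>z. \<kappa>0 z / I"])
    show "wirtinger2 (\<lambda>z. complex_of_real (\<kappa>0 z / I)) (\<lambda>z. 0 * of_real (\<kappa>0 z) + of_real (1/I) * p0 z) (\<lambda>z. 0 * of_real (\<kappa>0 z) + of_real (1/I) * q0 z)"
      using wirtinger2_mult[OF wirtinger2_const[of "of_real (1/I)"] w0] by simp
    fix k w
    have "Ck k (\<lambda>\<zeta>. complex_of_real (f d (w - \<zeta>)))" for d
      using Ck_flatexp[of k 1 "1 + Re (d * w)" "- d"] by (simp add: f_def algebra_simps)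
    then have "Ck k (\<lambda>\<zeta>. complex_of_real (\<kappa>0 (w - \<zeta>)))"
      unfolding \<kappa>0_def of_real_mult by (intro Ck_mult)
    moreover have "Ck k (\<lambda>\<zeta>::complex. complex_of_real (1/I))" by (rule Ck_const)
    ultimately have "Ck k (\<lambda>\<zeta>. complex_of_real (1/I) * complex_of_real (\<kappa>0 (w - \<zeta>)))" 
      by (intro Ck_mult)
    then show "Ck k (\<lambda>\<zeta>. complex_of_real (\<kappa>0 (w - \<zeta>) / I))" by simp
  qed (use nn I int supp in \<open>auto simp: I_def\<close>)
qed

section \<open>Convolution with a mollifier\<close>

definition convolve :: "(complex \<Rightarrow> complex) \<Rightarrow> (complex \<Rightarrow> complex) \<Rightarrow> complex \<Rightarrow> complex" where
  "convolve f \<kappa> z = (LINT \<zeta>|lborel. f \<zeta> * \<kappa> (z - \<zeta>))"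

text \<open>The support condition is stated with \<open>\<epsilon> \<le> |z|\<close>, so that only differences of modulus strictly less than \<open>\<epsilon>\<close>
  matter in a convolution.\<close>

definition mollifier :: "real \<Rightarrow> (complex \<Rightarrow> real) \<Rightarrow> bool" where
  "mollifier \<epsilon> \<kappa> \<longleftrightarrow> continuous_on UNIV \<kappa> \<and> (\<forall>z. 0 \<le> \<kappa> z) \<and> (\<forall>z. \<epsilon> \<le> norm z \<longrightarrow> \<kappa> z = 0) \<and> (LINT z|lborel. \<kappa> z) = 1"

lemma compact_support_uniform:
  fixes f :: "complex \<Rightarrow> 'b::real_normed_vector"
  assumes c: "continuous_on UNIV f" and s: "\<And>z. R < norm z \<Longrightarrow> f z = 0" and "e > 0"
  obtains d where "d > 0" "\<And>x y. norm (x - y) < d \<Longrightarrow> norm (f x - f y) < e"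
proof -
  have "uniformly_continuous_on (cball 0 (R + 1)) f"
    by (intro compact_uniformly_continuous continuous_on_subset[OF c]) auto
  then obtain d where d: "d > 0" "\<And>x y. x \<in> cball 0 (R+1) \<Longrightarrow> y \<in> cball 0 (R+1) \<Longrightarrow> dist x y < d \<Longrightarrow> dist (f x) (f y) < e"
    unfolding uniformly_continuous_on_def using \<open>e > 0\<close> by (metis dist_commute)
  show ?thesis
  proof (rule that[of "min d 1"])
    fix x y :: complex assume xy: "norm (x - y) < min d 1"
    have "norm x \<le> norm y + 1" "norm y \<le> norm x + 1"
      using xy norm_triangle_ineq2[of x y] norm_triangle_ineq2[of y x] by (auto simp: norm_minus_commute)
    then show "norm (f x - f y) < e"
      using d(2)[of x y] xy s[of x] s[of y] \<open>e > 0\<close>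
      by (cases "norm x \<le> R"; cases "norm y \<le> R") (auto simp: dist_norm)
  qed (use d in auto)
qed

lemma convolve_integrable:
  fixes f \<kappa> :: "complex \<Rightarrow> complex"
  assumes f: "integrable lborel f" and c: "continuous_on UNIV \<kappa>" and s: "\<And>z. R < norm z \<Longrightarrow> \<kappa> z = 0"
  shows "integrable lborel (\<lambda>\<zeta>. f \<zeta> * \<kappa> (z - \<zeta>))"
proof -
  obtain C where C: "C > 0" "\<And>z. norm (\<kappa> z) \<le> C" using compact_support_bounded[OF c s] by blast
  have [measurable]: "\<kappa> \<in> borel_measurable borel" using c by (rule borel_measurable_continuous_onI)
  have [measurable]: "f \<in> borel_measurable borel" using f by auto
  show ?thesis
  proof (rule Bochner_Integration.integrable_bound)
    show "integrable lborel (\<lambda>\<zeta>. of_real C * f \<zeta>)" using f by simp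
    show "AE \<zeta> in lborel. norm (f \<zeta> * \<kappa> (z - \<zeta>)) \<le> norm (of_real C * f \<zeta>)"
      using C by (auto simp: norm_mult mult.commute[of C] intro!: AE_I2 mult_left_mono)
  qed measurable
qed

lemma convolve_norm_le:
  fixes f g :: "complex \<Rightarrow> complex"
  assumes f: "integrable lborel f" and g: "integrable lborel (\<lambda>\<zeta>. f \<zeta> * g \<zeta>)" and b: "\<And>\<zeta>. norm (g \<zeta>) \<le> B"
  shows "norm (LINT \<zeta>|lborel. f \<zeta> * g \<zeta>) \<le> (LINT \<zeta>|lborel. norm (f \<zeta>)) * B"
proof -
  have "norm (LINT \<zeta>|lborel. f \<zeta> * g \<zeta>) \<le> (LINT \<zeta>|lborel. norm (f \<zeta>) * B)"
    by (rule Bochner_Integration.integral_norm_bound_integral)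
       (use f g b in \<open>auto simp: norm_mult intro: mult_left_mono\<close>)
  then show ?thesis by simp
qed

lemma convolve_continuous:
  fixes f \<kappa> :: "complex \<Rightarrow> complex"
  assumes f: "integrable lborel f" and c: "continuous_on UNIV \<kappa>" and s: "\<And>z. R < norm z \<Longrightarrow> \<kappa> z = 0"
  shows "continuous_on UNIV (convolve f \<kappa>)"
  unfolding continuous_on_iff
proof (intro ballI allI impI)
  fix x :: complex and e :: real assume "e > 0"
  define N where "N = (LINT \<zeta>|lborel. norm (f \<zeta>)) + 1"
  have N: "N > 0" unfolding N_def by (smt (verit) integral_nonneg_AE AE_I2 norm_ge_zero)
  obtain d where d: "d > 0" "\<And>x y. norm (x - y) < d \<Longrightarrow> norm (\<kappa> x - \<kappa> y) < e / N"
    using compact_support_uniform[OF c s, where e="e/N"] N \<open>e > 0\<close> by auto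
  show "\<exists>d>0. \<forall>x'\<in>UNIV. dist x' x < d \<longrightarrow> dist (convolve f \<kappa> x') (convolve f \<kappa> x) < e"
  proof (intro exI[of _ d] conjI d ballI impI)
    fix x' assume "dist x' x < d"
    then have *: "norm (\<kappa> (x' - \<zeta>) - \<kappa> (x - \<zeta>)) \<le> e / N" for \<zeta>
      using d(2)[of "x' - \<zeta>" "x - \<zeta>"] by (simp add: dist_norm)
    have i: "integrable lborel (\<lambda>\<zeta>. f \<zeta> * \<kappa> (z - \<zeta>))" for z by (rule convolve_integrable[OF f c s])
    have "convolve f \<kappa> x' - convolve f \<kappa> x = (LINT \<zeta>|lborel. f \<zeta> * (\<kappa> (x' - \<zeta>) - \<kappa> (x - \<zeta>)))"
      using i by (simp add: convolve_def right_diff_distrib)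
    also have "norm \<dots> \<le> (LINT \<zeta>|lborel. norm (f \<zeta>)) * (e / N)"
      by (rule convolve_norm_le[OF f _ *]) (use i in \<open>simp add: right_diff_distrib\<close>)
    also have "\<dots> < N * (e / N)"
      using N \<open>e > 0\<close> by (intro mult_strict_right_mono) (auto simp: N_def)
    finally show "dist (convolve f \<kappa> x') (convolve f \<kappa> x) < e" using N by (simp add: dist_norm)
  qed
qed

text \<open>Uniform continuity of \<open>p\<close> and \<open>q\<close> makes the first-order Taylor remainder of \<open>\<kappa>\<close> at most \<open>e |h|\<close>, uniformly in the
  base point, for small \<open>h\<close>; integrating it against \<open>f\<close> costs only the \<open>L\<^sup>1\<close> norm of \<open>f\<close>.\<close>

lemma convolve_wirtinger:
  assumes f: "integrable lborel f" and w: "wirtinger \<kappa> p q"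
    and c: "continuous_on UNIV p" "continuous_on UNIV q" and s: "\<And>z. R < norm z \<Longrightarrow> \<kappa> z = 0"
  shows "wirtinger (convolve f \<kappa>) (convolve f p) (convolve f q)"
  unfolding wirtinger_def
proof
  fix z
  have o: "open {z::complex. R < norm z}"
    by (intro open_Collect_less continuous_intros)
  have s': "p z = 0" "q z = 0" if "R < norm z" for z
    using wirtinger_zero_outside[OF w o, of z] s that by auto
  define N where "N = (LINT \<zeta>|lborel. norm (f \<zeta>)) + 1"
  have N: "N > 0" unfolding N_def by (smt (verit) integral_nonneg_AE AE_I2 norm_ge_zero)
  note i = convolve_integrable[OF f wirtinger_continuous[OF w] s] convolve_integrable[OF f c(1) s'(1)] convolve_integrable[OF f c(2) s'(2)]
  show "(convolve f \<kappa> has_derivative (\<lambda>h. convolve f p z * h + convolve f q z * cnj h)) (at z)"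
    unfolding has_derivative_at_alt
  proof (intro conjI allI impI)
    show "bounded_linear (\<lambda>h. convolve f p z * h + convolve f q z * cnj h)"
      by (intro bounded_linear_intros bounded_linear_compose[OF bounded_linear_mult_right bounded_linear_cnj])
    fix e :: real assume "e > 0"
    obtain d1 where d1: "d1 > 0" "\<And>x y. norm (x - y) < d1 \<Longrightarrow> norm (p x - p y) < e / N / 2"
      using compact_support_uniform[OF c(1) s'(1), where e="e/N/2"] N \<open>e > 0\<close> by auto
    obtain d2 where d2: "d2 > 0" "\<And>x y. norm (x - y) < d2 \<Longrightarrow> norm (q x - q y) < e / N / 2"
      using compact_support_uniform[OF c(2) s'(2), where e="e/N/2"] N \<open>e > 0\<close> by auto
    define d where "d = min d1 d2"
    \<comment> \<open>The mean value inequality, applied to \<open>\<kappa>\<close> minus its linear part at \<open>x\<close>.\<close>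
    have lin: "norm (\<kappa> (x + h) - \<kappa> x - (p x * h + q x * cnj h)) \<le> norm h * (e / N)" if "norm h < d" for x h
    proof -
      have "norm (\<kappa> (x + h) - \<kappa> x - (\<lambda>h. p x * h + q x * cnj h) ((x + h) - x)) \<le> norm ((x + h) - x) * (e / N)"
      proof (rule differentiable_bound_linearization[where S="ball x d" and f'="\<lambda>x h. p x * h + q x * cnj h"])
        show "x + t *\<^sub>R (x + h - x) \<in> ball x d" if "t \<in> {0..1}" for t
          using that \<open>norm h < d\<close> mult_left_le_one_le[of "norm h" t] by (auto simp: dist_norm)
        show "(\<kappa> has_derivative (\<lambda>h. p y * h + q y * cnj h)) (at y within ball x d)" for y
          using w unfolding wirtinger_def by (auto intro: has_derivative_at_withinI)
        show "onorm ((\<lambda>h. p y * h + q y * cnj h) - (\<lambda>h. p x * h + q x * cnj h)) \<le> e / N" if "y \<in> ball x d" for y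
        proof (rule onorm_bound)
          fix h :: complex
          have "norm (p y - p x) < e/N/2" "norm (q y - q x) < e/N/2"
            using that d1(2)[of y x] d2(2)[of y x] by (auto simp: d_def dist_norm norm_minus_commute)
          then have "norm (p y - p x) * norm h \<le> e/N/2 * norm h" "norm (q y - q x) * norm h \<le> e/N/2 * norm h"
            by (meson less_imp_le mult_right_mono norm_ge_zero)+
          then have "norm ((p y - p x) * h) \<le> e/N/2 * norm h" "norm ((q y - q x) * cnj h) \<le> e/N/2 * norm h"
            by (simp_all add: norm_mult)
          then have "norm ((p y - p x) * h + (q y - q x) * cnj h) \<le> e/N/2 * norm h + e/N/2 * norm h"
            by (intro norm_triangle_mono)
          then show "norm (((\<lambda>h. p y * h + q y * cnj h) - (\<lambda>h. p x * h + q x * cnj h)) h) \<le> e / N * norm h"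
            by (simp add: algebra_simps)
        qed (use N \<open>e > 0\<close> in auto)
        show "x \<in> ball x d" using d1 d2 by (simp add: d_def)
      qed
      then show ?thesis by simp
    qed
    show "\<exists>d>0. \<forall>y. norm (y - z) < d \<longrightarrow> norm (convolve f \<kappa> y - convolve f \<kappa> z - (convolve f p z * (y - z) + convolve f q z * cnj (y - z))) \<le> e * norm (y - z)"
    proof (intro exI[of _ d] conjI allI impI)
      show "d > 0" using d1 d2 by (simp add: d_def)
      fix y assume y: "norm (y - z) < d"
      define G where "G \<zeta> = \<kappa> (y - \<zeta>) - \<kappa> (z - \<zeta>) - (p (z - \<zeta>) * (y - z) + q (z - \<zeta>) * cnj (y - z))" for \<zeta>
      have G: "norm (G \<zeta>) \<le> norm (y - z) * (e / N)" for \<zeta>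
        using lin[OF y, of "z - \<zeta>"] by (simp add: G_def algebra_simps)
      have fG: "f \<zeta> * G \<zeta> = f \<zeta> * \<kappa> (y - \<zeta>) - f \<zeta> * \<kappa> (z - \<zeta>) - (f \<zeta> * p (z - \<zeta>) * (y - z) + f \<zeta> * q (z - \<zeta>) * cnj (y - z))" for \<zeta>
        by (simp add: G_def algebra_simps)
      have "convolve f \<kappa> y - convolve f \<kappa> z - (convolve f p z * (y - z) + convolve f q z * cnj (y - z)) = (LINT \<zeta>|lborel. f \<zeta> * G \<zeta>)"
        unfolding fG using i by (simp add: convolve_def del: complex_cnj_diff)
      also have "norm \<dots> \<le> (LINT \<zeta>|lborel. norm (f \<zeta>)) * (norm (y - z) * (e / N))"
        by (rule convolve_norm_le[OF f _ G]) (use i in \<open>simp add: fG del: complex_cnj_diff\<close>)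
      also have "\<dots> \<le> N * (norm (y - z) * (e / N))"
        using N \<open>e > 0\<close> by (intro mult_right_mono) (auto simp: N_def)
      also have "\<dots> = e * norm (y - z)" using N by simp
      finally show "norm (convolve f \<kappa> y - convolve f \<kappa> z - (convolve f p z * (y - z) + convolve f q z * cnj (y - z))) \<le> e * norm (y - z)" .
    qed
  qed
qed

lemma convolve_wirtinger2:
  assumes f: "integrable lborel f" and w: "wirtinger2 \<kappa> p q" and s: "\<And>z. R < norm z \<Longrightarrow> \<kappa> z = 0"
  shows "wirtinger2 (convolve f \<kappa>) (convolve f p) (convolve f q)"
proof -
  obtain a r c where 1: "wirtinger \<kappa> p q" "wirtinger p a r" "wirtinger q r c" "continuous_on UNIV a" "continuous_on UNIV r" "continuous_on UNIV c"
    using w unfolding wirtinger2_def by blast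
  have o: "open {z::complex. R < norm z}"
    by (intro open_Collect_less continuous_intros)
  have s1: "p z = 0" "q z = 0" if "R < norm z" for z
    using wirtinger_zero_outside[OF 1(1) o, of z] s that by auto
  have s2: "a z = 0" "r z = 0" "c z = 0" if "R < norm z" for z
    using wirtinger_zero_outside[OF 1(2) o, of z] wirtinger_zero_outside[OF 1(3) o, of z] s1 that by auto
  show ?thesis unfolding wirtinger2_def
    using convolve_wirtinger[OF f 1(1) wirtinger_continuous[OF 1(2)] wirtinger_continuous[OF 1(3)] s]
      convolve_wirtinger[OF f 1(2) 1(4,5) s1(1)] convolve_wirtinger[OF f 1(3) 1(5,6) s1(2)]
      convolve_continuous[OF f 1(4) s2(1)] convolve_continuous[OF f 1(5) s2(2)] convolve_continuous[OF f 1(6) s2(3)]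
    by blast
qed

lemma wirtinger_reflect:
  assumes "wirtinger \<kappa> p q"
  shows "wirtinger (\<lambda>\<zeta>. \<kappa> (w - \<zeta>)) (\<lambda>\<zeta>. - p (w - \<zeta>)) (\<lambda>\<zeta>. - q (w - \<zeta>))"
  unfolding wirtinger_def
proof
  fix z
  have k: "(\<kappa> has_derivative (\<lambda>h. p (w - z) * h + q (w - z) * cnj h)) (at (w - z))"
    using assms unfolding wirtinger_def by auto
  have "((\<lambda>\<zeta>. w - \<zeta>) has_derivative (\<lambda>h. - h)) (at z)" by (auto intro!: derivative_eq_intros)
  from has_derivative_eq_rhs[OF has_derivative_compose[OF this k]]
  show "((\<lambda>\<zeta>. \<kappa> (w - \<zeta>)) has_derivative (\<lambda>h. - p (w - z) * h + - q (w - z) * cnj h)) (at z)"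
    by auto
qed

text \<open>The reflected kernel is the test function: the sign from reflecting cancels the sign in the
  definition of a weak derivative.\<close>

lemma convolve_weak:
  assumes "wirtinger \<kappa> p q"
    and "(LINT \<zeta>|lborel. f \<zeta> * dbar (\<lambda>\<zeta>. \<kappa> (w - \<zeta>)) \<zeta>) = - (LINT \<zeta>|lborel. F \<zeta> * \<kappa> (w - \<zeta>))"
  shows "convolve f q w = convolve F \<kappa> w"
  using assms(2) wirtinger_dbar[OF wirtinger_reflect[OF assms(1)]] by (simp add: convolve_def)

lemma nn_integral_reflect:
  fixes f :: "complex \<Rightarrow> ennreal"
  assumes [measurable]: "f \<in> borel_measurable borel"
  shows "(\<integral>\<^sup>+ \<zeta>. f (w - \<zeta>) \<partial>lborel) = (\<integral>\<^sup>+ z. f z \<partial>lborel)" "(\<integral>\<^sup>+ z. f (z - w) \<partial>lborel) = (\<integral>\<^sup>+ z. f z \<partial>lborel)"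
proof -
  have e1: "lborel = distr lborel borel (\<lambda>x. w - x)"
    using lborel_affine[of "-1" w] by (simp add: density_1)
  have e2: "lborel = distr lborel borel (\<lambda>x. x - w)"
    using lborel_affine[of "1" "- w"] by (simp add: density_1)
  show "(\<integral>\<^sup>+ \<zeta>. f (w - \<zeta>) \<partial>lborel) = (\<integral>\<^sup>+ z. f z \<partial>lborel)"
    using arg_cong[OF e1, of "\<lambda>M. integral\<^sup>N M f"] by (simp add: nn_integral_distr)
  show "(\<integral>\<^sup>+ z. f (z - w) \<partial>lborel) = (\<integral>\<^sup>+ z. f z \<partial>lborel)"
    using arg_cong[OF e2, of "\<lambda>M. integral\<^sup>N M f"] by (simp add: nn_integral_distr)
qed

lemma mollifier_nn_integral:
  assumes "mollifier \<epsilon> \<kappa>"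
  shows "(\<integral>\<^sup>+ z. ennreal (\<kappa> z) \<partial>lborel) = 1" "integrable lborel \<kappa>" "\<kappa> \<in> borel_measurable borel"
proof -
  have c: "continuous_on UNIV \<kappa>" and s: "\<And>z. \<epsilon> < norm z \<Longrightarrow> \<kappa> z = 0" and n: "\<And>z. 0 \<le> \<kappa> z" and 1: "(LINT z|lborel. \<kappa> z) = 1"
    using assms by (auto simp: mollifier_def)
  show i: "integrable lborel \<kappa>" by (rule compact_support_integrable[OF c s])
  show "(\<integral>\<^sup>+ z. ennreal (\<kappa> z) \<partial>lborel) = 1"
    using nn_integral_eq_integral[OF i] n 1 by simp
  show "\<kappa> \<in> borel_measurable borel" using c by (rule borel_measurable_continuous_onI)
qed

text \<open>Convolution by a mollifier is moved from \<open>k\<close> to the weight \<open>h\<close>, and there it changes values by at most the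
  oscillation \<open>\<omega>\<close> of \<open>h\<close> at scale \<open>\<epsilon>\<close>.\<close>

lemma mollifier_Fubini:
  fixes k :: "complex \<Rightarrow> real" and h :: "complex \<Rightarrow> real"
  assumes m: "mollifier \<epsilon> \<kappa>" and [measurable]: "k \<in> borel_measurable borel" "h \<in> borel_measurable borel"
    and k: "\<And>z. k z \<ge> 0" and h: "\<And>z. h z \<ge> 0" "\<omega> \<ge> 0" "\<And>x y. norm (x - y) < \<epsilon> \<Longrightarrow> h x \<le> h y + \<omega>"
  shows "(\<integral>\<^sup>+ z. (\<integral>\<^sup>+ \<zeta>. ennreal (k \<zeta> * \<kappa> (z - \<zeta>)) \<partial>lborel) * ennreal (h z) \<partial>lborel) \<le> (\<integral>\<^sup>+ \<zeta>. ennreal (k \<zeta> * (h \<zeta> + \<omega>)) \<partial>lborel)"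
proof -
  note [measurable] = mollifier_nn_integral(3)[OF m]
  have kn: "\<kappa> z \<ge> 0" for z using m by (simp add: mollifier_def)
  have "(\<integral>\<^sup>+ z. (\<integral>\<^sup>+ \<zeta>. ennreal (k \<zeta> * \<kappa> (z - \<zeta>)) \<partial>lborel) * ennreal (h z) \<partial>lborel)
     = (\<integral>\<^sup>+ z. (\<integral>\<^sup>+ \<zeta>. ennreal (k \<zeta> * \<kappa> (z - \<zeta>)) * ennreal (h z) \<partial>lborel) \<partial>lborel)"
    by (simp add: nn_integral_multc)
  also have "\<dots> = (\<integral>\<^sup>+ \<zeta>. (\<integral>\<^sup>+ z. ennreal (k \<zeta> * \<kappa> (z - \<zeta>)) * ennreal (h z) \<partial>lborel) \<partial>lborel)"
    by (rule lborel_pair.Fubini') simp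
  also have "\<dots> \<le> (\<integral>\<^sup>+ \<zeta>. ennreal (k \<zeta> * (h \<zeta> + \<omega>)) \<partial>lborel)"
  proof (rule nn_integral_mono)
    fix \<zeta>
    have "(\<integral>\<^sup>+ z. ennreal (k \<zeta> * \<kappa> (z - \<zeta>)) * ennreal (h z) \<partial>lborel) \<le> (\<integral>\<^sup>+ z. ennreal (k \<zeta> * (h \<zeta> + \<omega>)) * ennreal (\<kappa> (z - \<zeta>)) \<partial>lborel)"
    proof (rule nn_integral_mono)
      fix z
      have "\<kappa> (z - \<zeta>) * h z \<le> \<kappa> (z - \<zeta>) * (h \<zeta> + \<omega>)"
        using h(3)[of z \<zeta>] kn m by (cases "norm (z - \<zeta>) < \<epsilon>") (auto simp: mollifier_def intro: mult_left_mono)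
      then have "k \<zeta> * (\<kappa> (z - \<zeta>) * h z) \<le> k \<zeta> * (\<kappa> (z - \<zeta>) * (h \<zeta> + \<omega>))"
        by (rule mult_left_mono[OF _ k])
      then show "ennreal (k \<zeta> * \<kappa> (z - \<zeta>)) * ennreal (h z) \<le> ennreal (k \<zeta> * (h \<zeta> + \<omega>)) * ennreal (\<kappa> (z - \<zeta>))"
        using k kn h by (subst (1 2) ennreal_mult[symmetric]) (auto simp: mult_ac intro!: ennreal_leI)
    qed
    also have "\<dots> = ennreal (k \<zeta> * (h \<zeta> + \<omega>)) * (\<integral>\<^sup>+ z. ennreal (\<kappa> (z - \<zeta>)) \<partial>lborel)"
      by (simp add: nn_integral_cmult)
    also have "\<dots> = ennreal (k \<zeta> * (h \<zeta> + \<omega>))"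
      using nn_integral_reflect(2)[of "\<lambda>z. ennreal (\<kappa> z)"] mollifier_nn_integral(1)[OF m] by simp
    finally show "(\<integral>\<^sup>+ z. ennreal (k \<zeta> * \<kappa> (z - \<zeta>)) * ennreal (h z) \<partial>lborel) \<le> ennreal (k \<zeta> * (h \<zeta> + \<omega>))" .
  qed
  finally show ?thesis .
qed

text \<open>With \<open>J = |f * \<kappa>|(z)\<close>, integrating \<open>2 J |f| \<le> |f|\<^sup>2 + J\<^sup>2\<close> against the probability density \<open>\<kappa> (z - \<cdot>)\<close> gives
  \<open>2 J\<^sup>2 \<le> \<integral> |f|\<^sup>2 \<kappa> (z - \<cdot>) + J\<^sup>2\<close>.\<close>

lemma convolve_Jensen:
  assumes m: "mollifier \<epsilon> \<kappa>" and f: "integrable lborel f"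
  shows "ennreal ((norm (convolve f (\<lambda>z. of_real (\<kappa> z)) z))^2) \<le> (\<integral>\<^sup>+ \<zeta>. ennreal ((norm (f \<zeta>))^2 * \<kappa> (z - \<zeta>)) \<partial>lborel)"
    and "ennreal (norm (convolve f (\<lambda>z. of_real (\<kappa> z)) z)) \<le> (\<integral>\<^sup>+ \<zeta>. ennreal (norm (f \<zeta>) * \<kappa> (z - \<zeta>)) \<partial>lborel)"
proof -
  note [measurable] = mollifier_nn_integral(3)[OF m]
  have [measurable]: "f \<in> borel_measurable borel" using f by auto
  have kn: "\<kappa> z \<ge> 0" for z using m by (simp add: mollifier_def)
  have c: "continuous_on UNIV \<kappa>" and s: "\<And>z. \<epsilon> < norm z \<Longrightarrow> \<kappa> z = 0"
    using m by (auto simp: mollifier_def)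
  have i: "integrable lborel (\<lambda>\<zeta>. f \<zeta> * of_real (\<kappa> (z - \<zeta>)))"
    by (rule convolve_integrable[OF f, of "\<lambda>z. of_real (\<kappa> z)" \<epsilon>]) (use c s in \<open>auto intro: continuous_intros\<close>)
  define J where "J = norm (convolve f (\<lambda>z. of_real (\<kappa> z)) z)"
  have i': "integrable lborel (\<lambda>\<zeta>. norm (f \<zeta>) * \<kappa> (z - \<zeta>))"
    using integrable_norm[OF i] kn by (simp add: norm_mult)
  have J: "J \<le> (LINT \<zeta>|lborel. norm (f \<zeta>) * \<kappa> (z - \<zeta>))"
    using integral_norm_bound[of lborel "\<lambda>\<zeta>. f \<zeta> * of_real (\<kappa> (z - \<zeta>))"] kn by (simp add: J_def convolve_def norm_mult)
  have 2: "(\<integral>\<^sup>+ \<zeta>. ennreal (norm (f \<zeta>) * \<kappa> (z - \<zeta>)) \<partial>lborel) = ennreal (LINT \<zeta>|lborel. norm (f \<zeta>) * \<kappa> (z - \<zeta>))"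
    using i' kn by (intro nn_integral_eq_integral) auto
  then show "ennreal J \<le> (\<integral>\<^sup>+ \<zeta>. ennreal (norm (f \<zeta>) * \<kappa> (z - \<zeta>)) \<partial>lborel)"
    using J by (simp add: ennreal_leI)
  have J0: "J \<ge> 0" by (simp add: J_def)
  have k1: "(\<integral>\<^sup>+ \<zeta>. ennreal (\<kappa> (z - \<zeta>)) \<partial>lborel) = 1"
    using nn_integral_reflect(1)[of "\<lambda>z. ennreal (\<kappa> z)"] mollifier_nn_integral(1)[OF m] by simp
  let ?I = "\<integral>\<^sup>+ \<zeta>. ennreal ((norm (f \<zeta>))^2 * \<kappa> (z - \<zeta>)) \<partial>lborel"
  have "ennreal (J^2) + ennreal (J^2) \<le> ennreal (2 * J * (LINT \<zeta>|lborel. norm (f \<zeta>) * \<kappa> (z - \<zeta>)))"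
    using mult_left_mono[OF J J0] J0 by (simp add: power2_eq_square flip: ennreal_plus) (simp add: ennreal_leI)
  also have "\<dots> = (\<integral>\<^sup>+ \<zeta>. ennreal (2 * J) * ennreal (norm (f \<zeta>) * \<kappa> (z - \<zeta>)) \<partial>lborel)"
    using J0 by (subst nn_integral_cmult) (simp_all add: 2[symmetric] ennreal_mult' 2)
  also have "\<dots> \<le> (\<integral>\<^sup>+ \<zeta>. ennreal ((norm (f \<zeta>))^2 * \<kappa> (z - \<zeta>)) + ennreal (J^2) * ennreal (\<kappa> (z - \<zeta>)) \<partial>lborel)"
  proof (rule nn_integral_mono)
    fix \<zeta>
    have "0 \<le> (norm (f \<zeta>) - J)^2" by simp
    then have "2 * J * norm (f \<zeta>) \<le> (norm (f \<zeta>))^2 + J^2" by (simp add: power2_eq_square algebra_simps)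
    from mult_right_mono[OF this kn, of "z - \<zeta>"]
    have "2 * J * (norm (f \<zeta>) * \<kappa> (z - \<zeta>)) \<le> (norm (f \<zeta>))^2 * \<kappa> (z - \<zeta>) + J^2 * \<kappa> (z - \<zeta>)"
      by (simp add: algebra_simps)
    then show "ennreal (2 * J) * ennreal (norm (f \<zeta>) * \<kappa> (z - \<zeta>)) \<le> ennreal ((norm (f \<zeta>))^2 * \<kappa> (z - \<zeta>)) + ennreal (J^2) * ennreal (\<kappa> (z - \<zeta>))"
      using J0 kn by (simp flip: ennreal_mult ennreal_plus)
  qed
  also have "\<dots> = ?I + ennreal (J^2)"
    by (simp add: nn_integral_add nn_integral_cmult k1)
  finally show "ennreal (J^2) \<le> ?I"
    by (simp add: ennreal_add_left_cancel_le add.commute)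
qed

lemma convolve_L2_weighted:
  assumes m: "mollifier \<epsilon> \<kappa>" and f: "integrable lborel f"
    and h: "h \<in> borel_measurable borel" "\<And>z. h z \<ge> 0" "\<omega> \<ge> 0" "\<And>x y. norm (x - y) < \<epsilon> \<Longrightarrow> h x \<le> h y + \<omega>"
  shows "(\<integral>\<^sup>+ z. ennreal ((norm (convolve f (\<lambda>z. of_real (\<kappa> z)) z))^2 * h z) \<partial>lborel) \<le> (\<integral>\<^sup>+ \<zeta>. ennreal ((norm (f \<zeta>))^2 * (h \<zeta> + \<omega>)) \<partial>lborel)"
proof -
  have [measurable]: "f \<in> borel_measurable borel" using f by auto
  have "(\<integral>\<^sup>+ z. ennreal ((norm (convolve f (\<lambda>z. of_real (\<kappa> z)) z))^2 * h z) \<partial>lborel)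
    \<le> (\<integral>\<^sup>+ z. (\<integral>\<^sup>+ \<zeta>. ennreal ((norm (f \<zeta>))^2 * \<kappa> (z - \<zeta>)) \<partial>lborel) * ennreal (h z) \<partial>lborel)"
    using convolve_Jensen(1)[OF m f] h(2) by (intro nn_integral_mono) (auto simp: ennreal_mult intro: mult_right_mono)
  also have "\<dots> \<le> (\<integral>\<^sup>+ \<zeta>. ennreal ((norm (f \<zeta>))^2 * (h \<zeta> + \<omega>)) \<partial>lborel)"
    by (rule mollifier_Fubini[OF m _ h(1) _ h(2-4)]) auto
  finally show ?thesis .
qed

lemma convolve_L1:
  assumes m: "mollifier \<epsilon> \<kappa>" and f: "integrable lborel f"
  shows "(\<integral>\<^sup>+ z. ennreal (norm (convolve f (\<lambda>z. of_real (\<kappa> z)) z)) \<partial>lborel) \<le> (\<integral>\<^sup>+ \<zeta>. ennreal (norm (f \<zeta>)) \<partial>lborel)"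
proof -
  have [measurable]: "f \<in> borel_measurable borel" using f by auto
  have "(\<integral>\<^sup>+ z. ennreal (norm (convolve f (\<lambda>z. of_real (\<kappa> z)) z)) \<partial>lborel)
    \<le> (\<integral>\<^sup>+ z. (\<integral>\<^sup>+ \<zeta>. ennreal (norm (f \<zeta>) * \<kappa> (z - \<zeta>)) \<partial>lborel) * ennreal 1 \<partial>lborel)"
    using convolve_Jensen(2)[OF m f] by (intro nn_integral_mono) auto
  also have "\<dots> \<le> (\<integral>\<^sup>+ \<zeta>. ennreal (norm (f \<zeta>) * (1 + 0)) \<partial>lborel)"
    by (rule mollifier_Fubini[OF m]) auto
  finally show ?thesis by simp
qed


text \<open>Outer regularity of the complement, after a large ball has been split off.\<close>

lemma borel_inner_compact:
  fixes A :: "complex set"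
  assumes A: "A \<in> sets borel" "emeasure lborel A < \<infinity>" and e: "e > (0::real)"
  obtains K where "compact K" "K \<subseteq> A" "emeasure lborel (A - K) < e"
proof -
  obtain B where B: "compact B" "emeasure lborel (A - B) < ennreal (e/2)" 
  proof -
    have "(\<lambda>n. emeasure lborel (A - cball 0 (real n))) \<longlonglongrightarrow> emeasure lborel (\<Inter>n. A - cball 0 (real n))"
    proof (rule Lim_emeasure_decseq)
      show "range (\<lambda>n. A - cball 0 (real n)) \<subseteq> sets lborel" using A by auto
      show "decseq (\<lambda>n. A - cball 0 (real n))" by (auto simp: decseq_def)
      show "emeasure lborel (A - cball 0 (real n)) \<noteq> \<infinity>" for n
        using A emeasure_mono[of "A - cball 0 (real n)" A lborel] by (auto simp: less_top top_unique)
    qed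
    moreover have "(\<Inter>n. A - cball 0 (real n)) = {}"
      using real_arch_simple by fastforce
    ultimately have "(\<lambda>n. emeasure lborel (A - cball 0 (real n))) \<longlonglongrightarrow> 0"
      by (simp only: emeasure_empty)
    then have "\<forall>\<^sub>F n in sequentially. emeasure lborel (A - cball 0 (real n)) < ennreal (e/2)"
      using e by (intro order_tendstoD(2)) auto
    then obtain n where "emeasure lborel (A - cball 0 (real n)) < ennreal (e/2)"
      by (meson eventually_sequentially order_refl)
    then show ?thesis using that[OF compact_cball] by blast
  qed
  have "- A \<in> sets borel" using A by auto
  then obtain U where U: "open U" "- A \<subseteq> U" "emeasure lborel (U - (- A)) < ennreal (e/2)"
    using outer_regular_lborel[of "- A" "e/2"] e by auto
  show ?thesis
  proof (rule that[of "B - U"])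
    show "compact (B - U)" using B U by (intro compact_diff) auto
    show "B - U \<subseteq> A" using U by auto
    have "A - (B - U) \<subseteq> (A - B) \<union> (U - (- A))" by auto
    then have "emeasure lborel (A - (B - U)) \<le> emeasure lborel ((A - B) \<union> (U - (- A)))"
      using A B U by (intro emeasure_mono) (auto simp: compact_imp_closed)
    also have "\<dots> \<le> emeasure lborel (A - B) + emeasure lborel (U - (- A))"
      using A B U by (intro emeasure_subadditive) (auto simp: compact_imp_closed)
    also have "\<dots> < ennreal (e/2) + ennreal (e/2)"
      using B U by (intro add_strict_mono)
    also have "\<dots> = ennreal e" using e by (simp flip: ennreal_plus)
    finally show "emeasure lborel (A - (B - U)) < ennreal e" .
  qed
qed

text \<open>For an indicator, squeeze the set between a compact and an open set and interpolate with Urysohn's lemma;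
  sums and dominated limits follow.\<close>

lemma L1_dense_continuous:
  fixes f :: "complex \<Rightarrow> complex"
  assumes "integrable lborel f" "e > (0::real)"
  shows "\<exists>g R. continuous_on UNIV g \<and> (\<forall>z. R < norm z \<longrightarrow> g z = 0) \<and> (\<integral>\<^sup>+ z. ennreal (norm (f z - g z)) \<partial>lborel) < e"
  using assms
proof (induction f arbitrary: e rule: integrable_induct)
  case (base A c)
  define d where "d = e / (2 * (norm c + 1))"
  have d: "d > 0" using base by (simp add: d_def add_nonneg_pos)
  obtain K where K: "compact K" "K \<subseteq> A" "emeasure lborel (A - K) < ennreal d"
    using borel_inner_compact[OF _ _ d, of A] base by auto
  obtain U where U: "open U" "A \<subseteq> U" "emeasure lborel (U - A) < ennreal d"
    using outer_regular_lborel[of A d] d base by auto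
  obtain R where R: "K \<subseteq> ball 0 R" using K(1)
    by (meson bounded_subset_ballD compact_imp_bounded)
  obtain g :: "complex \<Rightarrow> complex" where g: "continuous_on UNIV g" "\<And>x. g x \<in> closed_segment c 0" "\<And>x. x \<in> K \<Longrightarrow> g x = c" "\<And>x. x \<in> - (U \<inter> ball 0 R) \<Longrightarrow> g x = 0"
    by (rule Urysohn[of K "- (U \<inter> ball 0 R)" c 0]) (use K U R in \<open>auto simp: compact_imp_closed closed_Compl open_Int\<close>)
  have gc: "norm (g x) \<le> norm c" "norm (c - g x) \<le> norm c" for x
    using g(2)[of x] segment_bound[of "g x" c 0] by (auto simp: norm_minus_commute)
  have [measurable]: "U \<in> sets borel" "A \<in> sets borel" "K \<in> sets borel" using U base K by (auto simp: compact_imp_closed)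
  have "(\<integral>\<^sup>+ z. ennreal (norm (indicator A z *\<^sub>R c - g z)) \<partial>lborel) \<le> (\<integral>\<^sup>+ z. ennreal (norm c) * indicator ((U - A) \<union> (A - K)) z \<partial>lborel)"
  proof (intro nn_integral_mono)
    fix z
    show "ennreal (norm (indicator A z *\<^sub>R c - g z)) \<le> ennreal (norm c) * indicator ((U - A) \<union> (A - K)) z"
      using gc[of z] g(3,4)[of z] U(2) K(2) 
      by (cases "z \<in> U"; cases "z \<in> A"; cases "z \<in> K") (auto simp: indicator_def intro!: ennreal_leI)
  qed
  also have "\<dots> = ennreal (norm c) * emeasure lborel ((U - A) \<union> (A - K))"
    by (simp add: nn_integral_cmult_indicator)
  also have "\<dots> \<le> ennreal (norm c) * (emeasure lborel (U - A) + emeasure lborel (A - K))"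
    by (intro mult_left_mono emeasure_subadditive) auto
  also have "\<dots> \<le> ennreal (norm c) * (ennreal d + ennreal d)"
    using K U by (intro mult_left_mono add_mono) auto
  also have "\<dots> = ennreal (norm c * (2 * d))"
    using d by (simp add: ennreal_mult flip: ennreal_plus)
  also have "\<dots> < ennreal e"
  proof (rule ennreal_lessI)
    have "norm c * (2 * d) < (norm c + 1) * (2 * d)" using d by simp
    also have "\<dots> = e"
    proof -
      have "norm c + 1 \<noteq> 0" using norm_ge_zero[of c] by linarith
      then show ?thesis unfolding d_def by (simp add: divide_simps)
    qed
    finally show "norm c * (2 * d) < e" .
  qed (use base in auto)
  finally show ?case using g(1,4) by (intro exI[of _ g] exI[of _ R]) auto
next
  case (add f1 f2)
  obtain g1 R1 where 1: "continuous_on UNIV g1" "\<And>z. R1 < norm z \<Longrightarrow> g1 z = 0" "(\<integral>\<^sup>+ z. ennreal (norm (f1 z - g1 z)) \<partial>lborel) < ennreal (e/2)"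
    using add.IH(1)[of "e/2"] add.prems by auto
  obtain g2 R2 where 2: "continuous_on UNIV g2" "\<And>z. R2 < norm z \<Longrightarrow> g2 z = 0" "(\<integral>\<^sup>+ z. ennreal (norm (f2 z - g2 z)) \<partial>lborel) < ennreal (e/2)"
    using add.IH(2)[of "e/2"] add.prems by auto
  have [measurable]: "g1 \<in> borel_measurable borel" "g2 \<in> borel_measurable borel" "f1 \<in> borel_measurable borel" "f2 \<in> borel_measurable borel"
    using 1 2 add.hyps by (auto intro: borel_measurable_continuous_onI)
  have "(\<integral>\<^sup>+ z. ennreal (norm (f1 z + f2 z - (g1 z + g2 z))) \<partial>lborel) \<le> (\<integral>\<^sup>+ z. ennreal (norm (f1 z - g1 z)) + ennreal (norm (f2 z - g2 z)) \<partial>lborel)"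
    by (intro nn_integral_mono) (simp add: norm_diff_triangle_ineq flip: ennreal_plus)
  also have "\<dots> = (\<integral>\<^sup>+ z. ennreal (norm (f1 z - g1 z)) \<partial>lborel) + (\<integral>\<^sup>+ z. ennreal (norm (f2 z - g2 z)) \<partial>lborel)"
    by (intro nn_integral_add) auto
  also have "\<dots> < ennreal (e/2) + ennreal (e/2)" using 1 2 by (intro add_strict_mono)
  also have "\<dots> = ennreal e" using add.prems by (simp flip: ennreal_plus)
  finally have *: "(\<integral>\<^sup>+ z. ennreal (norm (f1 z + f2 z - (g1 z + g2 z))) \<partial>lborel) < ennreal e" .
  show ?case
    by (rule exI[of _ "\<lambda>z. g1 z + g2 z"], rule exI[of _ "max R1 R2"])
       (use 1 2 * in \<open>auto intro!: continuous_intros\<close>)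
next
  case (lim f s)
  have [measurable]: "f \<in> borel_measurable borel" "\<And>i. s i \<in> borel_measurable borel"
    using lim.hyps by auto
  have "(\<lambda>i. (\<integral>\<^sup>+ z. ennreal (norm (s i z - f z)) \<partial>lborel)) \<longlonglongrightarrow> (\<integral>\<^sup>+ z. 0 \<partial>(lborel :: complex measure))"
  proof (rule nn_integral_dominated_convergence[where w="\<lambda>z. ennreal (3 * norm (f z))"])
    show "(\<integral>\<^sup>+ z. ennreal (3 * norm (f z)) \<partial>lborel) < \<infinity>"
      using lim.hyps(4) by (subst nn_integral_eq_integral) auto
    show "AE z in lborel. ennreal (norm (s i z - f z)) \<le> ennreal (3 * norm (f z))" for i
    proof (intro AE_I2 ennreal_leI)
      fix z
      show "norm (s i z - f z) \<le> 3 * norm (f z)"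
        using lim.hyps(3)[of z i] norm_triangle_ineq4[of "s i z" "f z"] by simp
    qed
    show "AE z in lborel. (\<lambda>i. ennreal (norm (s i z - f z))) \<longlonglongrightarrow> 0"
    proof (intro AE_I2)
      fix z
      have "(\<lambda>i. norm (s i z - f z)) \<longlonglongrightarrow> 0"
        using lim.hyps(2)[of z] by (simp add: LIM_zero_iff tendsto_norm_zero_iff)
      then show "(\<lambda>i. ennreal (norm (s i z - f z))) \<longlonglongrightarrow> 0"
        using tendsto_ennrealI by fastforce
    qed
  qed auto
  then have "(\<lambda>i. (\<integral>\<^sup>+ z. ennreal (norm (s i z - f z)) \<partial>lborel)) \<longlonglongrightarrow> 0" by simp
  then have "\<forall>\<^sub>F i in sequentially. (\<integral>\<^sup>+ z. ennreal (norm (s i z - f z)) \<partial>lborel) < ennreal (e/2)"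
    using lim.prems by (intro order_tendstoD(2)) auto
  then obtain i where i: "(\<integral>\<^sup>+ z. ennreal (norm (s i z - f z)) \<partial>lborel) < ennreal (e/2)"
    by (auto simp: eventually_sequentially)
  obtain g R where g: "continuous_on UNIV g" "\<And>z. R < norm z \<Longrightarrow> g z = 0" "(\<integral>\<^sup>+ z. ennreal (norm (s i z - g z)) \<partial>lborel) < ennreal (e/2)"
    using lim.IH[of "e/2" i] lim.prems by auto
  have [measurable]: "g \<in> borel_measurable borel"
    using g by (auto intro: borel_measurable_continuous_onI)
  have "(\<integral>\<^sup>+ z. ennreal (norm (f z - g z)) \<partial>lborel) \<le> (\<integral>\<^sup>+ z. ennreal (norm (s i z - f z)) + ennreal (norm (s i z - g z)) \<partial>lborel)"
  proof (intro nn_integral_mono)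
    fix z
    have "norm (f z - g z) \<le> norm (s i z - f z) + norm (s i z - g z)"
      using norm_triangle_ineq4[of "s i z - g z" "s i z - f z"] by simp
    then show "ennreal (norm (f z - g z)) \<le> ennreal (norm (s i z - f z)) + ennreal (norm (s i z - g z))"
      by (simp flip: ennreal_plus)
  qed
  also have "\<dots> = (\<integral>\<^sup>+ z. ennreal (norm (s i z - f z)) \<partial>lborel) + (\<integral>\<^sup>+ z. ennreal (norm (s i z - g z)) \<partial>lborel)"
    by (intro nn_integral_add) auto
  also have "\<dots> < ennreal (e/2) + ennreal (e/2)" using i g by (intro add_strict_mono)
  also have "\<dots> = ennreal e" using lim.prems by (simp flip: ennreal_plus)
  finally show ?case using g by blast
qed

lemma convolve_diff:
  assumes "integrable lborel f" "integrable lborel g" "mollifier \<epsilon> \<kappa>"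
  shows "convolve (\<lambda>z. f z - g z) (\<lambda>z. of_real (\<kappa> z)) z = convolve f (\<lambda>z. of_real (\<kappa> z)) z - convolve g (\<lambda>z. of_real (\<kappa> z)) z"
proof -
  have c: "continuous_on UNIV (\<lambda>z. complex_of_real (\<kappa> z))" "\<And>z. \<epsilon> < norm z \<Longrightarrow> complex_of_real (\<kappa> z) = 0"
    using assms(3) by (auto simp: mollifier_def intro: continuous_intros)
  show ?thesis
    using convolve_integrable[OF assms(1) c] convolve_integrable[OF assms(2) c] by (simp add: convolve_def left_diff_distrib)
qed

text \<open>Immediate for continuous functions of compact support by uniform continuity, and carried over by density
  because convolution is a contraction on \<open>L\<^sup>1\<close>.\<close>

lemma mollifier_convolve_L1:
  assumes f: "integrable lborel f" and e: "e > (0::real)"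
  shows "\<exists>d>0. \<forall>\<epsilon> \<kappa>. mollifier \<epsilon> \<kappa> \<longrightarrow> \<epsilon> < d \<longrightarrow> (\<integral>\<^sup>+ z. ennreal (norm (convolve f (\<lambda>z. of_real (\<kappa> z)) z - f z)) \<partial>lborel) < e"
proof -
  obtain g R where g: "continuous_on UNIV g" "\<And>z. R < norm z \<Longrightarrow> g z = 0" "(\<integral>\<^sup>+ z. ennreal (norm (f z - g z)) \<partial>lborel) < ennreal (e/4)"
    using L1_dense_continuous[OF f, of "e/4"] e by auto
  have gi: "integrable lborel g" by (rule compact_support_integrable[OF g(1,2)])
  have [measurable]: "g \<in> borel_measurable borel" "f \<in> borel_measurable borel"
    using gi f by auto
  define M where "M = measure lborel (cball (0::complex) (R + 1))"
  have M: "emeasure lborel (cball (0::complex) (R + 1)) = ennreal M" "M \<ge> 0"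
    using emeasure_bounded_finite[OF bounded_cball, of "0::complex" "R + 1"]
    by (auto simp: M_def intro!: emeasure_eq_ennreal_measure)
  define \<eta> where "\<eta> = e / (4 * (M + 1))"
  have \<eta>: "\<eta> > 0" "\<eta> * M \<le> e / 4"
    using e M by (auto simp: \<eta>_def field_simps)
  obtain d where d: "d > 0" "\<And>x y. norm (x - y) < d \<Longrightarrow> norm (g x - g y) < \<eta>"
    using compact_support_uniform[OF g(1,2) \<eta>(1)] by blast
  show ?thesis
  proof (intro exI[of _ "min d 1"] conjI allI impI)
    show "min d 1 > 0" using d by simp
    fix \<epsilon> \<kappa> assume m: "mollifier \<epsilon> \<kappa>" and \<epsilon>: "\<epsilon> < min d 1"
    let ?k = "\<lambda>z. complex_of_real (\<kappa> z)"
    have kc: "continuous_on UNIV ?k" "\<And>z. \<epsilon> < norm z \<Longrightarrow> ?k z = 0" and kn: "\<And>z. 0 \<le> \<kappa> z" and k0: "\<And>z. \<epsilon> \<le> norm z \<Longrightarrow> \<kappa> z = 0"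
      using m by (auto simp: mollifier_def intro: continuous_intros)
    note [measurable] = mollifier_nn_integral(3)[OF m]
    have [measurable]: "convolve f ?k \<in> borel_measurable borel" "convolve g ?k \<in> borel_measurable borel"
      "convolve (\<lambda>z. f z - g z) ?k \<in> borel_measurable borel"
      using convolve_continuous[OF f kc] convolve_continuous[OF gi kc] convolve_continuous[OF Bochner_Integration.integrable_diff[OF f gi] kc]
      by (auto intro: borel_measurable_continuous_onI)
    have k1: "(\<integral>\<^sup>+ \<zeta>. ennreal (\<kappa> (z - \<zeta>)) \<partial>lborel) = 1" for z
      using nn_integral_reflect(1)[of "\<lambda>z. ennreal (\<kappa> z)"] mollifier_nn_integral(1)[OF m] by simp
    have ki: "integrable lborel (\<lambda>\<zeta>. \<kappa> (z - \<zeta>))" "(LINT \<zeta>|lborel. \<kappa> (z - \<zeta>)) = 1" for z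
      using k1[of z] kn by (auto intro!: integrableI_nonneg simp: integral_eq_nn_integral)
    have gd: "norm (convolve g ?k z - g z) \<le> \<eta> * indicator (cball 0 (R + 1)) z" for z
    proof (cases "norm z \<le> R + 1")
      case True
      have "convolve g ?k z - g z = convolve g ?k z - (LINT \<zeta>|lborel. g z * ?k (z - \<zeta>))"
        using ki(2)[of z] by simp
      also have "\<dots> = (LINT \<zeta>|lborel. (g \<zeta> - g z) * ?k (z - \<zeta>))"
        using convolve_integrable[OF gi kc, where z=z] ki(1)[of z] by (simp add: convolve_def left_diff_distrib)
      also have "norm \<dots> \<le> (LINT \<zeta>|lborel. \<eta> * \<kappa> (z - \<zeta>))"
      proof (rule Bochner_Integration.integral_norm_bound_integral)
        show "integrable lborel (\<lambda>\<zeta>. (g \<zeta> - g z) * ?k (z - \<zeta>))"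
          using convolve_integrable[OF gi kc, where z=z] ki(1)[of z] by (simp add: left_diff_distrib)
        show "integrable lborel (\<lambda>\<zeta>. \<eta> * \<kappa> (z - \<zeta>))" using ki(1)[of z] by simp
        fix \<zeta>
        show "norm ((g \<zeta> - g z) * ?k (z - \<zeta>)) \<le> \<eta> * \<kappa> (z - \<zeta>)"
        proof (cases "norm (z - \<zeta>) < \<epsilon>")
          case True
          then have "norm (g \<zeta> - g z) < \<eta>" using \<epsilon> d(2)[of \<zeta> z] by (simp add: norm_minus_commute)
          then show ?thesis using kn[of "z - \<zeta>"] by (simp add: norm_mult mult_right_mono)
        qed (use k0 in auto)
      qed
      also have "\<dots> = \<eta>" using ki(2)[of z] by simp
      finally show ?thesis using True by simp
    next
      case False
      have "g \<zeta> * ?k (z - \<zeta>) = 0" for \<zeta>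
      proof (cases "norm (z - \<zeta>) < \<epsilon>")
        case True
        then have "R < norm \<zeta>" using False \<epsilon> norm_triangle_ineq2[of z \<zeta>] by linarith
        then show ?thesis using g(2) by simp
      qed (use k0 in auto)
      then have "convolve g ?k z = 0" by (simp only: convolve_def) simp
      moreover have "g z = 0" using False g(2) by simp
      ultimately show ?thesis using \<eta> by simp
    qed
    have "(\<integral>\<^sup>+ z. ennreal (norm (convolve g ?k z - g z)) \<partial>lborel) \<le> (\<integral>\<^sup>+ z. ennreal \<eta> * indicator (cball (0::complex) (R + 1)) z \<partial>lborel)"
    proof (rule nn_integral_mono)
      fix z show "ennreal (norm (convolve g ?k z - g z)) \<le> ennreal \<eta> * indicator (cball (0::complex) (R + 1)) z"
        using gd[of z] by (auto simp: indicator_def intro: ennreal_leI split: if_splits)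
    qed
    also have "\<dots> = ennreal (\<eta> * M)" using M \<eta> by (simp add: nn_integral_cmult_indicator ennreal_mult)
    also have "\<dots> \<le> ennreal (e/4)" using \<eta> by (intro ennreal_leI)
    finally have 1: "(\<integral>\<^sup>+ z. ennreal (norm (convolve g ?k z - g z)) \<partial>lborel) \<le> ennreal (e/4)" .
    have 2: "(\<integral>\<^sup>+ z. ennreal (norm (convolve (\<lambda>z. f z - g z) ?k z)) \<partial>lborel) < ennreal (e/4)"
      using convolve_L1[OF m Bochner_Integration.integrable_diff[OF f gi]] g(3) by (rule le_less_trans)
    have "(\<integral>\<^sup>+ z. ennreal (norm (convolve f ?k z - f z)) \<partial>lborel) \<le>
      (\<integral>\<^sup>+ z. ennreal (norm (convolve (\<lambda>z. f z - g z) ?k z)) + ennreal (norm (convolve g ?k z - g z)) + ennreal (norm (f z - g z)) \<partial>lborel)"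
    proof (rule nn_integral_mono)
      fix z
      have "convolve f ?k z - f z = convolve (\<lambda>z. f z - g z) ?k z + (convolve g ?k z - g z) - (f z - g z)"
        using convolve_diff[OF f gi m, of z] by simp
      then have "norm (convolve f ?k z - f z) \<le> norm (convolve (\<lambda>z. f z - g z) ?k z) + norm (convolve g ?k z - g z) + norm (f z - g z)"
        using norm_triangle_ineq4[of "convolve (\<lambda>z. f z - g z) ?k z + (convolve g ?k z - g z)" "f z - g z"]
          norm_triangle_ineq[of "convolve (\<lambda>z. f z - g z) ?k z" "convolve g ?k z - g z"] by (simp only:)
      then show "ennreal (norm (convolve f ?k z - f z)) \<le> ennreal (norm (convolve (\<lambda>z. f z - g z) ?k z)) + ennreal (norm (convolve g ?k z - g z)) + ennreal (norm (f z - g z))"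
        by (simp flip: ennreal_plus)
    qed
    also have "\<dots> = (\<integral>\<^sup>+ z. ennreal (norm (convolve (\<lambda>z. f z - g z) ?k z)) \<partial>lborel) + (\<integral>\<^sup>+ z. ennreal (norm (convolve g ?k z - g z)) \<partial>lborel) + (\<integral>\<^sup>+ z. ennreal (norm (f z - g z)) \<partial>lborel)"
      by (simp add: nn_integral_add)
    also have "\<dots> \<le> ennreal (e/4) + ennreal (e/4) + ennreal (e/4)"
      using 1 2 g(3) by (intro add_mono) auto
    also have "\<dots> = ennreal (3 * e / 4)" using e by (simp flip: ennreal_plus)
    also have "\<dots> < ennreal e" using e by (intro ennreal_lessI) auto
    finally show "(\<integral>\<^sup>+ z. ennreal (norm (convolve f ?k z - f z)) \<partial>lborel) < ennreal e" .
  qed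
qed

lemma mollifier_convolve_AE:
  assumes f: "integrable lborel f" and m: "\<And>n. mollifier (\<epsilon> n) (\<kappa> n)" and \<epsilon>: "\<epsilon> \<longlonglongrightarrow> 0"
  shows "\<exists>r::nat \<Rightarrow> nat. strict_mono r \<and> (AE z in lborel. (\<lambda>n. convolve f (\<lambda>z. of_real (\<kappa> (r n) z)) z) \<longlonglongrightarrow> f z)"
proof -
  let ?u = "\<lambda>n z. convolve f (\<lambda>z. of_real (\<kappa> n z)) z - f z"
  have kc: "continuous_on UNIV (\<lambda>z. complex_of_real (\<kappa> n z))" "\<And>z. \<epsilon> n < norm z \<Longrightarrow> complex_of_real (\<kappa> n z) = 0" for n
    using m[of n] by (auto simp: mollifier_def intro: continuous_intros)
  have [measurable]: "f \<in> borel_measurable borel" "convolve f (\<lambda>z. of_real (\<kappa> n z)) \<in> borel_measurable borel" for n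
    using f convolve_continuous[OF f kc] by (auto intro: borel_measurable_continuous_onI)
  have fin: "(\<integral>\<^sup>+ z. ennreal (norm (f z)) \<partial>lborel) < \<infinity>" using f by (simp add: integrable_iff_bounded)
  have ci: "integrable lborel (convolve f (\<lambda>z. of_real (\<kappa> n z)))" for n
    by (rule integrableI_bounded) (use convolve_L1[OF m f, of n] fin in \<open>auto intro: le_less_trans\<close>)
  have i: "integrable lborel (?u n)" for n using ci f by simp
  have "(\<lambda>n. (LINT z|lborel. norm (?u n z))) \<longlonglongrightarrow> 0"
    unfolding tendsto_iff
  proof (intro allI impI)
    fix e :: real assume e: "e > 0"
    obtain d where d: "d > 0" "\<And>\<epsilon> \<kappa>. mollifier \<epsilon> \<kappa> \<Longrightarrow> \<epsilon> < d \<Longrightarrow> (\<integral>\<^sup>+ z. ennreal (norm (convolve f (\<lambda>z. of_real (\<kappa> z)) z - f z)) \<partial>lborel) < ennreal e"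
      using mollifier_convolve_L1[OF f e] by blast
    have "\<forall>\<^sub>F n in sequentially. \<epsilon> n < d" using \<epsilon> d(1) by (rule order_tendstoD(2))
    then show "\<forall>\<^sub>F n in sequentially. dist (LINT z|lborel. norm (?u n z)) 0 < e"
    proof eventually_elim
      case (elim n)
      have "ennreal (LINT z|lborel. norm (?u n z)) = (\<integral>\<^sup>+ z. ennreal (norm (?u n z)) \<partial>lborel)"
        using i by (intro nn_integral_eq_integral[symmetric]) auto
      also have "\<dots> < ennreal e" using d(2)[OF m elim] .
      finally show ?case by (simp add: ennreal_less_iff)
    qed
  qed
  from tendsto_L1_AE_subseq[OF i this] obtain r :: "nat \<Rightarrow> nat" where r: "strict_mono r" "AE z in lborel. (\<lambda>n. ?u (r n) z) \<longlonglongrightarrow> 0"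
    by blast
  from r(2) have "AE z in lborel. (\<lambda>n. convolve f (\<lambda>z. of_real (\<kappa> (r n) z)) z) \<longlonglongrightarrow> f z"
    by (rule AE_mp) (auto simp: LIM_zero_iff)
  with r(1) show ?thesis by blast
qed

section \<open>The Carleman inequality for weak derivatives\<close>

lemma smooth_mollifier_exists:
  assumes "\<epsilon> > 0"
  obtains \<kappa> p q where "mollifier \<epsilon> \<kappa>" "wirtinger2 (\<lambda>z. of_real (\<kappa> z)) p q"
    "\<And>S w. cball w \<epsilon> \<subseteq> S \<Longrightarrow> test_fun S (\<lambda>\<zeta>. complex_of_real (\<kappa> (w - \<zeta>)))"
proof -
  obtain \<kappa> :: "complex \<Rightarrow> real" and p q where k: "\<And>z. 0 \<le> \<kappa> z" "\<And>z. \<epsilon> \<le> norm z \<Longrightarrow> \<kappa> z = 0"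
    "integrable lborel \<kappa>" "(LINT z|lborel. \<kappa> z) = 1"
    "wirtinger2 (\<lambda>z. of_real (\<kappa> z)) p q"
    "\<And>k w. Ck k (\<lambda>\<zeta>. complex_of_real (\<kappa> (w - \<zeta>)))"
    using mollifier_exists[OF assms] by blast
  have "continuous_on UNIV (\<lambda>z. complex_of_real (\<kappa> z))" using k(5) wirtinger_continuous unfolding wirtinger2_def by blast
  from continuous_on_Re[OF this] have c: "continuous_on UNIV \<kappa>" by simp
  have "test_fun S (\<lambda>\<zeta>. complex_of_real (\<kappa> (w - \<zeta>)))" if "cball w \<epsilon> \<subseteq> S" for S w
  proof -
    have "closure {\<zeta>. complex_of_real (\<kappa> (w - \<zeta>)) \<noteq> 0} \<subseteq> cball w \<epsilon>"
    proof (rule closure_minimal)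
      show "{\<zeta>. complex_of_real (\<kappa> (w - \<zeta>)) \<noteq> 0} \<subseteq> cball w \<epsilon>"
        using k(2) by (auto simp: dist_norm) (meson linear)
    qed simp
    moreover from this have "compact (closure {\<zeta>. complex_of_real (\<kappa> (w - \<zeta>)) \<noteq> 0})"
      by (meson bounded_cball bounded_subset closed_closure compact_eq_bounded_closed)
    ultimately show ?thesis unfolding test_fun_def using k(6) that by blast
  qed
  then show ?thesis using that[of \<kappa> p q] k c unfolding mollifier_def by blast
qed

text \<open>The equation \<open>\<partial>f/\<partial>\<bar>z = F\<close> holds weakly on the disc \<open>ball z0 R\<close> only, but \<open>f\<close> and \<open>F\<close> are globally defined and
  globally in \<open>L\<^sup>1 \<inter> L\<^sup>2\<close>, so that they can be convolved on the whole plane.\<close>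

definition dbar_pair :: "complex \<Rightarrow> real \<Rightarrow> (complex \<Rightarrow> complex) \<Rightarrow> (complex \<Rightarrow> complex) \<Rightarrow> bool" where
  "dbar_pair z0 R f F \<longleftrightarrow> integrable lborel f \<and> integrable lborel (\<lambda>z. (norm (f z))^2) \<and>
     integrable lborel F \<and> integrable lborel (\<lambda>z. (norm (F z))^2) \<and>
     (\<forall>\<phi>. test_fun (ball z0 R) \<phi> \<longrightarrow> (LINT z|lborel. f z * dbar \<phi> z) = - (LINT z|lborel. F z * \<phi> z))"

text \<open>The support stays in a disc of some radius \<open>R\<close> strictly below \<open>R'\<close>. This gap is what lets a mollifier of
  small radius, centred in the support, fit into the disc where the weak equation holds.\<close>

definition cutoff_in :: "complex \<Rightarrow> real \<Rightarrow> (complex \<Rightarrow> complex) \<Rightarrow> (complex \<Rightarrow> complex) \<Rightarrow> bool" where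
  "cutoff_in z0 R' \<eta> \<eta>q \<longleftrightarrow> (\<exists>\<eta>p R. wirtinger2 \<eta> \<eta>p \<eta>q \<and> R < R' \<and> (\<forall>z. R \<le> norm (z - z0) \<longrightarrow> \<eta> z = 0))"

text \<open>The inequality for smooth functions is applied to \<open>\<eta> (f * \<kappa>\<^sub>n)\<close>, whose \<open>\<partial>/\<partial>\<bar>z\<close> is
  \<open>\<eta>q (f * \<kappa>\<^sub>n) + \<eta> (F * \<kappa>\<^sub>n)\<close>. Estimating the square of the sum by twice the sum of squares is
  affordable, since the weight can be chosen with a large Laplacian.\<close>

lemma weak_carleman:
  fixes f F :: "complex \<Rightarrow> complex" and \<psi> g :: "complex \<Rightarrow> real"
  assumes pair: "dbar_pair z0 R' f F" and cutoff: "cutoff_in z0 R' \<eta> \<eta>q"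
    and psi: "wirtinger (\<lambda>z. of_real (\<psi> z)) l (\<lambda>z. cnj (l z))" "wirtinger l m (\<lambda>z. of_real (g z))"
    and cont: "continuous_on UNIV m" "continuous_on UNIV g" and g: "\<And>z. g z \<ge> 0"
  shows "(\<integral>\<^sup>+ z. ennreal (g z * (norm (\<eta> z * f z))^2 * exp (\<psi> z)) \<partial>lborel) \<le>
     2 * (\<integral>\<^sup>+ z. ennreal ((norm (F z))^2 * ((norm (\<eta> z))^2 * exp (\<psi> z))) \<partial>lborel)
     + 2 * (\<integral>\<^sup>+ z. ennreal ((norm (f z))^2 * ((norm (\<eta>q z))^2 * exp (\<psi> z))) \<partial>lborel)"
proof -
  have f: "integrable lborel f" "integrable lborel (\<lambda>z. (norm (f z))^2)"
    and F: "integrable lborel F" "integrable lborel (\<lambda>z. (norm (F z))^2)"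
    and weak: "test_fun (ball z0 R') \<phi> \<Longrightarrow> (LINT z|lborel. f z * dbar \<phi> z) = - (LINT z|lborel. F z * \<phi> z)" for \<phi>
    using pair by (simp_all add: dbar_pair_def)
  obtain \<eta>p R where \<eta>: "wirtinger2 \<eta> \<eta>p \<eta>q" "\<And>z. R \<le> norm (z - z0) \<Longrightarrow> \<eta> z = 0" and R: "R < R'"
    using cutoff unfolding cutoff_in_def by blast
  define h1 where "h1 z = (norm (\<eta> z))^2 * exp (\<psi> z)" for z
  define h2 where "h2 z = (norm (\<eta>q z))^2 * exp (\<psi> z)" for z
  define S where "S = norm z0 + R"
  have w1: "wirtinger \<eta> \<eta>p \<eta>q" using \<eta> by (simp add: wirtinger2_def)
  have S: "\<eta> z = 0" if "S < norm z" for z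
    using \<eta>(2)[of z] that norm_triangle_ineq2[of z z0] by (simp add: S_def)
  have o: "open {z::complex. S < norm z}"
    by (intro open_Collect_less continuous_intros)
  have Sq: "\<eta>q z = 0" if "S < norm z" for z
    using wirtinger_zero_outside[OF w1 o, of z] S that by auto
  have ec: "continuous_on UNIV \<psi>"
    using continuous_on_Re[OF wirtinger_continuous[OF psi(1)]] by simp
  have \<eta>c: "continuous_on UNIV \<eta>" "continuous_on UNIV \<eta>q"
    using \<eta>(1) wirtinger_continuous unfolding wirtinger2_def by blast+
  have hc: "continuous_on UNIV h1" "continuous_on UNIV h2"
    unfolding h1_def h2_def by (intro continuous_intros \<eta>c ec)+
  have hn: "h1 z \<ge> 0" "h2 z \<ge> 0" for z by (auto simp: h1_def h2_def)
  have h0: "h1 z = 0" "h2 z = 0" if "S < norm z" for z using S[OF that] Sq[OF that] by (auto simp: h1_def h2_def)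
  have [measurable]: "f \<in> borel_measurable borel" "F \<in> borel_measurable borel" "h1 \<in> borel_measurable borel" "h2 \<in> borel_measurable borel"
    "\<eta> \<in> borel_measurable borel" "\<psi> \<in> borel_measurable borel" "g \<in> borel_measurable borel"
    using f F hc \<eta>c ec cont by (auto intro: borel_measurable_continuous_onI)
  \<comment> \<open>Radii below the gap \<open>R' - R\<close> keep the test functions inside \<open>ball z0 R'\<close>.\<close>
  define \<epsilon> where "\<epsilon> n = (R' - R) / real (n + 2)" for n
  have \<epsilon>: "\<epsilon> n > 0" "\<epsilon> n < R' - R" for n
    using R mult_strict_left_mono[of 1 "real (n + 2)" "R' - R"] by (auto simp: \<epsilon>_def pos_divide_less_eq)
  have \<epsilon>0: "\<epsilon> \<longlonglongrightarrow> 0" unfolding \<epsilon>_def by (rule LIMSEQ_ignore_initial_segment) (rule lim_const_over_n)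
  have "\<exists>\<kappa> p q. mollifier (\<epsilon> n) \<kappa> \<and> wirtinger2 (\<lambda>z. of_real (\<kappa> z)) p q \<and>
    (\<forall>S w. cball w (\<epsilon> n) \<subseteq> S \<longrightarrow> test_fun S (\<lambda>\<zeta>. complex_of_real (\<kappa> (w - \<zeta>))))" for n
    using smooth_mollifier_exists[OF \<epsilon>(1)[of n]] by metis
  then obtain \<kappa> p q where k: "\<And>n. mollifier (\<epsilon> n) (\<kappa> n)" "\<And>n. wirtinger2 (\<lambda>z. of_real (\<kappa> n z)) (p n) (q n)"
    "\<And>n S w. cball w (\<epsilon> n) \<subseteq> S \<Longrightarrow> test_fun S (\<lambda>\<zeta>. complex_of_real (\<kappa> n (w - \<zeta>)))"
    by metis
  define fk where "fk n = convolve f (\<lambda>z. of_real (\<kappa> n z))" for n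
  define Fk where "Fk n = convolve F (\<lambda>z. of_real (\<kappa> n z))" for n
  have k0: "\<epsilon> n < norm z \<Longrightarrow> complex_of_real (\<kappa> n z) = 0" for n z
    using k(1)[of n] by (auto simp: mollifier_def)
  have kc: "continuous_on UNIV (\<lambda>z. complex_of_real (\<kappa> n z))" for n
    using k(1)[of n] by (auto simp: mollifier_def intro: continuous_intros)
  have fkc: "continuous_on UNIV (fk n)" "continuous_on UNIV (Fk n)" for n
    unfolding fk_def Fk_def using convolve_continuous[OF f(1) kc k0] convolve_continuous[OF F(1) kc k0] by auto
  have [measurable]: "fk n \<in> borel_measurable borel" "Fk n \<in> borel_measurable borel" for n
    using fkc by (auto intro: borel_measurable_continuous_onI)
  let ?L = "\<lambda>n z. g z * (norm (\<eta> z * fk n z))^2 * exp (\<psi> z)"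
  have step: "(\<integral>\<^sup>+ z. ennreal (?L n z) \<partial>lborel) \<le>
     2 * (\<integral>\<^sup>+ z. ennreal ((norm (Fk n z))^2 * h1 z) \<partial>lborel) + 2 * (\<integral>\<^sup>+ z. ennreal ((norm (fk n z))^2 * h2 z) \<partial>lborel)" for n
  proof -
    define wq where "wq z = \<eta>q z * fk n z + \<eta> z * convolve f (q n) z" for z
    have w2: "wirtinger2 (\<lambda>z. \<eta> z * fk n z) (\<lambda>z. \<eta>p z * fk n z + \<eta> z * convolve f (p n) z) wq"
      unfolding wq_def fk_def by (rule wirtinger2_mult[OF \<eta>(1) convolve_wirtinger2[OF f(1) k(2) k0]])
    have wqF: "wq z = \<eta>q z * fk n z + \<eta> z * Fk n z" for z
    proof (cases "\<eta> z = 0")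
      case False
      then have "norm (z - z0) < R" using \<eta>(2)[of z] by linarith
      have "cball z (\<epsilon> n) \<subseteq> ball z0 R'"
      proof
        fix y assume "y \<in> cball z (\<epsilon> n)"
        then have "dist z y < R' - R" using \<epsilon>(2)[of n] by simp
        then show "y \<in> ball z0 R'" using dist_triangle[of z0 y z] \<open>norm (z - z0) < R\<close> by (simp add: dist_norm norm_minus_commute)
      qed
      moreover have "wirtinger (\<lambda>z. of_real (\<kappa> n z)) (p n) (q n)" using k(2)[of n] by (simp add: wirtinger2_def)
      ultimately have "convolve f (q n) z = Fk n z"
        unfolding Fk_def by (intro convolve_weak weak k(3))
      then show ?thesis by (simp add: wq_def)
    qed (simp add: wq_def)
    have wqc: "continuous_on UNIV wq"
      using w2 wirtinger_continuous unfolding wirtinger2_def by blast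
    have 0: "\<eta> z * fk n z = 0" "wq z = 0" if "S < norm z" for z
      using S[OF that] Sq[OF that] by (auto simp: wqF)
    have C: "(LINT z|lborel. ?L n z) \<le> (LINT z|lborel. (norm (wq z))^2 * exp (\<psi> z))"
      by (rule carleman_C2[OF w2 _ psi cont, of S]) (use 0 in auto)
    have iL: "integrable lborel (?L n)"
      by (rule compact_support_integrable[where R=S])
         ((intro continuous_intros \<eta>c ec fkc cont) | (use 0 in auto))+
    have iR: "integrable lborel (\<lambda>z. (norm (wq z))^2 * exp (\<psi> z))"
      by (rule compact_support_integrable[where R=S])
         ((intro continuous_intros wqc ec) | (use 0 in auto))+
    have "(\<integral>\<^sup>+ z. ennreal (?L n z) \<partial>lborel) = ennreal (LINT z|lborel. ?L n z)"
      using g by (intro nn_integral_eq_integral[OF iL]) auto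
    also have "\<dots> \<le> ennreal (LINT z|lborel. (norm (wq z))^2 * exp (\<psi> z))"
      using C by (rule ennreal_leI)
    also have "\<dots> = (\<integral>\<^sup>+ z. ennreal ((norm (wq z))^2 * exp (\<psi> z)) \<partial>lborel)"
      by (intro nn_integral_eq_integral[OF iR, symmetric]) auto
    also have "\<dots> \<le> (\<integral>\<^sup>+ z. 2 * ennreal ((norm (Fk n z))^2 * h1 z) + 2 * ennreal ((norm (fk n z))^2 * h2 z) \<partial>lborel)"
    proof (rule nn_integral_mono)
      fix z
      have "(norm (wq z))^2 \<le> (norm (\<eta>q z * fk n z) + norm (\<eta> z * Fk n z))^2"
        unfolding wqF by (intro power_mono norm_triangle_ineq) auto
      also have "\<dots> \<le> 2 * (norm (\<eta>q z * fk n z))^2 + 2 * (norm (\<eta> z * Fk n z))^2"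
        using zero_le_power2[of "norm (\<eta>q z * fk n z) - norm (\<eta> z * Fk n z)"] by (simp add: power2_eq_square algebra_simps)
      finally have "(norm (wq z))^2 * exp (\<psi> z) \<le> (2 * (norm (\<eta>q z * fk n z))^2 + 2 * (norm (\<eta> z * Fk n z))^2) * exp (\<psi> z)"
        by (intro mult_right_mono) auto
      also have "\<dots> = 2 * ((norm (Fk n z))^2 * h1 z) + 2 * ((norm (fk n z))^2 * h2 z)"
        by (simp add: h1_def h2_def norm_mult power_mult_distrib algebra_simps)
      finally have "ennreal ((norm (wq z))^2 * exp (\<psi> z)) \<le> ennreal (2 * ((norm (Fk n z))^2 * h1 z) + 2 * ((norm (fk n z))^2 * h2 z))"
        by (rule ennreal_leI)
      also have "\<dots> = 2 * ennreal ((norm (Fk n z))^2 * h1 z) + 2 * ennreal ((norm (fk n z))^2 * h2 z)"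
        using hn[of z] by (simp add: ennreal_mult' ennreal_plus)
      finally show "ennreal ((norm (wq z))^2 * exp (\<psi> z)) \<le> 2 * ennreal ((norm (Fk n z))^2 * h1 z) + 2 * ennreal ((norm (fk n z))^2 * h2 z)" .
    qed
    also have "\<dots> = 2 * (\<integral>\<^sup>+ z. ennreal ((norm (Fk n z))^2 * h1 z) \<partial>lborel) + 2 * (\<integral>\<^sup>+ z. ennreal ((norm (fk n z))^2 * h2 z) \<partial>lborel)"
      by (subst nn_integral_add) (simp_all add: nn_integral_cmult)
    finally show ?thesis .
  qed
  obtain r :: "nat \<Rightarrow> nat" where r: "strict_mono r" "AE z in lborel. (\<lambda>n. fk (r n) z) \<longlonglongrightarrow> f z"
    using mollifier_convolve_AE[OF f(1) k(1) \<epsilon>0] unfolding fk_def by blast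
  define NF where "NF = (LINT z|lborel. (norm (F z))^2)"
  define Nf where "Nf = (LINT z|lborel. (norm (f z))^2)"
  have N: "NF \<ge> 0" "Nf \<ge> 0" unfolding NF_def Nf_def by (intro integral_nonneg_AE; auto)+
  have NN: "(\<integral>\<^sup>+ z. ennreal ((norm (F z))^2) \<partial>lborel) = ennreal NF" "(\<integral>\<^sup>+ z. ennreal ((norm (f z))^2) \<partial>lborel) = ennreal Nf"
    unfolding NF_def Nf_def using f F by (intro nn_integral_eq_integral; auto)+
  let ?R1 = "\<integral>\<^sup>+ z. ennreal ((norm (F z))^2 * h1 z) \<partial>lborel"
  let ?R2 = "\<integral>\<^sup>+ z. ennreal ((norm (f z))^2 * h2 z) \<partial>lborel"
  have main: "(\<integral>\<^sup>+ z. ennreal (g z * (norm (\<eta> z * f z))^2 * exp (\<psi> z)) \<partial>lborel) \<le> 2 * ?R1 + 2 * ?R2 + ennreal (2 * \<omega> * (NF + Nf))"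
    if \<omega>: "\<omega> > 0" for \<omega>
  proof -
    obtain d1 where d1: "d1 > 0" "\<And>x y. norm (x - y) < d1 \<Longrightarrow> norm (h1 x - h1 y) < \<omega>"
      using compact_support_uniform[OF hc(1) h0(1) \<omega>] by blast
    obtain d2 where d2: "d2 > 0" "\<And>x y. norm (x - y) < d2 \<Longrightarrow> norm (h2 x - h2 y) < \<omega>"
      using compact_support_uniform[OF hc(2) h0(2) \<omega>] by blast
    have ev: "\<forall>\<^sub>F n in sequentially. \<epsilon> (r n) < min d1 d2"
      using d1 d2 order_tendstoD(2)[OF LIMSEQ_subseq_LIMSEQ[OF \<epsilon>0 r(1)], of "min d1 d2"] by (simp add: o_def)
    have bound: "\<forall>\<^sub>F n in sequentially. (\<integral>\<^sup>+ z. ennreal (?L (r n) z) \<partial>lborel) \<le> 2 * ?R1 + 2 * ?R2 + ennreal (2 * \<omega> * (NF + Nf))"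
      using ev
    proof eventually_elim
      case (elim n)
      have h1': "h1 x \<le> h1 y + \<omega>" if "norm (x - y) < \<epsilon> (r n)" for x y
        using d1(2)[of x y] that elim by auto
      have h2': "h2 x \<le> h2 y + \<omega>" if "norm (x - y) < \<epsilon> (r n)" for x y
        using d2(2)[of x y] that elim by auto
      have "(\<integral>\<^sup>+ z. ennreal ((norm (Fk (r n) z))^2 * h1 z) \<partial>lborel) \<le> (\<integral>\<^sup>+ z. ennreal ((norm (F z))^2 * (h1 z + \<omega>)) \<partial>lborel)"
        unfolding Fk_def by (rule convolve_L2_weighted[OF k(1) F(1) _ hn(1) _ h1']) (use \<omega> in auto)
      also have "\<dots> = (\<integral>\<^sup>+ z. ennreal ((norm (F z))^2 * h1 z) + ennreal \<omega> * ennreal ((norm (F z))^2) \<partial>lborel)"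
        using \<omega> hn by (intro nn_integral_cong) (simp add: distrib_left distrib_right ennreal_mult mult.commute)
      also have "\<dots> = ?R1 + ennreal (\<omega> * NF)"
        using \<omega> by (simp add: nn_integral_add nn_integral_cmult NN ennreal_mult')
      finally have 1: "(\<integral>\<^sup>+ z. ennreal ((norm (Fk (r n) z))^2 * h1 z) \<partial>lborel) \<le> ?R1 + ennreal (\<omega> * NF)" .
      have "(\<integral>\<^sup>+ z. ennreal ((norm (fk (r n) z))^2 * h2 z) \<partial>lborel) \<le> (\<integral>\<^sup>+ z. ennreal ((norm (f z))^2 * (h2 z + \<omega>)) \<partial>lborel)"
        unfolding fk_def by (rule convolve_L2_weighted[OF k(1) f(1) _ hn(2) _ h2']) (use \<omega> in auto)
      also have "\<dots> = (\<integral>\<^sup>+ z. ennreal ((norm (f z))^2 * h2 z) + ennreal \<omega> * ennreal ((norm (f z))^2) \<partial>lborel)"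
        using \<omega> hn by (intro nn_integral_cong) (simp add: distrib_left distrib_right ennreal_mult mult.commute)
      also have "\<dots> = ?R2 + ennreal (\<omega> * Nf)"
        using \<omega> by (simp add: nn_integral_add nn_integral_cmult NN ennreal_mult')
      finally have 2: "(\<integral>\<^sup>+ z. ennreal ((norm (fk (r n) z))^2 * h2 z) \<partial>lborel) \<le> ?R2 + ennreal (\<omega> * Nf)" .
      have "(\<integral>\<^sup>+ z. ennreal (?L (r n) z) \<partial>lborel) \<le> 2 * (?R1 + ennreal (\<omega> * NF)) + 2 * (?R2 + ennreal (\<omega> * Nf))"
        by (rule order_trans[OF step]) (intro add_mono mult_left_mono 1 2; simp)
      also have "\<dots> = 2 * ?R1 + 2 * ?R2 + (ennreal (2 * (\<omega> * NF)) + ennreal (2 * (\<omega> * Nf)))"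
        using \<omega> N by (simp add: ring_distribs ennreal_mult' add_ac)
      also have "ennreal (2 * (\<omega> * NF)) + ennreal (2 * (\<omega> * Nf)) = ennreal (2 * \<omega> * (NF + Nf))"
        using \<omega> N by (subst ennreal_plus[symmetric]) (auto simp: algebra_simps)
      finally show ?case .
    qed
    have "(\<integral>\<^sup>+ z. ennreal (g z * (norm (\<eta> z * f z))^2 * exp (\<psi> z)) \<partial>lborel) = (\<integral>\<^sup>+ z. liminf (\<lambda>n. ennreal (?L (r n) z)) \<partial>lborel)"
    proof (rule nn_integral_cong_AE)
      show "AE z in lborel. ennreal (g z * (norm (\<eta> z * f z))^2 * exp (\<psi> z)) = liminf (\<lambda>n. ennreal (?L (r n) z))"
        using r(2)
      proof eventually_elim
        case (elim z)
        have "(\<lambda>n. ennreal (?L (r n) z)) \<longlonglongrightarrow> ennreal (g z * (norm (\<eta> z * f z))^2 * exp (\<psi> z))"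
          by (intro tendsto_ennrealI tendsto_intros elim)
        from lim_imp_Liminf[OF _ this] show ?case by simp
      qed
    qed
    also have "\<dots> \<le> liminf (\<lambda>n. (\<integral>\<^sup>+ z. ennreal (?L (r n) z) \<partial>lborel))"
      by (rule nn_integral_liminf) simp
    also have "\<dots> \<le> 2 * ?R1 + 2 * ?R2 + ennreal (2 * \<omega> * (NF + Nf))"
      using bound by (intro Liminf_le) auto
    finally show ?thesis .
  qed
  have "(\<integral>\<^sup>+ z. ennreal (g z * (norm (\<eta> z * f z))^2 * exp (\<psi> z)) \<partial>lborel) \<le> 2 * ?R1 + 2 * ?R2"
  proof (rule ennreal_le_epsilon)
    fix e :: real assume e: "e > 0"
    define \<omega> where "\<omega> = e / (2 * (NF + Nf + 1))"
    have \<omega>: "\<omega> > 0" using e N by (simp add: \<omega>_def)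
    have "2 * \<omega> * (NF + Nf) \<le> 2 * \<omega> * (NF + Nf + 1)" using \<omega> by simp
    also have "\<dots> = e" using N by (simp add: \<omega>_def divide_simps)
    finally have "ennreal (2 * \<omega> * (NF + Nf)) \<le> ennreal e" by (rule ennreal_leI)
    then show "(\<integral>\<^sup>+ z. ennreal (g z * (norm (\<eta> z * f z))^2 * exp (\<psi> z)) \<partial>lborel) \<le> 2 * ?R1 + 2 * ?R2 + ennreal e"
      using main[OF \<omega>] by (meson add_left_mono order_trans)
  qed
  then show ?thesis by (simp add: h1_def h2_def)
qed

text \<open>The fundamental lemma of the calculus of variations: mollifications of \<open>H\<close> vanish and converge to \<open>H\<close>.\<close>

lemma weak_zero_imp_AE_zero:
  fixes H :: "complex \<Rightarrow> complex"
  assumes H: "integrable lborel H" 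
    and weak: "\<And>\<phi>. test_fun (ball z0 R') \<phi> \<Longrightarrow> (LINT z|lborel. H z * \<phi> z) = 0"
  shows "AE z in lborel. z \<in> ball z0 R' \<longrightarrow> H z = 0"
proof -
  define \<epsilon> where "\<epsilon> n = 1 / real (Suc n)" for n
  have \<epsilon>: "\<epsilon> n > 0" for n by (auto simp: \<epsilon>_def)
  have \<epsilon>0: "\<epsilon> \<longlonglongrightarrow> 0" unfolding \<epsilon>_def by (rule LIMSEQ_Suc) (rule lim_1_over_n)
  have "\<exists>\<kappa>. mollifier (\<epsilon> n) \<kappa> \<and>
    (\<forall>S w. cball w (\<epsilon> n) \<subseteq> S \<longrightarrow> test_fun S (\<lambda>\<zeta>. complex_of_real (\<kappa> (w - \<zeta>))))" for n
    using smooth_mollifier_exists[OF \<epsilon>(1)[of n]] by metis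
  then obtain \<kappa> where k: "\<And>n. mollifier (\<epsilon> n) (\<kappa> n)"
    "\<And>n S w. cball w (\<epsilon> n) \<subseteq> S \<Longrightarrow> test_fun S (\<lambda>\<zeta>. complex_of_real (\<kappa> n (w - \<zeta>)))"
    by metis
  obtain r :: "nat \<Rightarrow> nat" where r: "strict_mono r" "AE z in lborel. (\<lambda>n. convolve H (\<lambda>z. of_real (\<kappa> (r n) z)) z) \<longlonglongrightarrow> H z"
    using mollifier_convolve_AE[OF H k(1) \<epsilon>0] by blast
  from r(2) show ?thesis
  proof eventually_elim
    case (elim z)
    show ?case
    proof
      assume "z \<in> ball z0 R'"
      then obtain d where d: "d > 0" "ball z d \<subseteq> ball z0 R'"
        by (meson open_ball openE)
      have "\<forall>\<^sub>F n in sequentially. \<epsilon> (r n) < d"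
        using order_tendstoD(2)[OF LIMSEQ_subseq_LIMSEQ[OF \<epsilon>0 r(1)] d(1)] by (simp add: o_def)
      then have "\<forall>\<^sub>F n in sequentially. convolve H (\<lambda>z. of_real (\<kappa> (r n) z)) z = 0"
      proof eventually_elim
        case (elim n)
        then have "cball z (\<epsilon> (r n)) \<subseteq> ball z0 R'" using d(2) by fastforce
        from weak[OF k(2)[OF this]] show ?case by (simp add: convolve_def)
      qed
      then have "(\<lambda>n. convolve H (\<lambda>z. of_real (\<kappa> (r n) z)) z) \<longlonglongrightarrow> 0"
        by (rule tendsto_eventually)
      then show "H z = 0" using elim LIMSEQ_unique by blast
    qed
  qed
qed

section \<open>Majorants made of discs\<close>

text \<open>Vitali's covering theorem, with the countable family of discs listed as a sequence. Positions that are not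
  used are filled with discs of radius \<open>0\<close>.\<close>

lemma open_ball_decomposition:
  fixes U :: "complex set"
  assumes U: "open U"
  shows "\<exists>a \<rho>. (\<forall>j::nat. 0 \<le> \<rho> j \<and> \<rho> j \<le> 1 \<and> ball (a j) (\<rho> j) \<subseteq> U) \<and>
    (\<Sum>j. emeasure lborel (ball (a j) (\<rho> j))) \<le> emeasure lborel U \<and>
    (AE z in lborel. z \<in> U \<longrightarrow> z \<in> (\<Union>j. ball (a j) (\<rho> j)))"
proof -
  let ?K = "{(x, r). 0 < r \<and> r \<le> 1 \<and> ball x r \<subseteq> U}"
  have V: "\<exists>i. i \<in> ?K \<and> x \<in> ball (fst i) (snd i) \<and> snd i < d" if "x \<in> U" "0 < d" for x and d :: real
  proof -
    obtain e where e: "e > 0" "ball x e \<subseteq> U" using openE[OF U \<open>x \<in> U\<close>] by blast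
    define r where "r = min (min e 1) (d / 2)"
    have r: "0 < r" "r \<le> 1" "r < d" "r \<le> e" using e(1) \<open>0 < d\<close> by (auto simp: r_def min_def)
    have "ball x r \<subseteq> U" by (rule subset_trans[OF subset_ball e(2)]) (rule r)
    with r show ?thesis by (intro exI[of _ "(x, r)"] conjI) simp_all
  qed
  obtain C where C: "countable C" "C \<subseteq> ?K" "pairwise (\<lambda>i j. disjnt (ball (fst i) (snd i)) (ball (fst j) (snd j))) C"
    "negligible (U - (\<Union>i\<in>C. ball (fst i) (snd i)))"
    by (rule Vitali_covering_theorem_balls[of U ?K fst snd, OF V]) (assumption, assumption, rule that)
  define e where "e j = (if j \<in> to_nat_on C ` C then from_nat_into C j else (0, 0))" for j
  have eC: "e j \<in> C" if "j \<in> to_nat_on C ` C" for j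
    using that by (auto simp: e_def C(1))
  have ee: "ball (fst (e j)) (snd (e j)) = {}" if "j \<notin> to_nat_on C ` C" for j
    using that by (auto simp: e_def)
  have un: "(\<Union>j. ball (fst (e j)) (snd (e j))) = (\<Union>i\<in>C. ball (fst i) (snd i))"
  proof
    show "(\<Union>j. ball (fst (e j)) (snd (e j))) \<subseteq> (\<Union>i\<in>C. ball (fst i) (snd i))"
    proof (rule UN_least)
      fix j
      show "ball (fst (e j)) (snd (e j)) \<subseteq> (\<Union>i\<in>C. ball (fst i) (snd i))"
      proof (cases "j \<in> to_nat_on C ` C")
        case True
        show ?thesis by (rule UN_upper[OF eC[OF True]])
      next
        case False
        show ?thesis by (rule ord_eq_le_trans[OF ee[OF False] empty_subsetI])
      qed
    qed
    show "(\<Union>i\<in>C. ball (fst i) (snd i)) \<subseteq> (\<Union>j. ball (fst (e j)) (snd (e j)))"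
    proof
      fix x assume "x \<in> (\<Union>i\<in>C. ball (fst i) (snd i))"
      then obtain i where i: "i \<in> C" "x \<in> ball (fst i) (snd i)" by (rule UN_E)
      then have "e (to_nat_on C i) = i" using C(1) by (simp add: e_def)
      then show "x \<in> (\<Union>j. ball (fst (e j)) (snd (e j)))" using i by (intro UN_I[of "to_nat_on C i"]) simp_all
    qed
  qed
  have subU: "ball (fst (e j)) (snd (e j)) \<subseteq> U" for j
  proof (cases "j \<in> to_nat_on C ` C")
    case True
    have "e j \<in> ?K" by (rule subsetD[OF C(2) eC[OF True]])
    then show ?thesis by (simp add: case_prod_unfold)
  next
    case False
    show ?thesis by (rule ord_eq_le_trans[OF ee[OF False] empty_subsetI])
  qed
  have dis: "disjoint_family (\<lambda>j. ball (fst (e j)) (snd (e j)))"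
    unfolding disjoint_family_on_def
  proof (intro ballI impI)
    fix i j :: nat assume "i \<noteq> j"
    show "ball (fst (e i)) (snd (e i)) \<inter> ball (fst (e j)) (snd (e j)) = {}"
    proof (cases "i \<in> to_nat_on C ` C \<and> j \<in> to_nat_on C ` C")
      case True
      then obtain x y where xy: "x \<in> C" "y \<in> C" "i = to_nat_on C x" "j = to_nat_on C y" by (elim conjE imageE) (rule that)
      then have "e i = x" "e j = y" using C(1) by (simp_all add: e_def)
      then have "e i \<noteq> e j" using \<open>i \<noteq> j\<close> xy by auto
      moreover have "e i \<in> C" "e j \<in> C" using eC True by auto
      ultimately show ?thesis using C(3) by (simp add: pairwise_def disjnt_def)
    next
      case False
      then have "ball (fst (e i)) (snd (e i)) = {} \<or> ball (fst (e j)) (snd (e j)) = {}" using ee by metis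
      then show ?thesis by (elim disjE) (simp_all only: Int_empty_left Int_empty_right)
    qed
  qed
  have "(\<Sum>j. emeasure lborel (ball (fst (e j)) (snd (e j)))) = emeasure lborel (\<Union>j. ball (fst (e j)) (snd (e j)))"
    by (rule suminf_emeasure[OF _ dis]) auto
  also have "\<dots> \<le> emeasure lborel U"
    by (rule emeasure_mono) (use subU U in auto)
  finally have m: "(\<Sum>j. emeasure lborel (ball (fst (e j)) (snd (e j)))) \<le> emeasure lborel U" .
  have bm: "(\<Union>i\<in>C. ball (fst i) (snd i)) \<in> sets borel" by (intro borel_open open_UN) auto
  have "U - (\<Union>i\<in>C. ball (fst i) (snd i)) \<in> null_sets lborel"
    using C(4) U bm by (simp add: negligible_iff_null_sets null_sets_def)
  then have ae: "AE z in lborel. z \<in> U \<longrightarrow> z \<in> (\<Union>i\<in>C. ball (fst i) (snd i))"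
    by (rule AE_I'[of _ ]) auto
  have "0 \<le> snd (e j) \<and> snd (e j) \<le> 1 \<and> ball (fst (e j)) (snd (e j)) \<subseteq> U" for j
  proof (cases "j \<in> to_nat_on C ` C")
    case True
    have "e j \<in> ?K" by (rule subsetD[OF C(2) eC[OF True]])
    then show ?thesis by (simp add: case_prod_unfold)
  qed (simp add: e_def)
  then show ?thesis
    using m ae un by (intro exI[of _ "\<lambda>j. fst (e j)"] exI[of _ "\<lambda>j. snd (e j)"]) simp
qed

text \<open>The number of naturals below \<open>x\<close> is \<open>x\<close> rounded up; this is the layer-cake formula with integer layers.\<close>

lemma sum_levels:
  fixes x :: real assumes x: "x \<ge> 0"
  shows "ennreal x \<le> (\<Sum>k. indicator {k. real k < x} k)" "(\<Sum>k. indicator {k. real k < x} k :: ennreal) \<le> ennreal (x + 1)"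
proof -
  define N where "N = nat \<lceil>x\<rceil>"
  have N: "x \<le> real N" "\<And>k. k < N \<Longrightarrow> real k < x"
    unfolding N_def by linarith+
  have "ennreal x \<le> ennreal (real N)" using N(1) by (rule ennreal_leI)
  also have "\<dots> = (\<Sum>k<N. indicator {k. real k < x} k)"
    using N(2) by (simp add: indicator_def ennreal_of_nat_eq_real_of_nat)
  also have "\<dots> \<le> (\<Sum>k. indicator {k. real k < x} k)"
    by (rule sum_le_suminf) auto
  finally show "ennreal x \<le> (\<Sum>k. indicator {k. real k < x} k)" .
  have bd: "(\<Sum>k<n. indicator {k. real k < x} k :: real) \<le> x + 1 \<and> (\<Sum>k<n. indicator {k. real k < x} k :: real) \<le> real n" for n
    using x by (induction n) (auto simp: indicator_def)
  have "(\<Sum>k<n. indicator {k. real k < x} k :: ennreal) \<le> ennreal (x + 1)" for n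
  proof -
    have "(\<Sum>k<n. indicator {k. real k < x} k :: ennreal) = (\<Sum>k<n. ennreal (indicator {k. real k < x} k))" by (intro sum.cong) (auto simp: indicator_def)
    also have "\<dots> = ennreal (\<Sum>k<n. indicator {k. real k < x} k)" by (rule sum_ennreal) simp
    also have "\<dots> \<le> ennreal (x + 1)" using bd[of n] by (intro ennreal_leI) simp
    finally show ?thesis .
  qed
  then show "(\<Sum>k. indicator {k. real k < x} k :: ennreal) \<le> ennreal (x + 1)"
    by (intro suminf_le_const) auto
qed

text \<open>Each superlevel set \<open>{G > k}\<close> is enclosed in an open set with excess measure at most \<open>2\<^bsup>-k\<^esup>\<close>, and the open set is filled
  with disjoint discs. By counting layers, the indicators of all these discs add up to at least \<open>G\<close>, while the sum
  of their areas is at most \<open>\<integral> G\<close> plus a finite amount.\<close>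

lemma ball_majorant:
  fixes G :: "complex \<Rightarrow> real"
  assumes G: "integrable lborel G" "\<And>z. G z \<ge> 0" and s: "\<And>z. z \<notin> ball z0 R \<Longrightarrow> G z = 0"
  shows "\<exists>a \<rho>. (\<forall>j::nat. 0 \<le> \<rho> j \<and> \<rho> j \<le> 1 \<and> ball (a j) (\<rho> j) \<subseteq> ball z0 R) \<and> summable (\<lambda>j. (\<rho> j)^2) \<and>
    (AE z in lborel. ennreal (G z) \<le> (\<Sum>j. indicator (ball (a j) (\<rho> j)) z))"
proof -
  have [measurable]: "G \<in> borel_measurable borel" using G by auto
  define S where "S k = {z. real k < G z}" for k :: nat
  have [measurable]: "S k \<in> sets borel" for k unfolding S_def by measurable
  have Sb: "S k \<subseteq> ball z0 R" for k using s by (force simp: S_def)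
  have "\<exists>U. open U \<and> S k \<subseteq> U \<and> U \<subseteq> ball z0 R \<and> emeasure lborel U \<le> emeasure lborel (S k) + ennreal ((1/2)^k)" for k
  proof -
    obtain U where U: "open U" "S k \<subseteq> U" "emeasure lborel (U - S k) < ennreal ((1/2)^k)"
      using outer_regular_lborel[of "S k" "(1/2)^k"] by auto
    have "emeasure lborel (U \<inter> ball z0 R) \<le> emeasure lborel (S k \<union> (U - S k))"
      using U by (intro emeasure_mono) auto
    also have "\<dots> \<le> emeasure lborel (S k) + emeasure lborel (U - S k)"
      using U by (intro emeasure_subadditive) auto
    also have "\<dots> \<le> emeasure lborel (S k) + ennreal ((1/2)^k)"
      using U by (intro add_left_mono) auto
    finally show ?thesis using U Sb by (intro exI[of _ "U \<inter> ball z0 R"]) auto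
  qed
  then obtain U where U: "\<And>k. open (U k)" "\<And>k. S k \<subseteq> U k" "\<And>k. U k \<subseteq> ball z0 R" "\<And>k. emeasure lborel (U k) \<le> emeasure lborel (S k) + ennreal ((1/2)^k)"
    by metis
  define Q where "Q k a \<rho> \<longleftrightarrow> (\<forall>j::nat. 0 \<le> \<rho> j \<and> \<rho> j \<le> 1 \<and> ball (a j) (\<rho> j) \<subseteq> U k) \<and>
    (\<Sum>j. emeasure lborel (ball (a j) (\<rho> j))) \<le> emeasure lborel (U k) \<and>
    (AE z in lborel. z \<in> U k \<longrightarrow> z \<in> (\<Union>j. ball (a j) (\<rho> j)))" for k a \<rho>
  have "\<forall>k. \<exists>a \<rho>. Q k a \<rho>" unfolding Q_def by (intro allI open_ball_decomposition U(1))
  then obtain a \<rho> where Q: "\<And>k. Q k (a k) (\<rho> k)" by metis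
  have a: "\<And>k j. 0 \<le> \<rho> k j \<and> \<rho> k j \<le> 1 \<and> ball (a k j) (\<rho> k j) \<subseteq> U k"
    "\<And>k. (\<Sum>j::nat. emeasure lborel (ball (a k j) (\<rho> k j))) \<le> emeasure lborel (U k)"
    "\<And>k. AE z in lborel. z \<in> U k \<longrightarrow> z \<in> (\<Union>j. ball (a k j) (\<rho> k j))"
    using Q unfolding Q_def by blast+
  define a' where "a' n = (case prod_decode n of (k, j) \<Rightarrow> a k j)" for n
  define \<rho>' where "\<rho>' n = (case prod_decode n of (k, j) \<Rightarrow> \<rho> k j)" for n
  have dec: "E (ball (a' n) (\<rho>' n)) = (\<lambda>(k, j). E (ball (a k j) (\<rho> k j))) (prod_decode n)" for n and E :: "complex set \<Rightarrow> ennreal"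
    by (simp add: a'_def \<rho>'_def split: prod.split)
  have 1: "0 \<le> \<rho>' n \<and> \<rho>' n \<le> 1 \<and> ball (a' n) (\<rho>' n) \<subseteq> ball z0 R" for n
  proof -
    obtain k j where kj: "prod_decode n = (k, j)" by (cases "prod_decode n")
    have "ball (a k j) (\<rho> k j) \<subseteq> ball z0 R" by (rule subset_trans[OF _ U(3)]) (use a(1) in blast)
    then show ?thesis using a(1)[of k j] by (simp add: a'_def \<rho>'_def kj)
  qed
  have SS: "(\<Sum>k. emeasure lborel (S k)) \<le> (\<integral>\<^sup>+ z. ennreal (G z) + indicator (ball z0 R) z \<partial>lborel)"
  proof -
    have "(\<Sum>k. emeasure lborel (S k)) = (\<Sum>k. (\<integral>\<^sup>+ z. indicator (S k) z \<partial>lborel))" by simp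
    also have "\<dots> = (\<integral>\<^sup>+ z. (\<Sum>k. indicator (S k) z) \<partial>lborel)" by (rule nn_integral_suminf[symmetric]) simp
    also have "\<dots> \<le> (\<integral>\<^sup>+ z. ennreal (G z) + indicator (ball z0 R) z \<partial>lborel)"
    proof (rule nn_integral_mono)
      fix z
      have eq: "(indicator (S k) z :: ennreal) = indicator {k. real k < G z} k" for k by (simp add: S_def indicator_def)
      show "(\<Sum>k. indicator (S k) z) \<le> ennreal (G z) + indicator (ball z0 R) z"
      proof (cases "z \<in> ball z0 R")
        case True then show ?thesis using sum_levels(2)[OF G(2)[of z]] G(2)[of z] by (simp add: eq ennreal_plus)
      next
        case False
        then have "z \<notin> S k" for k using Sb[of k] by (meson subsetD)
        then have "indicator (S k) z = (0::ennreal)" for k by simp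
        then show ?thesis by simp
      qed
    qed
    finally show ?thesis .
  qed
  have "(\<Sum>n. emeasure lborel (ball (a' n) (\<rho>' n))) = (\<Sum>k. \<Sum>j. emeasure lborel (ball (a k j) (\<rho> k j)))"
    unfolding dec[of "emeasure lborel"] by (rule suminf_ennreal_2dimen) simp
  also have "\<dots> \<le> (\<Sum>k. emeasure lborel (S k) + ennreal ((1/2)^k))"
    by (intro suminf_le order_trans[OF a(2) U(4)]) auto
  also have "\<dots> = (\<Sum>k. emeasure lborel (S k)) + (\<Sum>k. ennreal ((1/2)^k))"
    by (rule suminf_add[symmetric]) auto
  also have "\<dots> \<le> (\<integral>\<^sup>+ z. ennreal (G z) + indicator (ball z0 R) z \<partial>lborel) + (\<Sum>k. ennreal ((1/2)^k))"
    using SS by (rule add_right_mono)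
  also have "\<dots> < \<infinity>"
  proof -
    have "(\<integral>\<^sup>+ z. ennreal (G z) + indicator (ball z0 R) z \<partial>lborel) = (\<integral>\<^sup>+ z. ennreal (G z) \<partial>lborel) + emeasure lborel (ball z0 R)"
      by (subst nn_integral_add) (simp_all add: borel_measurable_indicator)
    also have "\<dots> < \<infinity>"
      using G emeasure_bounded_finite[OF bounded_ball, of z0 R] by (subst nn_integral_eq_integral) auto
    finally have 1: "(\<integral>\<^sup>+ z. ennreal (G z) + indicator (ball z0 R) z \<partial>lborel) < \<infinity>" .
    have "(\<Sum>k. ennreal ((1/2)^k)) = ennreal (\<Sum>k. (1/2)^k)"
      by (intro suminf_ennreal2) auto
    then show ?thesis using 1 by simp
  qed
  finally have fin: "(\<Sum>n. emeasure lborel (ball (a' n) (\<rho>' n))) < \<infinity>" .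
  have "emeasure lborel (ball (a' n) (\<rho>' n)) = ennreal (pi * (\<rho>' n)^2)" for n
    using 1[of n] by (simp add: emeasure_ball unit_ball_vol_2)
  then have "(\<Sum>n. ennreal (pi * (\<rho>' n)^2)) \<noteq> top" using fin by simp
  then have "summable (\<lambda>n. pi * (\<rho>' n)^2)" by (intro summable_suminf_not_top) auto
  then have 2: "summable (\<lambda>n. (\<rho>' n)^2)" by simp
  have "AE z in lborel. \<forall>k. z \<in> U k \<longrightarrow> z \<in> (\<Union>j. ball (a k j) (\<rho> k j))"
    using a(3) by (simp add: AE_all_countable)
  then have 3: "AE z in lborel. ennreal (G z) \<le> (\<Sum>j. indicator (ball (a' j) (\<rho>' j)) z)"
  proof eventually_elim
    case (elim z)
    have "ennreal (G z) \<le> (\<Sum>k. indicator {k. real k < G z} k)"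
      by (rule sum_levels(1)[OF G(2)])
    also have "\<dots> \<le> (\<Sum>k. \<Sum>j. indicator (ball (a k j) (\<rho> k j)) z)"
    proof (rule suminf_le)
      fix k
      show "indicator {k. real k < G z} k \<le> (\<Sum>j. indicator (ball (a k j) (\<rho> k j)) z :: ennreal)"
      proof (cases "real k < G z")
        case True
        then have "z \<in> U k" using U(2) by (auto simp: S_def)
        then obtain j where "z \<in> ball (a k j) (\<rho> k j)" using elim by blast
        then have "1 = (\<Sum>i\<in>{j}. indicator (ball (a k i) (\<rho> k i)) z :: ennreal)" by simp
        also have "\<dots> \<le> (\<Sum>j. indicator (ball (a k j) (\<rho> k j)) z)" by (rule sum_le_suminf) auto
        finally show ?thesis by (simp add: indicator_def)
      qed simp
    qed auto
    also have "\<dots> = (\<Sum>n. indicator (ball (a' n) (\<rho>' n)) z)"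
      unfolding dec[of "\<lambda>B. indicator B z"] by (rule suminf_ennreal_2dimen[symmetric]) simp
    finally show ?case .
  qed
  show ?thesis using 1 2 3 by blast
qed

section \<open>Logarithmic potentials\<close>

lemma wirtinger_sum:
  fixes f :: "nat \<Rightarrow> complex \<Rightarrow> complex"
  assumes "\<And>j. wirtinger (f j) (p j) (q j)"
  shows "wirtinger (\<lambda>z. \<Sum>j<n. f j z) (\<lambda>z. \<Sum>j<n. p j z) (\<lambda>z. \<Sum>j<n. q j z)"
proof (induction n)
  case 0
  show ?case using wirtinger_const[of 0] by simp
next
  case (Suc n)
  show ?case using wirtinger_add[OF Suc assms[of n]] by simp
qed

text \<open>With \<open>D = |z - a|\<^sup>2 + \<rho>\<^sup>2\<close>, the function \<open>ln D\<close> has mixed derivative \<open>\<rho>\<^sup>2 / D\<^sup>2\<close>, which is at least \<open>1 / (4 \<rho>\<^sup>2)\<close> on the disc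
  because \<open>D \<le> 2 \<rho>\<^sup>2\<close> there. The factor \<open>16 \<rho>\<^sup>2\<close> turns this into \<open>4\<close>: \<open>2\<close> would be absorbed by the square of
  the sum in \<open>weak_carleman\<close>, and the rest is left over. The degenerate radius \<open>0\<close> gives the zero function.\<close>

lemma log_potential:
  fixes a :: complex and \<rho> c :: real
  assumes "\<rho> \<ge> 0"
  shows "\<exists>l m g. wirtinger (\<lambda>z. of_real (16 * \<rho>^2 * (ln ((norm (z - a))^2 + \<rho>^2) - c))) l (\<lambda>z. cnj (l z)) \<and>
     wirtinger l m (\<lambda>z. of_real (g z)) \<and> continuous_on UNIV m \<and> continuous_on UNIV g \<and> (\<forall>z. g z \<ge> 0) \<and> (\<forall>z\<in>ball a \<rho>. 4 \<le> g z)"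
proof (cases "\<rho> = 0")
  case True
  show ?thesis
    using True wirtinger_const[of 0] by (intro exI[of _ "\<lambda>_. 0"]) simp
next
  case False
  with assms have r: "\<rho> > 0" by simp
  define d where "d z = (norm (z - a))^2 + \<rho>^2" for z
  define D where "D z = (z - a) * cnj (z - a) + of_real (\<rho>^2)" for z
  define E where "E z = inverse (D z)" for z
  define k :: complex where "k = of_real (16 * \<rho>^2)"
  have d0: "d z > 0" for z using r by (simp add: d_def add_nonneg_pos)
  have Dd: "D z = of_real (d z)" for z
    unfolding D_def d_def of_real_add complex_norm_square by (rule refl)
  have D0: "D z \<noteq> 0" for z using Dd d0[of z] by simp
  have Dn: "D z \<notin> \<real>\<^sub>\<le>\<^sub>0" for z using d0[of z] by (simp add: Dd complex_nonpos_Reals_iff)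
  have za: "wirtinger (\<lambda>z. z - a) (\<lambda>z. 1) (\<lambda>z. 0)"
    by (rule wirtinger_cong[OF wirtinger_add[OF wirtinger_ident wirtinger_const[of "- a"]]]) auto
  have cza: "wirtinger (\<lambda>z. cnj (z - a)) (\<lambda>z. 0) (\<lambda>z. 1)"
    by (rule wirtinger_cong[OF wirtinger_cnj[OF za]]) auto
  have WD: "wirtinger D (\<lambda>z. cnj (z - a)) (\<lambda>z. z - a)"
    unfolding D_def by (rule wirtinger_cong[OF wirtinger_add[OF wirtinger_mult[OF za cza] wirtinger_const[of "of_real (\<rho>^2)"]]]) auto
  have WL: "wirtinger (\<lambda>z. Ln (D z)) (\<lambda>z. E z * cnj (z - a)) (\<lambda>z. E z * (z - a))"
    unfolding E_def
    by (rule wirtinger_comp_holo[OF WD]) (rule has_field_derivative_Ln[OF Dn])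
  have WE: "wirtinger E (\<lambda>z. - (E z * E z) * cnj (z - a)) (\<lambda>z. - (E z * E z) * (z - a))"
    unfolding E_def
    by (rule wirtinger_comp_holo[OF WD]) (use D0 in \<open>auto intro!: derivative_eq_intros\<close>)
  have LnD: "Ln (D z) = of_real (ln (d z))" for z
    unfolding Dd using d0 by (rule Ln_of_real)
  have cE: "cnj (E z) = E z" for z by (simp add: E_def Dd)
  define l where "l z = k * (E z * cnj (z - a))" for z
  define m where "m z = k * (- (E z * E z) * cnj (z - a) * cnj (z - a))" for z
  define g where "g z = 16 * \<rho>^2 * \<rho>^2 / (d z)^2" for z
  have 1: "wirtinger (\<lambda>z. of_real (16 * \<rho>^2 * (ln ((norm (z - a))^2 + \<rho>^2) - c))) l (\<lambda>z. cnj (l z))"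
    by (rule wirtinger_cong[OF wirtinger_cmult[OF wirtinger_add[OF WL wirtinger_const[of "of_real (- c)"]], of k]])
       (simp_all add: LnD d_def[symmetric] k_def l_def cE)
  have 2: "wirtinger l m (\<lambda>z. of_real (g z))"
  proof (rule wirtinger_cong[OF wirtinger_cmult[OF wirtinger_mult[OF WE cza], of k]])
    fix z
    have Edz: "E z = of_real (1 / d z)" by (simp add: E_def Dd inverse_eq_divide)
    have "(z - a) * cnj (z - a) = of_real (d z - \<rho>^2)"
      using Dd[of z] by (simp add: D_def algebra_simps del: complex_cnj_diff)
    then have "k * (- (E z * E z) * (z - a) * cnj (z - a) + E z * 1) = of_real (16 * \<rho>^2 * (- (1 / d z * (1 / d z)) * (d z - \<rho>^2) + 1 / d z))"
      unfolding Edz k_def by (simp add: mult.assoc del: complex_cnj_diff)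
    also have "16 * \<rho>^2 * (- (1 / d z * (1 / d z)) * (d z - \<rho>^2) + 1 / d z) = g z"
      using d0[of z] by (simp add: g_def field_simps power2_eq_square)
    finally show "k * (- (E z * E z) * (z - a) * cnj (z - a) + E z * 1) = of_real (g z)" .
  qed (simp_all add: l_def m_def)
  have Ec: "continuous_on UNIV E" by (rule wirtinger_continuous[OF WE])
  have mc: "continuous_on UNIV m" unfolding m_def by (intro continuous_intros Ec)
  have dc: "continuous_on UNIV d" unfolding d_def by (intro continuous_intros)
  have gc: "continuous_on UNIV g" unfolding g_def
    by (intro continuous_intros dc) (use d0 in \<open>auto simp: less_imp_neq[symmetric]\<close>)
  have g0: "g z \<ge> 0" for z by (simp add: g_def)
  have g4: "4 \<le> g z" if "z \<in> ball a \<rho>" for z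
  proof -
    have "norm (z - a) \<le> \<rho>" using that by (simp add: dist_norm norm_minus_commute)
    then have "(norm (z - a))^2 \<le> \<rho>^2" by (intro power_mono) auto
    then have "d z \<le> 2 * \<rho>^2" by (simp add: d_def)
    then have "(d z)^2 \<le> (2 * \<rho>^2)^2" using d0[of z] by (intro power_mono) auto
    then have "4 * (d z)^2 \<le> 16 * \<rho>^2 * \<rho>^2" by (simp add: power2_eq_square)
    then show ?thesis using d0[of z] by (simp add: g_def pos_le_divide_eq)
  qed
  show ?thesis using 1 2 mc gc g0 g4 by blast
qed

lemma log_potential_sum:
  fixes a :: "nat \<Rightarrow> complex" and \<rho> :: "nat \<Rightarrow> real" and c :: real
  assumes \<rho>: "\<And>j. \<rho> j \<ge> 0"
  defines "\<psi> n z \<equiv> (\<Sum>j<n. 16 * (\<rho> j)^2 * (ln ((norm (z - a j))^2 + (\<rho> j)^2) - c))"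
  shows "\<exists>l m g. wirtinger (\<lambda>z. of_real (\<psi> n z)) l (\<lambda>z. cnj (l z)) \<and>
     wirtinger l m (\<lambda>z. of_real (g z)) \<and> continuous_on UNIV m \<and> continuous_on UNIV g \<and> (\<forall>z. g z \<ge> 0) \<and>
     (\<forall>z. 4 * (\<Sum>j<n. indicator (ball (a j) (\<rho> j)) z) \<le> g z)"
proof -
  have "\<forall>j. \<exists>l m g. wirtinger (\<lambda>z. of_real (16 * (\<rho> j)^2 * (ln ((norm (z - a j))^2 + (\<rho> j)^2) - c))) l (\<lambda>z. cnj (l z)) \<and>
     wirtinger l m (\<lambda>z. of_real (g z)) \<and> continuous_on UNIV m \<and> continuous_on UNIV g \<and> (\<forall>z. g z \<ge> 0) \<and> (\<forall>z\<in>ball (a j) (\<rho> j). 4 \<le> g z)"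
    by (intro allI log_potential \<rho>)
  then obtain l m g where H: "\<And>j. wirtinger (\<lambda>z. of_real (16 * (\<rho> j)^2 * (ln ((norm (z - a j))^2 + (\<rho> j)^2) - c))) (l j) (\<lambda>z. cnj (l j z)) \<and>
     wirtinger (l j) (m j) (\<lambda>z. of_real (g j z)) \<and> continuous_on UNIV (m j) \<and> continuous_on UNIV (g j) \<and> (\<forall>z. g j z \<ge> 0) \<and> (\<forall>z\<in>ball (a j) (\<rho> j). 4 \<le> g j z)"
    unfolding choice_iff by blast
  have 1: "wirtinger (\<lambda>z. of_real (\<psi> n z)) (\<lambda>z. \<Sum>j<n. l j z) (\<lambda>z. cnj (\<Sum>j<n. l j z))"
    unfolding \<psi>_def of_real_sum cnj_sum by (rule wirtinger_sum) (use H in blast)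
  have 2: "wirtinger (\<lambda>z. \<Sum>j<n. l j z) (\<lambda>z. \<Sum>j<n. m j z) (\<lambda>z. of_real (\<Sum>j<n. g j z))"
    unfolding of_real_sum by (rule wirtinger_sum) (use H in blast)
  have 3: "continuous_on UNIV (\<lambda>z. \<Sum>j<n. m j z)" "continuous_on UNIV (\<lambda>z. \<Sum>j<n. g j z)"
    by (intro continuous_on_sum; use H in blast)+
  have 4: "(\<Sum>j<n. g j z) \<ge> 0" for z by (intro sum_nonneg) (use H in blast)
  have 5: "4 * (\<Sum>j<n. indicator (ball (a j) (\<rho> j)) z) \<le> (\<Sum>j<n. g j z)" for z
  proof -
    have "4 * indicator (ball (a j) (\<rho> j)) z \<le> g j z" for j
      using H[of j] by (cases "z \<in> ball (a j) (\<rho> j)") auto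
    then show ?thesis unfolding sum_distrib_left by (intro sum_mono)
  qed
  show ?thesis
    by (rule exI[of _ "\<lambda>z. \<Sum>j<n. l j z"], rule exI[of _ "\<lambda>z. \<Sum>j<n. m j z"], rule exI[of _ "\<lambda>z. \<Sum>j<n. g j z"])
       (intro conjI allI 1 2 3 4 5)
qed

text \<open>Integer layers again: \<open>|z - a| < e\<^bsup>-k\<^esup>\<close> holds exactly for the naturals \<open>k\<close> below \<open>- ln |z - a|\<close>. It bounds the
  integral of the logarithm by a geometric series of areas, uniformly in \<open>a\<close>.\<close>

lemma neg_ln_le_layers:
  fixes a z :: complex
  assumes "z \<noteq> a"
  shows "ennreal (- ln (norm (z - a))) \<le> (\<Sum>k. indicator (ball a (exp (- real k))) z)"
proof (cases "ln (norm (z - a)) \<le> 0")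
  case True
  have eq: "(indicator (ball a (exp (- real k))) z :: ennreal) = indicator {k. real k < - ln (norm (z - a))} k" for k
  proof -
    have "norm (z - a) < exp (- real k) \<longleftrightarrow> ln (norm (z - a)) < - real k"
      using assms by (metis exp_less_cancel_iff exp_ln right_minus_eq zero_less_norm_iff)
    then show ?thesis by (auto simp: indicator_def dist_norm norm_minus_commute)
  qed
  show ?thesis unfolding eq by (rule sum_levels(1)) (use True in simp)
qed (simp add: ennreal_neg)

text \<open>The integral over the disc of the \<open>j\<close>-th term is at most a fixed multiple of \<open>\<rho>\<^sub>j\<^sup>2\<close>, since the logarithm is
  integrable uniformly in its pole. A series of nonnegative functions with summable integrals converges almost everywhere.\<close>

lemma log_potential_AE_summable:
  fixes a :: "nat \<Rightarrow> complex" and \<rho> :: "nat \<Rightarrow> real"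
  assumes \<rho>: "\<And>j. \<rho> j \<ge> 0" and s: "summable (\<lambda>j. (\<rho> j)^2)"
    and bd: "\<And>j z. z \<in> ball z0 R \<Longrightarrow> \<rho> j > 0 \<Longrightarrow> ln ((norm (z - a j))^2 + (\<rho> j)^2) \<le> c" and c: "c \<ge> 0"
  shows "AE z in lborel. z \<in> ball z0 R \<longrightarrow> summable (\<lambda>j. 16 * (\<rho> j)^2 * (c - ln ((norm (z - a j))^2 + (\<rho> j)^2)))"
proof -
  let ?t = "\<lambda>j z. 16 * (\<rho> j)^2 * (c - ln ((norm (z - a j))^2 + (\<rho> j)^2))"
  let ?B = "ball z0 R"
  have [measurable]: "Measurable.pred borel (\<lambda>x. x \<in> ?B)" by (simp add: pred_def)
  define S where "S = (\<Sum>k. ennreal (pi * (exp (-2)) ^ k))"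
  \<comment> \<open>Bounds the integral of \<open>c - 2 ln |z - a|\<close> over the disc for every pole \<open>a\<close>.\<close>
  define W where "W = ennreal c * emeasure lborel ?B + 2 * S"
  have "S = ennreal (\<Sum>k. pi * (exp (-2)) ^ k)" unfolding S_def by (intro suminf_ennreal2) (auto intro!: summable_mult summable_geometric)
  then have "W < \<infinity>" unfolding W_def using emeasure_bounded_finite[OF bounded_ball, of z0 R]
    by (auto simp: ennreal_mult_less_top)
  then obtain w where w: "W = ennreal w" "w \<ge> 0" by (metis ennreal_cases infinity_ennreal_def less_irrefl)
  have one: "(\<integral>\<^sup>+ z. ennreal (?t j z) * indicator ?B z \<partial>lborel) \<le> ennreal (16 * (\<rho> j)^2 * w)" for j
  proof (cases "\<rho> j = 0")
    case False
    have "(\<integral>\<^sup>+ z. ennreal (?t j z) * indicator ?B z \<partial>lborel) \<le>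
       (\<integral>\<^sup>+ z. ennreal (16 * (\<rho> j)^2) * (ennreal c * indicator ?B z + 2 * (\<Sum>k. indicator (ball (a j) (exp (- real k))) z)) \<partial>lborel)"
    proof (rule nn_integral_mono_AE)
      have "AE z in lborel. z \<noteq> a j" by (rule AE_lborel_singleton)
      then show "AE z in lborel. ennreal (?t j z) * indicator ?B z \<le> ennreal (16 * (\<rho> j)^2) * (ennreal c * indicator ?B z + 2 * (\<Sum>k. indicator (ball (a j) (exp (- real k))) z))"
      proof eventually_elim
        case (elim z)
        show ?case
        proof (cases "z \<in> ?B")
          case True
          have n0: "norm (z - a j) > 0" using elim by simp
          have "ln ((norm (z - a j))^2) \<le> ln ((norm (z - a j))^2 + (\<rho> j)^2)"
            using n0 by (intro ln_mono) (auto intro: add_pos_nonneg)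
          then have "c - ln ((norm (z - a j))^2 + (\<rho> j)^2) \<le> c + 2 * - ln (norm (z - a j))"
            using n0 by (simp add: ln_realpow)
          then have "ennreal (c - ln ((norm (z - a j))^2 + (\<rho> j)^2)) \<le> ennreal (c + 2 * - ln (norm (z - a j)))"
            by (rule ennreal_leI)
          also have "\<dots> \<le> ennreal c + ennreal (2 * - ln (norm (z - a j)))"
            using c by (cases "ln (norm (z - a j)) \<le> 0") (auto simp: ennreal_neg simp flip: ennreal_plus intro: ennreal_leI)
          also have "ennreal (2 * - ln (norm (z - a j))) = 2 * ennreal (- ln (norm (z - a j)))"
            by (subst ennreal_mult') auto
          also have "\<dots> \<le> 2 * (\<Sum>k. indicator (ball (a j) (exp (- real k))) z)"
            by (intro mult_left_mono neg_ln_le_layers elim) auto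
          finally have "ennreal (c - ln ((norm (z - a j))^2 + (\<rho> j)^2)) \<le> ennreal c + 2 * (\<Sum>k. indicator (ball (a j) (exp (- real k))) z)"
            by (simp add: add_left_mono)
          then have "ennreal (16 * (\<rho> j)^2) * ennreal (c - ln ((norm (z - a j))^2 + (\<rho> j)^2)) \<le> ennreal (16 * (\<rho> j)^2) * (ennreal c + 2 * (\<Sum>k. indicator (ball (a j) (exp (- real k))) z))"
            by (intro mult_left_mono) auto
          then show ?thesis using True by (simp add: ennreal_mult')
        qed simp
      qed
    qed
    also have "\<dots> = ennreal (16 * (\<rho> j)^2) * (ennreal c * emeasure lborel ?B + 2 * (\<Sum>k. emeasure lborel (ball (a j) (exp (- real k)))))"
    proof -
      have ib [measurable]: "(indicator (ball (a j) (exp (- real k))) :: complex \<Rightarrow> ennreal) \<in> borel_measurable borel" for k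
        by (intro borel_measurable_indicator borel_open open_ball)
      have ib' [measurable]: "(indicator ?B :: complex \<Rightarrow> ennreal) \<in> borel_measurable borel"
        by (intro borel_measurable_indicator borel_open open_ball)
      have ms [measurable]: "(\<lambda>z. \<Sum>k. indicator (ball (a j) (exp (- real k))) z :: ennreal) \<in> borel_measurable borel"
        by (intro borel_measurable_suminf_order ib)
      have "(\<integral>\<^sup>+ z. (\<Sum>k. indicator (ball (a j) (exp (- real k))) z) \<partial>lborel) = (\<Sum>k. emeasure lborel (ball (a j) (exp (- real k))))"
        by (subst nn_integral_suminf) (simp_all add: ib)
      moreover have "(\<integral>\<^sup>+ z. ennreal c * indicator ?B z \<partial>lborel) = ennreal c * emeasure lborel ?B"
        by (intro nn_integral_cmult_indicator) simp
      ultimately show ?thesis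
        using ms ib' by (simp add: nn_integral_cmult nn_integral_add borel_measurable_times)
    qed
    also have "(\<Sum>k. emeasure lborel (ball (a j) (exp (- real k)))) = S"
      unfolding S_def by (intro suminf_cong) (simp add: emeasure_ball unit_ball_vol_2 flip: exp_of_nat_mult exp_double)
    also have "ennreal (16 * (\<rho> j)^2) * (ennreal c * emeasure lborel ?B + 2 * S) = ennreal (16 * (\<rho> j)^2 * w)"
      using w by (simp add: W_def[symmetric] ennreal_mult)
    finally show ?thesis .
  qed simp
  have "(\<integral>\<^sup>+ z. (\<Sum>j. ennreal (?t j z) * indicator ?B z) \<partial>lborel) = (\<Sum>j. \<integral>\<^sup>+ z. ennreal (?t j z) * indicator ?B z \<partial>lborel)"
    by (rule nn_integral_suminf) measurable
  also have "\<dots> \<le> (\<Sum>j. ennreal (16 * (\<rho> j)^2 * w))"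
    by (intro suminf_le one) auto
  also have "\<dots> = ennreal (\<Sum>j. 16 * (\<rho> j)^2 * w)"
    using s w by (intro suminf_ennreal2) (auto intro!: summable_mult summable_mult2)
  also have "\<dots> < \<infinity>" by simp
  finally have "(\<integral>\<^sup>+ z. (\<Sum>j. ennreal (?t j z) * indicator ?B z) \<partial>lborel) \<noteq> \<infinity>" by simp
  then have "AE z in lborel. (\<Sum>j. ennreal (?t j z) * indicator ?B z) \<noteq> \<infinity>"
    by (intro nn_integral_PInf_AE) measurable
  then show ?thesis
  proof eventually_elim
    case (elim z)
    show ?case
    proof
      assume z: "z \<in> ?B"
      have "?t j z \<ge> 0" for j using bd[OF z, of j] \<rho>[of j] by (cases "\<rho> j = 0") auto
      then show "summable (\<lambda>j. ?t j z)"
        using elim z by (intro summable_suminf_not_top) auto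
    qed
  qed
qed

section \<open>The singular weight\<close>

text \<open>The weight \<open>P\<close> is the decreasing limit of the weights \<open>e\<^bsup>\<psi> n\<^esup>\<close> of the partial sums; it is positive because the
  potential is finite almost everywhere. On the left, the first \<open>N\<close> discs are kept while \<open>n\<close> tends to infinity (Fatou),
  and then \<open>N\<close> tends to infinity (monotone convergence). On the right, \<open>e\<^bsup>\<psi> n\<^esup> \<le> 1\<close> on the disc dominates.\<close>

lemma singular_weight_carleman:
  fixes G :: "complex \<Rightarrow> real"
  assumes G: "integrable lborel G" "\<And>z. G z \<ge> 0" "\<forall>z. z \<notin> ball z0 R' \<longrightarrow> G z = 0"
  shows "\<exists>P :: complex \<Rightarrow> real. P \<in> borel_measurable borel \<and> (\<forall>z. 0 < P z \<and> P z \<le> 1) \<and>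
    (\<forall>f F \<eta> \<eta>q. dbar_pair z0 R' f F \<longrightarrow> cutoff_in z0 R' \<eta> \<eta>q \<longrightarrow>
       (\<integral>\<^sup>+ z. ennreal (4 * G z * (norm (\<eta> z * f z))^2 * P z) \<partial>lborel) \<le>
         2 * (\<integral>\<^sup>+ z. ennreal ((norm (F z))^2 * ((norm (\<eta> z))^2 * P z)) \<partial>lborel)
         + 2 * (\<integral>\<^sup>+ z. ennreal ((norm (f z))^2 * ((norm (\<eta>q z))^2 * P z)) \<partial>lborel))"
proof -
  have "\<exists>a \<rho>. (\<forall>j::nat. 0 \<le> \<rho> j \<and> \<rho> j \<le> 1 \<and> ball (a j) (\<rho> j) \<subseteq> ball z0 R') \<and> summable (\<lambda>j. (\<rho> j)^2) \<and>
    (AE z in lborel. ennreal (G z) \<le> (\<Sum>j. indicator (ball (a j) (\<rho> j)) z))"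
    by (rule ball_majorant[OF G(1,2)]) (rule G(3)[rule_format])
  then obtain a \<rho> where H: "\<forall>j::nat. 0 \<le> \<rho> j \<and> \<rho> j \<le> 1 \<and> ball (a j) (\<rho> j) \<subseteq> ball z0 R'" "summable (\<lambda>j. (\<rho> j)^2)"
    "AE z in lborel. ennreal (G z) \<le> (\<Sum>j. indicator (ball (a j) (\<rho> j)) z)"
    by (elim exE conjE) (rule that)
  have \<rho>: "0 \<le> \<rho> j" "\<rho> j \<le> 1" "ball (a j) (\<rho> j) \<subseteq> ball z0 R'" for j using H(1) by simp_all
  \<comment> \<open>The largest value that the logarithms can take on the disc; subtracting it makes the potentials nonpositive.\<close>
  define c where "c = ln (4 * R'^2 + 1)"
  have c0: "c \<ge> 0" by (simp add: c_def)
  have bd: "ln ((norm (z - a j))^2 + (\<rho> j)^2) \<le> c" if "z \<in> ball z0 R'" "\<rho> j > 0" for j z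
  proof -
    have "a j \<in> ball (a j) (\<rho> j)" using that(2) by simp
    then have "a j \<in> ball z0 R'" by (rule subsetD[OF \<rho>(3)])
    then have "norm (z - a j) \<le> 2 * R'"
      using that(1) dist_triangle[of z "a j" z0] by (simp add: dist_norm norm_minus_commute)
    then have "(norm (z - a j))^2 \<le> (2 * R')^2" by (intro power_mono) auto
    moreover have "(\<rho> j)^2 \<le> 1" using \<rho>(1,2)[of j] by (simp add: power_le_one)
    ultimately have "(norm (z - a j))^2 + (\<rho> j)^2 \<le> 4 * R'^2 + 1" by (simp add: power_mult_distrib)
    moreover have "(norm (z - a j))^2 + (\<rho> j)^2 > 0" using that(2) by (intro add_nonneg_pos) auto
    ultimately show ?thesis unfolding c_def by (intro ln_mono) auto
  qed
  define t where "t j z = 16 * (\<rho> j)^2 * (c - ln ((norm (z - a j))^2 + (\<rho> j)^2))" for j z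
  define \<psi> where "\<psi> n z = (\<Sum>j<n. 16 * (\<rho> j)^2 * (ln ((norm (z - a j))^2 + (\<rho> j)^2) - c))" for n z
  have \<psi>t: "\<psi> n z = - (\<Sum>j<n. t j z)" for n z
    unfolding \<psi>_def t_def sum_negf[symmetric] by (intro sum.cong refl) (simp add: algebra_simps)
  have t0: "t j z \<ge> 0" if "z \<in> ball z0 R'" for j z
    using bd[OF that, of j] \<rho>(1)[of j] by (cases "\<rho> j = 0") (auto simp: t_def)
  have \<psi>0: "exp (\<psi> n z) \<le> 1" if "z \<in> ball z0 R'" for n z
    using t0[OF that] by (simp add: \<psi>t sum_nonneg)
  have [measurable]: "t j \<in> borel_measurable borel" for j unfolding t_def by measurable
  have [measurable]: "\<psi> n \<in> borel_measurable borel" for n unfolding \<psi>_def by measurable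
  have [measurable]: "G \<in> borel_measurable borel" using G by auto
  \<comment> \<open>The minimum and the value of a divergent \<open>suminf\<close> matter only on a null set and outside the disc.\<close>
  define P where "P z = min 1 (exp (- (\<Sum>j. t j z)))" for z
  have Pm [measurable]: "P \<in> borel_measurable borel" unfolding P_def by measurable
  have P: "0 < P z" "P z \<le> 1" for z by (auto simp: P_def)
  have AEs: "AE z in lborel. z \<in> ball z0 R' \<longrightarrow> summable (\<lambda>j. t j z)"
    unfolding t_def by (rule log_potential_AE_summable[OF \<rho>(1) H(2) bd c0])
  have lim: "AE z in lborel. z \<in> ball z0 R' \<longrightarrow> (\<lambda>n. exp (\<psi> n z)) \<longlonglongrightarrow> P z"
    using AEs
  proof eventually_elim
    case (elim z)
    show ?case
    proof
      assume z: "z \<in> ball z0 R'"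
      then have s: "summable (\<lambda>j. t j z)" using elim by blast
      have "(\<Sum>j. t j z) \<ge> 0" by (rule suminf_nonneg[OF s t0[OF z]])
      then have Pz: "P z = exp (- (\<Sum>j. t j z))" by (simp add: P_def)
      show "(\<lambda>n. exp (\<psi> n z)) \<longlonglongrightarrow> P z"
        unfolding Pz \<psi>t by (intro tendsto_intros summable_LIMSEQ s)
    qed
  qed
  show ?thesis
  proof (rule exI[of _ P], intro conjI allI impI Pm P)
    fix f F \<eta> \<eta>q :: "complex \<Rightarrow> complex"
    assume pair: "dbar_pair z0 R' f F" and cutoff: "cutoff_in z0 R' \<eta> \<eta>q"
    have f: "integrable lborel f" "integrable lborel (\<lambda>z. (norm (f z))^2)"
      and F: "integrable lborel F" "integrable lborel (\<lambda>z. (norm (F z))^2)"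
      using pair by (simp_all add: dbar_pair_def)
    obtain \<eta>p R where \<eta>: "wirtinger2 \<eta> \<eta>p \<eta>q" "\<forall>z. R \<le> norm (z - z0) \<longrightarrow> \<eta> z = 0" and R: "R < R'"
      using cutoff unfolding cutoff_in_def by blast
    have \<eta>c: "continuous_on UNIV \<eta>" "continuous_on UNIV \<eta>q"
      using \<eta>(1) wirtinger_continuous unfolding wirtinger2_def by blast+
    have w1: "wirtinger \<eta> \<eta>p \<eta>q" using \<eta> by (simp add: wirtinger2_def)
    have out: "\<eta> z = 0" "\<eta>q z = 0" if "R < norm (z - z0)" for z
    proof -
      have "open {z. R < norm (z - z0)}" by (intro open_Collect_less continuous_intros)
      from wirtinger_zero_outside(2)[OF w1 this, of z] that \<eta>(2) show "\<eta>q z = 0" by simp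
      show "\<eta> z = 0" using that \<eta>(2) by simp
    qed
    have out': "\<eta> z = 0" "\<eta>q z = 0" if "z \<notin> ball z0 R'" for z
      using out[of z] that R by (auto simp: dist_norm norm_minus_commute)
    have big: "R < norm (z - z0)" if "norm z0 + R < norm z" for z
      using that norm_triangle_ineq2[of z z0] by linarith
    obtain C1 where C1: "\<And>z. norm (\<eta> z) \<le> C1"
      by (rule compact_support_bounded[OF \<eta>c(1), of "norm z0 + R"]) (use out(1) big in auto)
    obtain C2 where C2: "\<And>z. norm (\<eta>q z) \<le> C2"
      by (rule compact_support_bounded[OF \<eta>c(2), of "norm z0 + R"]) (use out(2) big in auto)
    have [measurable]: "f \<in> borel_measurable borel" "F \<in> borel_measurable borel" "\<eta> \<in> borel_measurable borel" "\<eta>q \<in> borel_measurable borel"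
      using f F \<eta>c by (auto intro: borel_measurable_continuous_onI)
    let ?A = "\<lambda>n. \<integral>\<^sup>+ z. ennreal ((norm (F z))^2 * ((norm (\<eta> z))^2 * exp (\<psi> n z))) \<partial>lborel"
    let ?B = "\<lambda>n. \<integral>\<^sup>+ z. ennreal ((norm (f z))^2 * ((norm (\<eta>q z))^2 * exp (\<psi> n z))) \<partial>lborel"
    let ?A' = "\<integral>\<^sup>+ z. ennreal ((norm (F z))^2 * ((norm (\<eta> z))^2 * P z)) \<partial>lborel"
    let ?B' = "\<integral>\<^sup>+ z. ennreal ((norm (f z))^2 * ((norm (\<eta>q z))^2 * P z)) \<partial>lborel"
    have conv_rhs: "(\<lambda>n. \<integral>\<^sup>+ z. ennreal ((norm (k z))^2 * ((norm (\<theta> z))^2 * exp (\<psi> n z))) \<partial>lborel) \<longlonglongrightarrow>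
        (\<integral>\<^sup>+ z. ennreal ((norm (k z))^2 * ((norm (\<theta> z))^2 * P z)) \<partial>lborel)"
      if k: "integrable lborel (\<lambda>z. (norm (k z))^2)" and [measurable]: "k \<in> borel_measurable borel" "\<theta> \<in> borel_measurable borel"
        and C: "\<And>z. norm (\<theta> z) \<le> C" and o: "\<And>z. z \<notin> ball z0 R' \<Longrightarrow> \<theta> z = 0" for k \<theta> :: "complex \<Rightarrow> complex" and C
    proof (rule nn_integral_dominated_convergence[where w="\<lambda>z. ennreal ((norm (k z))^2 * C^2)"])
      show "(\<integral>\<^sup>+ z. ennreal ((norm (k z))^2 * C^2) \<partial>lborel) < \<infinity>"
        using k by (subst nn_integral_eq_integral) auto
      show "AE z in lborel. ennreal ((norm (k z))^2 * ((norm (\<theta> z))^2 * exp (\<psi> n z))) \<le> ennreal ((norm (k z))^2 * C^2)" for n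
      proof (intro AE_I2 ennreal_leI mult_left_mono)
        fix z
        show "(norm (\<theta> z))^2 * exp (\<psi> n z) \<le> C^2"
        proof (cases "z \<in> ball z0 R'")
          case True
          have "(norm (\<theta> z))^2 * exp (\<psi> n z) \<le> C^2 * 1"
            by (intro mult_mono power_mono C \<psi>0[OF True]) auto
          then show ?thesis by simp
        qed (use o in simp)
      qed simp
      show "AE z in lborel. (\<lambda>n. ennreal ((norm (k z))^2 * ((norm (\<theta> z))^2 * exp (\<psi> n z)))) \<longlonglongrightarrow> ennreal ((norm (k z))^2 * ((norm (\<theta> z))^2 * P z))"
        using lim
      proof eventually_elim
        case (elim z)
        show ?case
        proof (cases "z \<in> ball z0 R'")
          case True
          then show ?thesis using elim by (intro tendsto_ennrealI tendsto_intros) blast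
        qed (use o in simp)
      qed
    qed measurable
    have lims: "(\<lambda>n. 2 * ?A n + 2 * ?B n) \<longlonglongrightarrow> 2 * ?A' + 2 * ?B'"
      by (intro tendsto_add ennreal_tendsto_cmult conv_rhs[OF F(2) _ _ C1 out'(1)] conv_rhs[OF f(2) _ _ C2 out'(2)]) simp_all
    let ?X = "\<lambda>z. ennreal (4 * (norm (\<eta> z * f z))^2 * P z)"
    \<comment> \<open>Fatou's lemma as \<open>n\<close> tends to infinity, with the first \<open>N\<close> discs frozen.\<close>
    have fixN: "(\<Sum>j<N. \<integral>\<^sup>+ z. indicator (ball (a j) (\<rho> j)) z * ?X z \<partial>lborel) \<le> 2 * ?A' + 2 * ?B'" for N
    proof -
      define I where "I z = (\<Sum>j<N. indicator (ball (a j) (\<rho> j)) z :: real)" for z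
      have bm: "ball (a j) (\<rho> j) \<in> sets borel" for j by simp
      have [measurable]: "I \<in> borel_measurable borel" unfolding I_def
        by (intro borel_measurable_sum borel_measurable_indicator bm)
      have I0: "I z \<ge> 0" for z unfolding I_def by (intro sum_nonneg) simp
      have step: "(\<integral>\<^sup>+ z. ennreal (4 * I z * (norm (\<eta> z * f z))^2 * exp (\<psi> n z)) \<partial>lborel) \<le> 2 * ?A n + 2 * ?B n" if "N \<le> n" for n
      proof -
        obtain l m g where lmg: "wirtinger (\<lambda>z. of_real (\<psi> n z)) l (\<lambda>z. cnj (l z))" "wirtinger l m (\<lambda>z. of_real (g z))"
          "continuous_on UNIV m" "continuous_on UNIV g" "\<forall>z. g z \<ge> 0"
          "\<forall>z. 4 * (\<Sum>j<n. indicator (ball (a j) (\<rho> j)) z) \<le> g z"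
          using log_potential_sum[where \<rho>=\<rho> and a=a and c=c and n=n, OF \<rho>(1), folded \<psi>_def] by (elim exE conjE) (rule that)
        have "(\<integral>\<^sup>+ z. ennreal (4 * I z * (norm (\<eta> z * f z))^2 * exp (\<psi> n z)) \<partial>lborel) \<le> (\<integral>\<^sup>+ z. ennreal (g z * (norm (\<eta> z * f z))^2 * exp (\<psi> n z)) \<partial>lborel)"
        proof (intro nn_integral_mono ennreal_leI mult_right_mono)
          fix z
          have "I z \<le> (\<Sum>j<n. indicator (ball (a j) (\<rho> j)) z)"
            unfolding I_def using that by (intro sum_mono2) auto
          also have "4 * \<dots> \<le> g z" using lmg(6) by blast
          finally show "4 * I z \<le> g z" by simp
        qed auto
        also have "\<dots> \<le> 2 * ?A n + 2 * ?B n"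
          by (rule weak_carleman[OF pair cutoff lmg(1-4)]) (use lmg(5) in blast)
        finally show ?thesis .
      qed
      have "(\<Sum>j<N. \<integral>\<^sup>+ z. indicator (ball (a j) (\<rho> j)) z * ?X z \<partial>lborel) = (\<integral>\<^sup>+ z. (\<Sum>j<N. indicator (ball (a j) (\<rho> j)) z * ?X z) \<partial>lborel)"
      proof (rule nn_integral_sum[symmetric])
        fix j
        have [measurable]: "(indicator (ball (a j) (\<rho> j)) :: complex \<Rightarrow> ennreal) \<in> borel_measurable borel"
          by (intro borel_measurable_indicator bm)
        show "(\<lambda>z. indicator (ball (a j) (\<rho> j)) z * ?X z) \<in> borel_measurable lborel" by measurable
      qed
      also have "\<dots> = (\<integral>\<^sup>+ z. ennreal (4 * I z * (norm (\<eta> z * f z))^2 * P z) \<partial>lborel)"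
      proof (rule nn_integral_cong)
        fix z
        have "(\<Sum>j<N. indicator (ball (a j) (\<rho> j)) z * ?X z) = (\<Sum>j<N. ennreal (indicator (ball (a j) (\<rho> j)) z)) * ?X z"
          by (simp only: sum_distrib_right ennreal_indicator)
        also have "(\<Sum>j<N. ennreal (indicator (ball (a j) (\<rho> j)) z)) = ennreal (I z)"
          unfolding I_def by (rule sum_ennreal) simp
        also have "ennreal (I z) * ?X z = ennreal (4 * I z * (norm (\<eta> z * f z))^2 * P z)"
          using I0[of z] P(1)[of z] by (subst ennreal_mult[symmetric]) (auto simp: mult_ac)
        finally show "(\<Sum>j<N. indicator (ball (a j) (\<rho> j)) z * ?X z) = ennreal (4 * I z * (norm (\<eta> z * f z))^2 * P z)" .
      qed
      also have "\<dots> = (\<integral>\<^sup>+ z. liminf (\<lambda>n. ennreal (4 * I z * (norm (\<eta> z * f z))^2 * exp (\<psi> n z))) \<partial>lborel)"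
      proof (rule nn_integral_cong_AE)
        show "AE z in lborel. ennreal (4 * I z * (norm (\<eta> z * f z))^2 * P z) = liminf (\<lambda>n. ennreal (4 * I z * (norm (\<eta> z * f z))^2 * exp (\<psi> n z)))"
          using lim
        proof eventually_elim
          case (elim z)
          have "(\<lambda>n. ennreal (4 * I z * (norm (\<eta> z * f z))^2 * exp (\<psi> n z))) \<longlonglongrightarrow> ennreal (4 * I z * (norm (\<eta> z * f z))^2 * P z)"
          proof (cases "z \<in> ball z0 R'")
            case True
            then show ?thesis using elim by (intro tendsto_ennrealI tendsto_intros) blast
          qed (simp add: out')
          from lim_imp_Liminf[OF _ this] show ?case by simp
        qed
      qed
      also have "\<dots> \<le> liminf (\<lambda>n. \<integral>\<^sup>+ z. ennreal (4 * I z * (norm (\<eta> z * f z))^2 * exp (\<psi> n z)) \<partial>lborel)"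
        by (rule nn_integral_liminf) measurable
      also have "\<dots> \<le> liminf (\<lambda>n. 2 * ?A n + 2 * ?B n)"
        by (rule Liminf_mono) (use step in \<open>auto simp: eventually_sequentially\<close>)
      also have "\<dots> = 2 * ?A' + 2 * ?B'"
        using lim_imp_Liminf[OF _ lims] by simp
      finally show ?thesis .
    qed
    have "(\<integral>\<^sup>+ z. ennreal (4 * G z * (norm (\<eta> z * f z))^2 * P z) \<partial>lborel) \<le> (\<integral>\<^sup>+ z. (\<Sum>j. indicator (ball (a j) (\<rho> j)) z * ?X z) \<partial>lborel)"
    proof (rule nn_integral_mono_AE)
      show "AE z in lborel. ennreal (4 * G z * (norm (\<eta> z * f z))^2 * P z) \<le> (\<Sum>j. indicator (ball (a j) (\<rho> j)) z * ?X z)"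
        using H(3)
      proof eventually_elim
        case (elim z)
        have "ennreal (4 * G z * (norm (\<eta> z * f z))^2 * P z) = ennreal (G z) * ?X z"
          using G(2)[of z] P(1)[of z] by (subst ennreal_mult[symmetric]) (auto simp: mult_ac)
        also have "\<dots> \<le> (\<Sum>j. indicator (ball (a j) (\<rho> j)) z) * ?X z"
          using elim by (rule mult_right_mono) simp
        also have "\<dots> = (\<Sum>j. indicator (ball (a j) (\<rho> j)) z * ?X z)"
          by (rule ennreal_suminf_multc[symmetric])
        finally show ?case .
      qed
    qed
    also have "\<dots> = (\<Sum>j. \<integral>\<^sup>+ z. indicator (ball (a j) (\<rho> j)) z * ?X z \<partial>lborel)"
    proof (rule nn_integral_suminf)
      fix j
      have [measurable]: "(indicator (ball (a j) (\<rho> j)) :: complex \<Rightarrow> ennreal) \<in> borel_measurable borel"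
        by (intro borel_measurable_indicator borel_open open_ball)
      show "(\<lambda>z. indicator (ball (a j) (\<rho> j)) z * ?X z) \<in> borel_measurable lborel" by measurable
    qed
    also have "\<dots> \<le> 2 * ?A' + 2 * ?B'"
      by (rule suminf_le_const) (use fixN in auto)
    finally show "(\<integral>\<^sup>+ z. ennreal (4 * G z * (norm (\<eta> z * f z))^2 * P z) \<partial>lborel) \<le> 2 * ?A' + 2 * ?B'" .
  qed
qed

section \<open>Cutoff functions with a pole factored in\<close>

lemma max_power_deriv:
  assumes "n \<ge> 1"
  shows "((\<lambda>t::real. max 0 t ^ Suc n) has_real_derivative real (Suc n) * max 0 t ^ n) (at t)"
proof (cases t "0::real" rule: linorder_cases)
  case less
  then have 0: "real (Suc n) * max 0 t ^ n = 0" using assms by simp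
  show ?thesis unfolding 0
    by (rule has_field_derivative_transform_within_open[where S="{..<0}" and f="\<lambda>_. 0"])
       (use less assms in \<open>auto simp: max_def\<close>)
next
  case greater
  have "((\<lambda>t::real. t ^ Suc n) has_real_derivative real (Suc n) * max 0 t ^ n) (at t)"
    using DERIV_pow[of "Suc n" t UNIV] greater by (simp add: max_def)
  then show ?thesis
    by (rule has_field_derivative_transform_within_open[where S="{0<..}"])
       (use greater in \<open>auto simp: max_def\<close>)
next
  case equal
  have "((\<lambda>h::real. max 0 h ^ n) \<longlongrightarrow> max 0 0 ^ n) (at 0)"
    by (intro tendsto_intros)
  moreover have "max 0 0 ^ n = (0::real)" using assms by simp
  ultimately have "((\<lambda>h::real. max 0 h ^ n) \<longlongrightarrow> 0) (at 0)" by (simp only:)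
  moreover have "\<forall>\<^sub>F h in at 0. max 0 h ^ n = max 0 h ^ Suc n / (h::real)"
    using assms by (auto simp: eventually_at_filter max_def)
  ultimately have "((\<lambda>h::real. max 0 h ^ Suc n / h) \<longlongrightarrow> 0) (at 0)"
    by (rule Lim_transform_eventually)
  moreover have "real (Suc n) * max 0 0 ^ n = 0" "max 0 0 ^ Suc n = (0::real)" using assms by simp_all
  ultimately show ?thesis unfolding equal DERIV_def by (simp only: add_0_left diff_zero)
qed

text \<open>A function in \<open>C\<^sup>2\<close> that rises from \<open>0\<close> to \<open>1\<close> on \<open>[0, 1]\<close>: since \<open>max 0 t ^ 3\<close> is in \<open>C\<^sup>2\<close>, so is the composition,
  and the truncation makes it exactly constant on both sides.\<close>

definition smoothstep :: "real \<Rightarrow> real" where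
  "smoothstep t = 1 - max 0 (1 - max 0 t ^ 3) ^ 3"
definition smoothstep' :: "real \<Rightarrow> real" where
  "smoothstep' t = 9 * max 0 (1 - max 0 t ^ 3) ^ 2 * max 0 t ^ 2"
definition smoothstep'' :: "real \<Rightarrow> real" where
  "smoothstep'' t = - 54 * max 0 (1 - max 0 t ^ 3) * max 0 t ^ 4 + 18 * max 0 (1 - max 0 t ^ 3) ^ 2 * max 0 t"

lemma max_derivs:
  "((\<lambda>t::real. max 0 t ^ 3) has_real_derivative 3 * max 0 t ^ 2) (at t)"
  "((\<lambda>t::real. max 0 t ^ 2) has_real_derivative 2 * max 0 t) (at t)"
  using max_power_deriv[of 2 t] max_power_deriv[of 1 t] by (simp_all add: eval_nat_numeral)

lemma smoothstep_deriv: "(smoothstep has_real_derivative smoothstep' t) (at t)"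
proof -
  have "((\<lambda>t. 1 - max 0 (1 - max 0 t ^ 3) ^ 3) has_real_derivative (0 - 3 * max 0 (1 - max 0 t ^ 3) ^ 2 * (0 - 3 * max 0 t ^ 2))) (at t)"
    by (intro DERIV_diff DERIV_const DERIV_chain2[where f="\<lambda>t. max 0 t ^ 3"] max_derivs)
  then show ?thesis unfolding smoothstep_def[abs_def] smoothstep'_def by (simp add: mult.assoc)
qed

lemma smoothstep'_deriv: "(smoothstep' has_real_derivative smoothstep'' t) (at t)"
proof -
  let ?s = "max 0 (1 - max 0 t ^ 3)"
  have 1: "((\<lambda>t. max 0 (1 - max 0 t ^ 3) ^ 2) has_real_derivative (2 * ?s * (0 - 3 * max 0 t ^ 2))) (at t)"
    by (intro DERIV_diff DERIV_const DERIV_chain2[where f="\<lambda>t. max 0 t ^ 2"] max_derivs)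
  have "((\<lambda>t. 9 * max 0 (1 - max 0 t ^ 3) ^ 2 * max 0 t ^ 2) has_real_derivative
     (9 * (2 * ?s * (0 - 3 * max 0 t ^ 2))) * max 0 t ^ 2 + (2 * max 0 t) * (9 * ?s ^ 2)) (at t)"
    by (intro DERIV_mult DERIV_cmult 1 max_derivs)
  moreover have "(9 * (2 * ?s * (0 - 3 * max 0 t ^ 2))) * max 0 t ^ 2 + (2 * max 0 t) * (9 * ?s ^ 2) = smoothstep'' t"
    unfolding smoothstep''_def by (simp add: algebra_simps eval_nat_numeral)
  ultimately show ?thesis unfolding smoothstep'_def[abs_def] by simp
qed

lemma smoothstep''_continuous: "continuous_on UNIV smoothstep''"
  unfolding smoothstep''_def[abs_def] by (intro continuous_intros)

lemma smoothstep_bounds: "0 \<le> smoothstep t" "smoothstep t \<le> 1" "0 \<le> smoothstep' t" "smoothstep' t \<le> 9"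
proof -
  have s: "0 \<le> max 0 (1 - max 0 t ^ 3)" "max 0 (1 - max 0 t ^ 3) \<le> 1" by auto
  show "0 \<le> smoothstep t" "smoothstep t \<le> 1" unfolding smoothstep_def using power_le_one[OF s, of 3] s by auto
  show "0 \<le> smoothstep' t" by (simp add: smoothstep'_def)
  show "smoothstep' t \<le> 9"
  proof (cases "t \<le> 1")
    case True
    then have "max 0 t ^ 2 \<le> 1" by (intro power_le_one) auto
    with power_le_one[OF s, of 2] have "max 0 (1 - max 0 t ^ 3) ^ 2 * max 0 t ^ 2 \<le> 1 * 1"
      by (intro mult_mono) auto
    then show ?thesis by (simp add: smoothstep'_def)
  next
    case False
    then have "1 \<le> max 0 t ^ 3" by (intro one_le_power) auto
    then show ?thesis by (simp add: smoothstep'_def)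
  qed
qed

lemma smoothstep_values:
  "t \<le> 0 \<Longrightarrow> smoothstep t = 0" "t \<ge> 1 \<Longrightarrow> smoothstep t = 1" "t \<le> 0 \<Longrightarrow> smoothstep' t = 0" "t \<ge> 1 \<Longrightarrow> smoothstep' t = 0"
proof -
  have 1: "1 \<le> max 0 t ^ 3" if "t \<ge> 1" using that by (intro one_le_power) auto
  show "t \<le> 0 \<Longrightarrow> smoothstep t = 0" "t \<le> 0 \<Longrightarrow> smoothstep' t = 0" by (simp_all add: smoothstep_def smoothstep'_def max_def)
  show "t \<ge> 1 \<Longrightarrow> smoothstep t = 1" "t \<ge> 1 \<Longrightarrow> smoothstep' t = 0" using 1 by (simp_all add: smoothstep_def smoothstep'_def)
qed

lemma wirtinger_real_comp:
  fixes v \<theta> :: "_ \<Rightarrow> real"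
  assumes w: "wirtinger (\<lambda>z. of_real (v z)) p q" and t: "\<And>t. (\<theta> has_real_derivative \<theta>' t) (at t)"
  shows "wirtinger (\<lambda>z. of_real (\<theta> (v z))) (\<lambda>z. of_real (\<theta>' (v z)) * p z) (\<lambda>z. of_real (\<theta>' (v z)) * q z)"
  unfolding wirtinger_def
proof
  fix z
  let ?D = "\<lambda>h. p z * h + q z * cnj h"
  have D: "((\<lambda>z. complex_of_real (v z)) has_derivative ?D) (at z)" using w by (simp add: wirtinger_def)
  have R: "(v has_derivative (\<lambda>h. Re (?D h))) (at z)"
    using has_derivative_Re[OF D] by simp
  have "((\<lambda>z. Im (complex_of_real (v z))) has_derivative (\<lambda>h. Im (?D h))) (at z)"
    by (rule has_derivative_Im[OF D])
  then have "((\<lambda>z. 0::real) has_derivative (\<lambda>h. Im (?D h))) (at z)" by simp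
  then have "(\<lambda>h. Im (?D h)) = (\<lambda>h. 0)" by (rule has_derivative_unique) simp
  then have I: "Im (?D h) = 0" for h by (rule fun_cong)
  have T: "(\<theta> has_derivative (*) (\<theta>' (v z))) (at (v z))" using t by (simp add: has_field_derivative_def)
  have "((\<lambda>z. complex_of_real (\<theta> (v z))) has_derivative (\<lambda>h. complex_of_real (\<theta>' (v z) * Re (?D h)))) (at z)"
    by (rule has_derivative_of_real[OF has_derivative_compose[OF R T]])
  moreover have "complex_of_real (\<theta>' (v z) * Re (?D h)) = of_real (\<theta>' (v z)) * p z * h + of_real (\<theta>' (v z)) * q z * cnj h" for h
  proof -
    have "?D h = of_real (Re (?D h))" using I[of h] by (simp add: complex_eq_iff)
    then have "complex_of_real (\<theta>' (v z) * Re (?D h)) = of_real (\<theta>' (v z)) * ?D h" by (metis of_real_mult)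
    then show ?thesis by (simp add: algebra_simps)
  qed
  ultimately show "((\<lambda>z. complex_of_real (\<theta> (v z))) has_derivative (\<lambda>h. of_real (\<theta>' (v z)) * p z * h + of_real (\<theta>' (v z)) * q z * cnj h)) (at z)"
    by simp
qed

lemma wirtinger2_radial_smoothstep:
  fixes z0 :: complex and \<alpha> \<beta> :: real
  defines "v z \<equiv> \<alpha> * (norm (z - z0))^2 + \<beta>"
  shows "wirtinger2 (\<lambda>z. of_real (smoothstep (v z))) (\<lambda>z. of_real (smoothstep' (v z)) * (of_real \<alpha> * cnj (z - z0))) (\<lambda>z. of_real (smoothstep' (v z)) * (of_real \<alpha> * (z - z0)))"
proof -
  have za: "wirtinger (\<lambda>z. z - z0) (\<lambda>z. 1) (\<lambda>z. 0)"
    by (rule wirtinger_cong[OF wirtinger_add[OF wirtinger_ident wirtinger_const[of "- z0"]]]) auto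
  have cza: "wirtinger (\<lambda>z. cnj (z - z0)) (\<lambda>z. 0) (\<lambda>z. 1)"
    by (rule wirtinger_cong[OF wirtinger_cnj[OF za]]) auto
  have v: "wirtinger (\<lambda>z. of_real (v z)) (\<lambda>z. of_real \<alpha> * cnj (z - z0)) (\<lambda>z. of_real \<alpha> * (z - z0))"
  proof (rule wirtinger_cong[OF wirtinger_add[OF wirtinger_cmult[OF wirtinger_mult[OF za cza], of "of_real \<alpha>"] wirtinger_const[of "of_real \<beta>"]]])
    fix z
    show "of_real \<alpha> * ((z - z0) * cnj (z - z0)) + of_real \<beta> = complex_of_real (v z)"
      unfolding v_def of_real_add of_real_mult complex_norm_square by (rule refl)
  qed (simp_all)
  have 1: "wirtinger (\<lambda>z. of_real (smoothstep (v z))) (\<lambda>z. of_real (smoothstep' (v z)) * (of_real \<alpha> * cnj (z - z0))) (\<lambda>z. of_real (smoothstep' (v z)) * (of_real \<alpha> * (z - z0)))"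
    by (rule wirtinger_real_comp[OF v smoothstep_deriv])
  have 2: "wirtinger (\<lambda>z. of_real (smoothstep' (v z))) (\<lambda>z. of_real (smoothstep'' (v z)) * (of_real \<alpha> * cnj (z - z0))) (\<lambda>z. of_real (smoothstep'' (v z)) * (of_real \<alpha> * (z - z0)))"
    by (rule wirtinger_real_comp[OF v smoothstep'_deriv])
  note n3 = wirtinger_mult[OF 2 wirtinger_cmult[OF cza, of "of_real \<alpha>"]]
  note n4 = wirtinger_mult[OF 2 wirtinger_cmult[OF za, of "of_real \<alpha>"]]
  let ?a = "\<lambda>z. of_real (smoothstep'' (v z)) * (of_real \<alpha> * cnj (z - z0)) * (of_real \<alpha> * cnj (z - z0))"
  let ?r = "\<lambda>z. of_real (smoothstep'' (v z)) * (of_real \<alpha> * (z - z0)) * (of_real \<alpha> * cnj (z - z0)) + of_real (smoothstep' (v z)) * of_real \<alpha>"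
  let ?c = "\<lambda>z. of_real (smoothstep'' (v z)) * (of_real \<alpha> * (z - z0)) * (of_real \<alpha> * (z - z0))"
  have w3: "wirtinger (\<lambda>z. of_real (smoothstep' (v z)) * (of_real \<alpha> * cnj (z - z0))) ?a ?r"
    by (rule wirtinger_cong[OF n3]) simp_all
  have w4: "wirtinger (\<lambda>z. of_real (smoothstep' (v z)) * (of_real \<alpha> * (z - z0))) ?r ?c"
    by (rule wirtinger_cong[OF n4]) simp_all
  have vc: "continuous_on UNIV v" unfolding v_def by (intro continuous_intros)
  have c1: "continuous_on UNIV (\<lambda>z. smoothstep' (v z))"
    using continuous_on_Re[OF wirtinger_continuous[OF 2]] by simp
  have c2: "continuous_on UNIV (\<lambda>z. smoothstep'' (v z))"
    by (rule continuous_on_compose2[OF smoothstep''_continuous vc]) simp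
  have "continuous_on UNIV ?a" "continuous_on UNIV ?r" "continuous_on UNIV ?c"
    by (intro continuous_intros c1 c2)+
  with 1 w3 w4 show ?thesis unfolding wirtinger2_def by blast
qed

lemma wirtinger_div_power:
  assumes w: "wirtinger f p q" and e: "\<epsilon> > 0" and z: "\<And>z. norm (z - z0) < \<epsilon> \<Longrightarrow> f z = 0"
  shows "wirtinger (\<lambda>z. f z * inverse (z - z0) ^ m)
     (\<lambda>z. p z * inverse (z - z0) ^ m + (- of_nat m) * (f z * inverse (z - z0) ^ Suc m)) (\<lambda>z. q z * inverse (z - z0) ^ m)"
  unfolding wirtinger_def
proof
  fix y
  let ?Z = "\<lambda>z. inverse (z - z0)"
  let ?D = "\<lambda>h. (p y * ?Z y ^ m + (- of_nat m) * (f y * ?Z y ^ Suc m)) * h + q y * ?Z y ^ m * cnj h"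
  show "((\<lambda>z. f z * ?Z z ^ m) has_derivative ?D) (at y)"
  proof (cases "y = z0")
    case True
    have y: "y \<in> ball z0 \<epsilon>" using True e by simp
    have 0: "f x = 0" if "x \<in> ball z0 \<epsilon>" for x using z[of x] that by (simp add: dist_norm norm_minus_commute)
    have "p y = 0" "q y = 0" "f y = 0" using wirtinger_zero_outside[OF w open_ball 0 y] 0[OF y] by auto
    then have D: "?D = (\<lambda>h. 0)" by simp
    show ?thesis unfolding D
      by (rule has_derivative_transform_within_open[OF has_derivative_const open_ball y]) (use 0 in simp)
  next
    case False
    have f: "(f has_derivative (\<lambda>h. p y * h + q y * cnj h)) (at y)" using w by (simp add: wirtinger_def)
    have "((\<lambda>z. ?Z z ^ m) has_field_derivative (- of_nat m * ?Z y ^ Suc m)) (at y)"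
    proof -
      have "(?Z has_field_derivative - (?Z y * 1 * ?Z y)) (at y)"
        by (rule DERIV_inverse') (use False in \<open>auto intro!: derivative_eq_intros\<close>)
      note D = DERIV_power[OF this, of m]
      have eq: "of_nat m * (- (?Z y * 1 * ?Z y) * ?Z y ^ (m - Suc 0)) = - of_nat m * ?Z y ^ Suc m"
        by (cases m) (simp_all add: algebra_simps)
      show ?thesis using D unfolding eq .
    qed
    then have g: "((\<lambda>z. ?Z z ^ m) has_derivative (\<lambda>h. (- of_nat m * ?Z y ^ Suc m) * h)) (at y)"
      by (simp only: has_field_derivative_def)
    show ?thesis
      by (rule has_derivative_eq_rhs[OF has_derivative_mult[OF f g]]) (auto simp: algebra_simps)
  qed
qed

lemma continuous_div_power:
  fixes f :: "complex \<Rightarrow> complex"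
  assumes c: "continuous_on UNIV f" and e: "\<epsilon> > 0" and z: "\<And>z. norm (z - z0) < \<epsilon> \<Longrightarrow> f z = 0"
  shows "continuous_on UNIV (\<lambda>z. f z * inverse (z - z0) ^ m)"
proof -
  have "continuous_on (ball z0 \<epsilon> \<union> (- {z0})) (\<lambda>z. f z * inverse (z - z0) ^ m)"
  proof (rule continuous_on_open_Un)
    have "continuous_on (ball z0 \<epsilon>) (\<lambda>z. 0::complex)" by simp
    then show "continuous_on (ball z0 \<epsilon>) (\<lambda>z. f z * inverse (z - z0) ^ m)"
      by (rule continuous_on_eq) (use z in \<open>simp add: dist_norm norm_minus_commute\<close>)
    show "continuous_on (- {z0}) (\<lambda>z. f z * inverse (z - z0) ^ m)"
      by (intro continuous_intros continuous_on_subset[OF c]) auto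
  qed auto
  moreover have "ball z0 \<epsilon> \<union> (- {z0}) = UNIV" using e by auto
  ultimately show ?thesis by simp
qed

text \<open>The factor \<open>(z - z0)\<^bsup>-m\<^esup>\<close> is holomorphic away from \<open>z0\<close>, so it passes through \<open>\<partial>/\<partial>\<bar>z\<close>; near \<open>z0\<close>
  everything vanishes because \<open>f\<close> does.\<close>

lemma wirtinger2_div_power:
  assumes w: "wirtinger2 f p q" and e: "\<epsilon> > 0" and z: "\<And>z. norm (z - z0) < \<epsilon> \<Longrightarrow> f z = 0"
  shows "wirtinger2 (\<lambda>z. f z * inverse (z - z0) ^ m)
     (\<lambda>z. p z * inverse (z - z0) ^ m + (- of_nat m) * (f z * inverse (z - z0) ^ Suc m)) (\<lambda>z. q z * inverse (z - z0) ^ m)"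
proof -
  obtain a r c where 1: "wirtinger f p q" "wirtinger p a r" "wirtinger q r c" "continuous_on UNIV a" "continuous_on UNIV r" "continuous_on UNIV c"
    using w unfolding wirtinger2_def by blast
  have 0: "f x = 0" if "x \<in> ball z0 \<epsilon>" for x using z[of x] that by (simp add: dist_norm norm_minus_commute)
  have pq: "p x = 0" "q x = 0" if "x \<in> ball z0 \<epsilon>" for x
    using wirtinger_zero_outside[OF 1(1) open_ball 0 that] by auto
  have arc: "a x = 0" "r x = 0" "c x = 0" if "x \<in> ball z0 \<epsilon>" for x
    using wirtinger_zero_outside[OF 1(2) open_ball pq(1) that] wirtinger_zero_outside[OF 1(3) open_ball pq(2) that] by auto
  have b: "norm (x - z0) < \<epsilon> \<Longrightarrow> x \<in> ball z0 \<epsilon>" for x by (simp add: dist_norm norm_minus_commute)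
  note pq' = pq[OF b] and arc' = arc[OF b]
  have W: "wirtinger (\<lambda>z. k z * inverse (z - z0) ^ j)
     (\<lambda>z. kp z * inverse (z - z0) ^ j + (- of_nat j) * (k z * inverse (z - z0) ^ Suc j)) (\<lambda>z. kq z * inverse (z - z0) ^ j)"
    if "wirtinger k kp kq" "\<And>x. x \<in> ball z0 \<epsilon> \<Longrightarrow> k x = 0" for k kp kq j
    by (rule wirtinger_div_power[OF that(1) e]) (rule that(2)[OF b])
  have C: "continuous_on UNIV (\<lambda>z. k z * inverse (z - z0) ^ j)" if "continuous_on UNIV k" "\<And>x. x \<in> ball z0 \<epsilon> \<Longrightarrow> k x = 0" for k j
    by (rule continuous_div_power[OF that(1) e]) (rule that(2)[OF b])
  let ?k = "- of_nat m :: complex"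
  let ?r = "\<lambda>z. r z * inverse (z - z0) ^ m + ?k * (q z * inverse (z - z0) ^ Suc m)"
  have Wf: "wirtinger (\<lambda>z. f z * inverse (z - z0) ^ m)
     (\<lambda>z. p z * inverse (z - z0) ^ m + ?k * (f z * inverse (z - z0) ^ Suc m)) (\<lambda>z. q z * inverse (z - z0) ^ m)"
    by (rule W[OF 1(1)]) (rule 0)
  have Wf': "wirtinger (\<lambda>z. f z * inverse (z - z0) ^ Suc m)
     (\<lambda>z. p z * inverse (z - z0) ^ Suc m + (- of_nat (Suc m)) * (f z * inverse (z - z0) ^ Suc (Suc m))) (\<lambda>z. q z * inverse (z - z0) ^ Suc m)"
    by (rule W[OF 1(1)]) (rule 0)
  have Wp: "wirtinger (\<lambda>z. p z * inverse (z - z0) ^ m)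
     (\<lambda>z. a z * inverse (z - z0) ^ m + ?k * (p z * inverse (z - z0) ^ Suc m)) (\<lambda>z. r z * inverse (z - z0) ^ m)"
    by (rule W[OF 1(2)]) (rule pq(1))
  have Wq: "wirtinger (\<lambda>z. q z * inverse (z - z0) ^ m) ?r (\<lambda>z. c z * inverse (z - z0) ^ m)"
    by (rule W[OF 1(3)]) (rule pq(2))
  note A = wirtinger_add[OF Wp wirtinger_cmult[OF Wf', of ?k]]
  note cc = 1(1,2,3)[THEN wirtinger_continuous]
  have c1: "continuous_on UNIV (\<lambda>z. f z * inverse (z - z0) ^ j)" for j by (rule C[OF cc(1)]) (rule 0)
  have c2: "continuous_on UNIV (\<lambda>z. p z * inverse (z - z0) ^ j)" for j by (rule C[OF cc(2)]) (rule pq(1))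
  have c3: "continuous_on UNIV (\<lambda>z. q z * inverse (z - z0) ^ j)" for j by (rule C[OF cc(3)]) (rule pq(2))
  have c4: "continuous_on UNIV (\<lambda>z. a z * inverse (z - z0) ^ j)" for j by (rule C[OF 1(4)]) (rule arc(1))
  have c5: "continuous_on UNIV (\<lambda>z. r z * inverse (z - z0) ^ j)" for j by (rule C[OF 1(5)]) (rule arc(2))
  have c6: "continuous_on UNIV (\<lambda>z. c z * inverse (z - z0) ^ j)" for j by (rule C[OF 1(6)]) (rule arc(3))
  show ?thesis unfolding wirtinger2_def
    apply (rule conjI[OF Wf])
    apply (rule exI)+
    apply (rule conjI[OF A], rule conjI[OF Wq])
    by (intro conjI continuous_on_add continuous_on_mult_left c1 c2 c3 c4 c5 c6)
qed

section \<open>Absorbing the potential\<close>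

abbreviation sqnorm :: "('n::finite \<Rightarrow> complex \<Rightarrow> complex) \<Rightarrow> complex \<Rightarrow> real" where
  "sqnorm f z \<equiv> \<Sum>k\<in>UNIV. (norm (f k z))^2"

text \<open>Put \<open>A = \<integral> V\<^sup>2 |\<eta>|\<^sup>2 |f|\<^sup>2 P\<close>, and write \<open>B\<close> and \<open>D\<close> for the two integrals in the conclusion and \<open>E\<close> for the integral
  of \<open>|\<eta>|\<^sup>2 |F|\<^sup>2 P\<close>. The weighted inequality for \<open>G = V\<^sup>2 + 1\<close>, summed over the components, says
  \<open>4 A + 4 B \<le> 2 E + 2 D\<close>, and \<open>E \<le> A\<close> by the differential inequality. Subtracting \<open>2 A\<close> is legitimate since \<open>E\<close> and \<open>D\<close>,
  and hence \<open>A\<close>, are finite: here it is essential that \<open>F\<close> is square-integrable.\<close>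

lemma vector_carleman:
  fixes f F :: "'n::finite \<Rightarrow> complex \<Rightarrow> complex" and V :: "complex \<Rightarrow> real"
  assumes pair: "\<And>k. dbar_pair z0 R' (f k) (F k)"
    and V: "V \<in> borel_measurable borel" "integrable lborel (\<lambda>z. indicator (ball z0 R') z * (V z)^2)"
    and ineq: "AE z in lborel. z \<in> ball z0 R' \<longrightarrow> sqnorm F z \<le> (V z)^2 * sqnorm f z"
  shows "\<exists>P :: complex \<Rightarrow> real. P \<in> borel_measurable borel \<and> (\<forall>z. 0 < P z \<and> P z \<le> 1) \<and>
    (\<forall>\<eta> \<eta>q. cutoff_in z0 R' \<eta> \<eta>q \<longrightarrow>
       (\<integral>\<^sup>+ z. ennreal ((norm (\<eta> z))^2 * sqnorm f z * P z) \<partial>lborel) \<le>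
       (\<integral>\<^sup>+ z. ennreal ((norm (\<eta>q z))^2 * sqnorm f z * P z) \<partial>lborel))"
proof -
  have f: "integrable lborel (f k)" "integrable lborel (\<lambda>z. (norm (f k z))^2)"
    and F: "integrable lborel (F k)" "integrable lborel (\<lambda>z. (norm (F k z))^2)" for k
    using pair[of k] by (simp_all add: dbar_pair_def)
  let ?I = "\<lambda>z. indicator (ball z0 R') z :: real"
  have Im [measurable]: "?I \<in> borel_measurable borel"
    by (intro borel_measurable_indicator borel_open open_ball)
  note [measurable] = V(1)
  define G where "G z = ?I z * (V z)^2 + ?I z" for z
  have Ii: "integrable lborel ?I"
    using emeasure_bounded_finite[OF bounded_ball, of z0 R'] by (intro integrable_real_indicator) auto
  have G: "integrable lborel G" unfolding G_def using V(2) Ii by (rule Bochner_Integration.integrable_add)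
  have G0: "G z \<ge> 0" for z by (simp add: G_def)
  have Go: "\<forall>z. z \<notin> ball z0 R' \<longrightarrow> G z = 0" by (simp add: G_def)
  have Gi: "G z = (V z)^2 + 1" if "z \<in> ball z0 R'" for z using that by (simp add: G_def)
  obtain P :: "complex \<Rightarrow> real" where Pm [measurable]: "P \<in> borel_measurable borel" and P: "\<forall>z. 0 < P z \<and> P z \<le> 1" and
    C: "\<forall>f F \<eta> \<eta>q. dbar_pair z0 R' f F \<longrightarrow> cutoff_in z0 R' \<eta> \<eta>q \<longrightarrow>
       (\<integral>\<^sup>+ z. ennreal (4 * G z * (norm (\<eta> z * f z))^2 * P z) \<partial>lborel) \<le>
         2 * (\<integral>\<^sup>+ z. ennreal ((norm (F z))^2 * ((norm (\<eta> z))^2 * P z)) \<partial>lborel)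
         + 2 * (\<integral>\<^sup>+ z. ennreal ((norm (f z))^2 * ((norm (\<eta>q z))^2 * P z)) \<partial>lborel)"
    using singular_weight_carleman[OF G G0 Go] by (elim exE conjE) (rule that)
  have P0: "0 < P z" "P z \<le> 1" for z using P by auto
  define N where "N z = sqnorm f z" for z
  define M where "M z = sqnorm F z" for z
  have [measurable]: "f k \<in> borel_measurable borel" "F k \<in> borel_measurable borel" for k using f(1)[of k] F(1)[of k] by auto
  have [measurable]: "N \<in> borel_measurable borel" "M \<in> borel_measurable borel" unfolding N_def M_def by measurable
  have NM: "N z \<ge> 0" "M z \<ge> 0" for z unfolding N_def M_def by (simp_all add: sum_nonneg)
  have Ni: "integrable lborel N" "integrable lborel M" unfolding N_def M_def using f(2) F(2) by simp_all
  show ?thesis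
  proof (rule exI[of _ P], intro conjI allI impI Pm P0)
    fix \<eta> \<eta>q :: "complex \<Rightarrow> complex"
    assume cutoff: "cutoff_in z0 R' \<eta> \<eta>q"
    then obtain \<eta>p R where \<eta>: "wirtinger2 \<eta> \<eta>p \<eta>q" "\<forall>z. R \<le> norm (z - z0) \<longrightarrow> \<eta> z = 0" and R: "R < R'"
      unfolding cutoff_in_def by blast
    have \<eta>c: "continuous_on UNIV \<eta>" "continuous_on UNIV \<eta>q"
      using \<eta>(1) wirtinger_continuous unfolding wirtinger2_def by blast+
    have [measurable]: "\<eta> \<in> borel_measurable borel" "\<eta>q \<in> borel_measurable borel"
      using \<eta>c by (auto intro: borel_measurable_continuous_onI)
    have w1: "wirtinger \<eta> \<eta>p \<eta>q" using \<eta> by (simp add: wirtinger2_def)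
    have o: "open {z::complex. norm z0 + R < norm z}" by (intro open_Collect_less continuous_intros)
    have big: "\<eta> z = 0" if "norm z0 + R < norm z" for z
      using that norm_triangle_ineq2[of z z0] \<eta>(2) by simp
    have bigq: "\<eta>q z = 0" if "norm z0 + R < norm z" for z
      using wirtinger_zero_outside(2)[OF w1 o, of z] big that by simp
    obtain C1 where C1: "\<And>z. norm (\<eta> z) \<le> C1"
      by (rule compact_support_bounded[OF \<eta>c(1), of "norm z0 + R"]) (use big in auto)
    obtain C2 where C2: "\<And>z. norm (\<eta>q z) \<le> C2"
      by (rule compact_support_bounded[OF \<eta>c(2), of "norm z0 + R"]) (use bigq in auto)
    have out: "\<eta> z = 0" if "z \<notin> ball z0 R'" for z
      using \<eta>(2) that R by (simp add: dist_norm norm_minus_commute)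
    define A where "A = (\<integral>\<^sup>+ z. ennreal (?I z * (V z)^2 * ((norm (\<eta> z))^2 * N z * P z)) \<partial>lborel)"
    define B where "B = (\<integral>\<^sup>+ z. ennreal ((norm (\<eta> z))^2 * N z * P z) \<partial>lborel)"
    define D where "D = (\<integral>\<^sup>+ z. ennreal ((norm (\<eta>q z))^2 * N z * P z) \<partial>lborel)"
    define E where "E = (\<integral>\<^sup>+ z. ennreal (M z * ((norm (\<eta> z))^2 * P z)) \<partial>lborel)"
    have fin: "(\<integral>\<^sup>+ z. ennreal (K z * ((norm (\<theta> z))^2 * P z)) \<partial>lborel) < \<infinity>"
      if K: "integrable lborel K" "\<And>z. K z \<ge> 0" and b: "\<And>z. norm (\<theta> z) \<le> c" for K :: "complex \<Rightarrow> real" and \<theta> :: "complex \<Rightarrow> complex" and c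
    proof -
      have "(\<integral>\<^sup>+ z. ennreal (K z * ((norm (\<theta> z))^2 * P z)) \<partial>lborel) \<le> (\<integral>\<^sup>+ z. ennreal (K z * (c^2 * 1)) \<partial>lborel)"
        using P0 K(2) b by (intro nn_integral_mono ennreal_leI mult_left_mono mult_mono power_mono) (auto intro: less_imp_le)
      also have "\<dots> < \<infinity>" using K by (subst nn_integral_eq_integral) auto
      finally show ?thesis .
    qed
    have Ef: "E < \<infinity>" unfolding E_def by (rule fin[OF Ni(2) NM(2) C1])
    have Df: "D < \<infinity>"
    proof -
      have "D = (\<integral>\<^sup>+ z. ennreal (N z * ((norm (\<eta>q z))^2 * P z)) \<partial>lborel)" unfolding D_def by (simp only: mult_ac)
      then show ?thesis using fin[OF Ni(1) NM(1) C2] by simp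
    qed
    have EA: "E \<le> A" unfolding E_def A_def
    proof (rule nn_integral_mono_AE)
      show "AE z in lborel. ennreal (M z * ((norm (\<eta> z))^2 * P z)) \<le> ennreal (?I z * (V z)^2 * ((norm (\<eta> z))^2 * N z * P z))"
        using ineq
      proof eventually_elim
        case (elim z)
        show ?case
        proof (cases "z \<in> ball z0 R'")
          case True
          then have "M z \<le> (V z)^2 * N z" using elim by (simp add: M_def N_def)
          then have "M z * ((norm (\<eta> z))^2 * P z) \<le> (V z)^2 * N z * ((norm (\<eta> z))^2 * P z)"
            using P0(1)[of z] by (intro mult_right_mono) auto
          then show ?thesis using True by (intro ennreal_leI) (simp add: mult_ac)
        qed (simp add: out)
      qed
    qed
    have "4 * A + 4 * B = (\<integral>\<^sup>+ z. 4 * ennreal (?I z * (V z)^2 * ((norm (\<eta> z))^2 * N z * P z)) + 4 * ennreal ((norm (\<eta> z))^2 * N z * P z) \<partial>lborel)"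
      unfolding A_def B_def by (subst nn_integral_add) (simp_all add: nn_integral_cmult)
    also have "\<dots> = (\<integral>\<^sup>+ z. (\<Sum>k\<in>UNIV. ennreal (4 * G z * (norm (\<eta> z * f k z))^2 * P z)) \<partial>lborel)"
    proof (rule nn_integral_cong)
      fix z
      have "(\<Sum>k\<in>UNIV. ennreal (4 * G z * (norm (\<eta> z * f k z))^2 * P z)) = ennreal (\<Sum>k\<in>UNIV. 4 * G z * (norm (\<eta> z * f k z))^2 * P z)"
        using G0[of z] P0(1)[of z] by (intro sum_ennreal) auto
      also have "(\<Sum>k\<in>UNIV. 4 * G z * (norm (\<eta> z * f k z))^2 * P z) = 4 * G z * (norm (\<eta> z))^2 * N z * P z"
        unfolding N_def by (simp add: norm_mult power_mult_distrib sum_distrib_left sum_distrib_right mult_ac)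
      also have "\<dots> = 4 * (?I z * (V z)^2 * ((norm (\<eta> z))^2 * N z * P z)) + 4 * ((norm (\<eta> z))^2 * N z * P z)"
        by (cases "z \<in> ball z0 R'") (simp_all add: Gi out algebra_simps)
      also have "ennreal \<dots> = 4 * ennreal (?I z * (V z)^2 * ((norm (\<eta> z))^2 * N z * P z)) + 4 * ennreal ((norm (\<eta> z))^2 * N z * P z)"
        using NM(1)[of z] P0(1)[of z] by (subst ennreal_plus) (simp_all add: ennreal_mult')
      finally show "4 * ennreal (?I z * (V z)^2 * ((norm (\<eta> z))^2 * N z * P z)) + 4 * ennreal ((norm (\<eta> z))^2 * N z * P z) = (\<Sum>k\<in>UNIV. ennreal (4 * G z * (norm (\<eta> z * f k z))^2 * P z))"
        by (rule sym)
    qed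
    also have "\<dots> = (\<Sum>k\<in>UNIV. \<integral>\<^sup>+ z. ennreal (4 * G z * (norm (\<eta> z * f k z))^2 * P z) \<partial>lborel)"
      using G by (intro nn_integral_sum) simp
    also have "\<dots> \<le> (\<Sum>k\<in>UNIV. 2 * (\<integral>\<^sup>+ z. ennreal ((norm (F k z))^2 * ((norm (\<eta> z))^2 * P z)) \<partial>lborel)
         + 2 * (\<integral>\<^sup>+ z. ennreal ((norm (f k z))^2 * ((norm (\<eta>q z))^2 * P z)) \<partial>lborel))"
    proof (rule sum_mono)
      fix k
      show "(\<integral>\<^sup>+ z. ennreal (4 * G z * (norm (\<eta> z * f k z))^2 * P z) \<partial>lborel) \<le>
         2 * (\<integral>\<^sup>+ z. ennreal ((norm (F k z))^2 * ((norm (\<eta> z))^2 * P z)) \<partial>lborel)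
         + 2 * (\<integral>\<^sup>+ z. ennreal ((norm (f k z))^2 * ((norm (\<eta>q z))^2 * P z)) \<partial>lborel)"
        by (rule C[rule_format, OF pair cutoff])
    qed
    also have "\<dots> = 2 * (\<integral>\<^sup>+ z. (\<Sum>k\<in>UNIV. ennreal ((norm (F k z))^2 * ((norm (\<eta> z))^2 * P z))) \<partial>lborel)
         + 2 * (\<integral>\<^sup>+ z. (\<Sum>k\<in>UNIV. ennreal ((norm (f k z))^2 * ((norm (\<eta>q z))^2 * P z))) \<partial>lborel)"
      by (subst (1 2) nn_integral_sum) (simp_all add: sum.distrib sum_distrib_left)
    also have "(\<integral>\<^sup>+ z. (\<Sum>k\<in>UNIV. ennreal ((norm (F k z))^2 * ((norm (\<eta> z))^2 * P z))) \<partial>lborel) = E"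
      unfolding E_def M_def
    proof (rule nn_integral_cong)
      fix z
      have "(\<Sum>k\<in>UNIV. ennreal ((norm (F k z))^2 * ((norm (\<eta> z))^2 * P z))) = ennreal (\<Sum>k\<in>UNIV. (norm (F k z))^2 * ((norm (\<eta> z))^2 * P z))"
        using P0(1)[of z] by (intro sum_ennreal) auto
      then show "(\<Sum>k\<in>UNIV. ennreal ((norm (F k z))^2 * ((norm (\<eta> z))^2 * P z))) = ennreal (sqnorm F z * ((norm (\<eta> z))^2 * P z))"
        by (simp only: sum_distrib_right)
    qed
    also have "(\<integral>\<^sup>+ z. (\<Sum>k\<in>UNIV. ennreal ((norm (f k z))^2 * ((norm (\<eta>q z))^2 * P z))) \<partial>lborel) = D"
      unfolding D_def N_def
    proof (rule nn_integral_cong)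
      fix z
      have "(\<Sum>k\<in>UNIV. ennreal ((norm (f k z))^2 * ((norm (\<eta>q z))^2 * P z))) = ennreal (\<Sum>k\<in>UNIV. (norm (f k z))^2 * ((norm (\<eta>q z))^2 * P z))"
        using P0(1)[of z] by (intro sum_ennreal) auto
      then show "(\<Sum>k\<in>UNIV. ennreal ((norm (f k z))^2 * ((norm (\<eta>q z))^2 * P z))) = ennreal ((norm (\<eta>q z))^2 * sqnorm f z * P z)"
        by (simp only: sum_distrib_left mult_ac)
    qed
    finally have main: "4 * A + 4 * B \<le> 2 * E + 2 * D" .
    obtain d e where de: "D = ennreal d" "d \<ge> 0" "E = ennreal e" "e \<ge> 0"
      using Ef Df by (metis ennreal_cases infinity_ennreal_def less_irrefl)
    have "2 * E + 2 * D = ennreal (2 * e + 2 * d)" using de by (simp add: ennreal_mult')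
    then have "4 * A + 4 * B < \<infinity>" using main by (metis ennreal_less_top infinity_ennreal_def le_less_trans)
    then have "A < \<infinity>" "B < \<infinity>" by (auto simp: ennreal_add_less_top ennreal_mult_less_top)
    then obtain a b where ab: "A = ennreal a" "a \<ge> 0" "B = ennreal b" "b \<ge> 0"
      by (metis ennreal_cases infinity_ennreal_def less_irrefl)
    have "ennreal (4 * a + 4 * b) \<le> ennreal (2 * e + 2 * d)"
      using main de ab by (simp add: ennreal_mult')
    then have 1: "4 * a + 4 * b \<le> 2 * e + 2 * d" using de by (subst (asm) ennreal_le_iff) auto
    have "e \<le> a" using EA ab(2) unfolding de(3) ab(1) by (subst (asm) ennreal_le_iff) auto
    with 1 ab de have "b \<le> d" by linarith
    then have "B \<le> D" using ab de by (simp add: ennreal_leI)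
    then show "(\<integral>\<^sup>+ z. ennreal ((norm (\<eta> z))^2 * sqnorm f z * P z) \<partial>lborel) \<le>
       (\<integral>\<^sup>+ z. ennreal ((norm (\<eta>q z))^2 * sqnorm f z * P z) \<partial>lborel)"
      unfolding B_def D_def N_def .
  qed
qed

section \<open>Flatness forces vanishing on discs\<close>

lemma square_add_le: "(x + y)^2 \<le> 2 * x^2 + 2 * (y::real)^2"
  using zero_le_power2[of "x - y"] by (simp add: power2_eq_square algebra_simps)

text \<open>The cutoff is \<open>\<chi> (z - z0)\<^bsup>-m\<^esup>\<close>, where \<open>\<chi>\<close> rises between the radii \<open>\<epsilon>\<close> and \<open>2\<epsilon>\<close> and falls between \<open>r\<close> and \<open>R\<close>. Since the power
  is holomorphic, the \<open>\<partial>/\<partial>\<bar>z\<close> derivative lives on the two transition regions, where \<open>|z - z0|\<close> is at least \<open>\<epsilon>\<close> and \<open>r\<close>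
  respectively. The numbers \<open>9\<close> and \<open>18\<close> come from the bound \<open>9\<close> for the derivative of \<open>smoothstep\<close>.\<close>

lemma annulus_cutoff:
  fixes z0 :: complex
  assumes e: "0 < \<epsilon>" "2 * \<epsilon> < r" and r: "r < R" "R < R'"
  shows "\<exists>\<eta> \<eta>q. cutoff_in z0 R' \<eta> \<eta>q \<and>
    (\<forall>z. 2 * \<epsilon> \<le> norm (z - z0) \<longrightarrow> norm (z - z0) \<le> r \<longrightarrow> norm (\<eta> z) = inverse (norm (z - z0)) ^ m) \<and>
    (\<forall>z. (norm (\<eta>q z))^2 \<le> 2 * (18 / \<epsilon> * inverse \<epsilon> ^ m)^2 * indicator (ball z0 (2 * \<epsilon>)) z + 2 * (9 * R / (R^2 - r^2) * inverse r ^ m)^2 * indicator (ball z0 R) z)"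
proof -
  define d where "d = R^2 - r^2"
  have r0: "r > 0" using e by simp
  have d: "d > 0" using r0 r by (simp add: d_def power_strict_mono)
  define v where "v z = 1 / \<epsilon>^2 * (norm (z - z0))^2 + (- 1)" for z
  define w where "w z = - 1 / d * (norm (z - z0))^2 + R^2 / d" for z
  define vq where "vq z = of_real (smoothstep' (v z)) * (of_real (1 / \<epsilon>^2) * (z - z0))" for z
  define wq where "wq z = of_real (smoothstep' (w z)) * (of_real (- 1 / d) * (z - z0))" for z
  note V = wirtinger2_radial_smoothstep[of "1 / \<epsilon>^2" z0 "- 1", folded v_def, folded vq_def]
  note W = wirtinger2_radial_smoothstep[of "- 1 / d" z0 "R^2 / d", folded w_def, folded wq_def]
  define c where "c z = complex_of_real (smoothstep (v z)) * complex_of_real (smoothstep (w z))" for z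
  define cq where "cq z = vq z * of_real (smoothstep (w z)) + of_real (smoothstep (v z)) * wq z" for z
  note VW = wirtinger2_mult[OF V W, folded c_def, folded cq_def]
  have vle: "v z \<le> 0 \<longleftrightarrow> norm (z - z0) \<le> \<epsilon>" for z
    using e by (simp add: v_def field_simps power2_le_iff_abs_le abs_le_square_iff[symmetric])
  have vge: "v z \<ge> 1" if "2 * \<epsilon> \<le> norm (z - z0)" for z
  proof -
    have "(2 * \<epsilon>)^2 \<le> (norm (z - z0))^2" using that e by (intro power_mono) auto
    then have "2 * \<epsilon>^2 \<le> (norm (z - z0))^2" 
    proof -
      have "(2 * \<epsilon>)^2 = 4 * \<epsilon>^2" by (simp add: power_mult_distrib)
      then show ?thesis using \<open>(2 * \<epsilon>)^2 \<le> (norm (z - z0))^2\<close> zero_le_power2[of \<epsilon>] by linarith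
    qed
    then have "2 \<le> (norm (z - z0))^2 / \<epsilon>^2" using e by (simp add: pos_le_divide_eq)
    then show ?thesis by (simp add: v_def)
  qed
  have wle: "w z \<le> 0" if "R \<le> norm (z - z0)" for z
  proof -
    have "R^2 \<le> (norm (z - z0))^2" using that r0 r by (intro power_mono) auto
    then have "(R^2 - (norm (z - z0))^2) / d \<le> 0" using d by (simp add: divide_nonpos_pos)
    then show ?thesis by (simp add: w_def diff_divide_distrib)
  qed
  have wge: "w z \<ge> 1" if "norm (z - z0) \<le> r" for z
  proof -
    have "(norm (z - z0))^2 \<le> r^2" using that by (intro power_mono) auto
    then have "d \<le> R^2 - (norm (z - z0))^2" by (simp add: d_def)
    then have "1 \<le> (R^2 - (norm (z - z0))^2) / d" using d by (simp add: pos_le_divide_eq)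
    then show ?thesis by (simp add: w_def diff_divide_distrib)
  qed
  have c0: "c z = 0" if "norm (z - z0) < \<epsilon>" for z
    using vle[of z] that by (simp add: c_def smoothstep_values(1))
  define Z where "Z z = inverse (z - z0) ^ m" for z
  have nZ: "norm (Z z) = inverse (norm (z - z0)) ^ m" for z by (simp add: Z_def norm_power norm_inverse)
  have Zb: "norm (Z z) \<le> inverse t ^ m" if "t > 0" "t \<le> norm (z - z0)" for z t
    unfolding nZ using that by (intro power_mono le_imp_inverse_le) auto
  show ?thesis
  proof (intro exI conjI allI impI)
    have "wirtinger2 (\<lambda>z. c z * inverse (z - z0) ^ m)
     (\<lambda>z. (of_real (smoothstep' (v z)) * (of_real (1 / \<epsilon>^2) * cnj (z - z0)) * of_real (smoothstep (w z)) +
         of_real (smoothstep (v z)) * (of_real (smoothstep' (w z)) * (of_real (- 1 / d) * cnj (z - z0)))) * inverse (z - z0) ^ m + (- of_nat m) * (c z * inverse (z - z0) ^ Suc m)) (\<lambda>z. cq z * inverse (z - z0) ^ m)"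
      by (rule wirtinger2_div_power[OF VW e(1)]) (rule c0)
    moreover have "\<forall>z. R \<le> norm (z - z0) \<longrightarrow> c z * inverse (z - z0) ^ m = 0"
      using wle by (simp add: c_def smoothstep_values(1))
    ultimately show "cutoff_in z0 R' (\<lambda>z. c z * inverse (z - z0) ^ m) (\<lambda>z. cq z * inverse (z - z0) ^ m)"
      unfolding cutoff_in_def using r(2) by blast
    show "norm (c z * inverse (z - z0) ^ m) = inverse (norm (z - z0)) ^ m" if "2 * \<epsilon> \<le> norm (z - z0)" "norm (z - z0) \<le> r" for z
      using vge[OF that(1)] wge[OF that(2)] nZ[of z] by (simp add: c_def smoothstep_values(2) Z_def)
    fix z
    have v1: "norm (vq z * of_real (smoothstep (w z)) * Z z) \<le> (18 / \<epsilon> * inverse \<epsilon> ^ m) * indicator (ball z0 (2 * \<epsilon>)) z"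
    proof (cases "\<epsilon> < norm (z - z0) \<and> norm (z - z0) < 2 * \<epsilon>")
      case True
      have "norm (vq z) = smoothstep' (v z) * (1 / \<epsilon>^2 * norm (z - z0))"
        using smoothstep_bounds(3)[of "v z"] by (simp add: vq_def norm_mult norm_divide norm_power)
      also have "\<dots> \<le> 9 * (1 / \<epsilon>^2 * (2 * \<epsilon>))"
        using True e smoothstep_bounds(3,4)[of "v z"] by (intro mult_mono) auto
      also have "\<dots> = 18 / \<epsilon>" using e by (simp add: power2_eq_square)
      finally have "norm (vq z) \<le> 18 / \<epsilon>" .
      moreover have "norm (complex_of_real (smoothstep (w z))) \<le> 1" using smoothstep_bounds(1,2)[of "w z"] by simp
      moreover have "norm (Z z) \<le> inverse \<epsilon> ^ m" using True e by (intro Zb) auto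
      ultimately have "norm (vq z) * norm (complex_of_real (smoothstep (w z))) * norm (Z z) \<le> 18 / \<epsilon> * 1 * inverse \<epsilon> ^ m"
        using e by (intro mult_mono) auto
      then show ?thesis using True by (simp add: norm_mult dist_norm norm_minus_commute)
    next
      case False
      then have "smoothstep' (v z) = 0" using vle[of z] vge[of z] by (cases "norm (z - z0) \<le> \<epsilon>") (auto simp: smoothstep_values)
      then show ?thesis using e by (simp add: vq_def)
    qed
    have w1: "norm (of_real (smoothstep (v z)) * wq z * Z z) \<le> (9 * R / d * inverse r ^ m) * indicator (ball z0 R) z"
    proof (cases "r < norm (z - z0) \<and> norm (z - z0) < R")
      case True
      have "norm (wq z) = smoothstep' (w z) * (1 / d * norm (z - z0))"
        using smoothstep_bounds(3)[of "w z"] d by (simp add: wq_def norm_mult norm_divide)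
      also have "\<dots> \<le> 9 * (1 / d * R)"
        using True d smoothstep_bounds(3,4)[of "w z"] by (intro mult_mono) (auto intro: divide_right_mono)
      finally have "norm (wq z) \<le> 9 * R / d" by simp
      moreover have "norm (complex_of_real (smoothstep (v z))) \<le> 1" using smoothstep_bounds(1,2)[of "v z"] by simp
      moreover have "norm (Z z) \<le> inverse r ^ m" using True r0 by (intro Zb) auto
      ultimately have "norm (complex_of_real (smoothstep (v z))) * norm (wq z) * norm (Z z) \<le> 1 * (9 * R / d) * inverse r ^ m"
        using r0 r d by (intro mult_mono) auto
      then show ?thesis using True by (simp add: norm_mult dist_norm norm_minus_commute)
    next
      case False
      then have "smoothstep' (w z) = 0" using wle[of z] wge[of z] by (cases "norm (z - z0) \<le> r") (auto simp: smoothstep_values)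
      then show ?thesis using r0 r d by (simp add: wq_def)
    qed
    have "norm (cq z * Z z) \<le> norm (vq z * of_real (smoothstep (w z)) * Z z) + norm (of_real (smoothstep (v z)) * wq z * Z z)"
      unfolding cq_def distrib_right by (rule norm_triangle_ineq)
    also have "\<dots> \<le> (18 / \<epsilon> * inverse \<epsilon> ^ m) * indicator (ball z0 (2 * \<epsilon>)) z + (9 * R / d * inverse r ^ m) * indicator (ball z0 R) z"
      using v1 w1 by (rule add_mono)
    finally have "(norm (cq z * Z z))^2 \<le> ((18 / \<epsilon> * inverse \<epsilon> ^ m) * indicator (ball z0 (2 * \<epsilon>)) z + (9 * R / d * inverse r ^ m) * indicator (ball z0 R) z)^2"
      by (intro power_mono) auto
    also have "\<dots> \<le> 2 * ((18 / \<epsilon> * inverse \<epsilon> ^ m) * indicator (ball z0 (2 * \<epsilon>)) z)^2 + 2 * ((9 * R / d * inverse r ^ m) * indicator (ball z0 R) z)^2"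
      by (rule square_add_le)
    also have "\<dots> = 2 * (18 / \<epsilon> * inverse \<epsilon> ^ m)^2 * indicator (ball z0 (2 * \<epsilon>)) z + 2 * (9 * R / d * inverse r ^ m)^2 * indicator (ball z0 R) z"
      by (simp add: indicator_def power_mult_distrib)
    finally show "(norm (cq z * inverse (z - z0) ^ m))^2 \<le> 2 * (18 / \<epsilon> * inverse \<epsilon> ^ m)^2 * indicator (ball z0 (2 * \<epsilon>)) z + 2 * (9 * R / (R^2 - r^2) * inverse r ^ m)^2 * indicator (ball z0 R) z"
      unfolding Z_def d_def .
  qed
qed

text \<open>Two limits, in this order: \<open>\<epsilon> \<rightarrow> 0\<close> for fixed \<open>m\<close>, where flatness of order \<open>2m + 2\<close> removes the inner transition region;
  then \<open>m \<rightarrow> \<infinity>\<close>, where the factor \<open>(s/r)\<^bsup>2m\<^esup>\<close> beats the outer one. What survives is the integral of \<open>N P\<close> over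
  the annulus, and \<open>P\<close> is positive.\<close>

lemma flat_weighted_zero:
  fixes N P :: "complex \<Rightarrow> real"
  assumes N: "integrable lborel N" "\<And>z. N z \<ge> 0" and P: "P \<in> borel_measurable borel" "\<And>z. 0 < P z \<and> P z \<le> 1"
    and carleman: "\<And>\<eta> \<eta>q. cutoff_in z0 R' \<eta> \<eta>q \<Longrightarrow>
       (\<integral>\<^sup>+ z. ennreal ((norm (\<eta> z))^2 * N z * P z) \<partial>lborel) \<le> (\<integral>\<^sup>+ z. ennreal ((norm (\<eta>q z))^2 * N z * P z) \<partial>lborel)"
    and flat: "\<And>m::nat. ((\<lambda>r. (LINT z|lborel. indicator (ball z0 r) z * N z) / r ^ m) \<longlongrightarrow> 0) (at_right 0)"
    and \<sigma>: "0 < \<sigma>" "\<sigma> < s" "s < R'"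
  shows "AE z in lborel. \<sigma> < norm (z - z0) \<and> norm (z - z0) < s \<longrightarrow> N z = 0"
proof -
  have [measurable]: "N \<in> borel_measurable borel" "P \<in> borel_measurable borel" using N P by auto
  \<comment> \<open>Intermediate radii \<open>s < r < R < R'\<close>.\<close>
  define r where "r = (2 * s + R') / 3"
  define R where "R = (s + 2 * R') / 3"
  have rR: "s < r" "r < R" "R < R'" "0 < r" "0 < R" using \<sigma> by (auto simp: r_def R_def)
  define T where "T = {z. \<sigma> < norm (z - z0) \<and> norm (z - z0) < s}"
  have T [measurable]: "T \<in> sets borel" unfolding T_def by measurable
  define j where "j = (LINT z|lborel. indicator T z * N z * P z)"
  have Ti: "integrable lborel (\<lambda>z. indicator T z * N z * P z)"
  proof (rule Bochner_Integration.integrable_bound[OF N(1)])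
    show "AE z in lborel. norm (indicator T z * N z * P z) \<le> norm (N z)"
      using N(2) P(2) by (intro AE_I2) (auto simp: indicator_def abs_mult less_imp_le intro!: mult_right_le_one_le)
  qed measurable
  have Tn: "0 \<le> indicator T z * N z * P z" for z using N(2)[of z] P(2)[of z] by simp
  have j0: "j \<ge> 0" unfolding j_def by (intro integral_nonneg_AE AE_I2 Tn)
  define \<Phi> where "\<Phi> t = (LINT z|lborel. indicator (ball z0 t) z * N z)" for t
  have Bi: "integrable lborel (\<lambda>z. indicator (ball z0 t) z * N z)" for t
    using integrable_mult_indicator[of "ball z0 t" lborel N] N(1) by simp
  define n where "n = (LINT z|lborel. N z)"
  define K where "K = 9 * R / (R^2 - r^2)"
  have n0: "n \<ge> 0" unfolding n_def by (intro integral_nonneg_AE AE_I2 N(2))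
  \<comment> \<open>The Carleman inequality for the cutoff: annulus on the left, the two transition regions on the right.\<close>
  have key: "j * inverse s ^ (2 * m) \<le> 2 * (18 / \<epsilon> * inverse \<epsilon> ^ m)^2 * \<Phi> (2 * \<epsilon>) + 2 * (K * inverse r ^ m)^2 * n"
    if e: "0 < \<epsilon>" "2 * \<epsilon> < \<sigma>" for \<epsilon> m
  proof -
    \<comment> \<open>For \<open>2\<epsilon> < \<sigma>\<close> the annulus avoids the inner transition region.\<close>
    have er: "2 * \<epsilon> < r" using e \<sigma> rR by simp
    obtain \<eta> \<eta>q where ex: "cutoff_in z0 R' \<eta> \<eta>q"
    "\<forall>z. 2 * \<epsilon> \<le> norm (z - z0) \<longrightarrow> norm (z - z0) \<le> r \<longrightarrow> norm (\<eta> z) = inverse (norm (z - z0)) ^ m"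
    "\<forall>z. (norm (\<eta>q z))^2 \<le> 2 * (18 / \<epsilon> * inverse \<epsilon> ^ m)^2 * indicator (ball z0 (2 * \<epsilon>)) z + 2 * (K * inverse r ^ m)^2 * indicator (ball z0 R) z"
      using annulus_cutoff[OF e(1) er rR(2,3), of z0 m, folded K_def] by (elim exE conjE) (rule that)
    note \<eta> = ex(1) ex(2-3)[rule_format]
    let ?c = "2 * (18 / \<epsilon> * inverse \<epsilon> ^ m)^2" and ?k = "2 * (K * inverse r ^ m)^2"
    have "ennreal (j * inverse s ^ (2 * m)) = ennreal (LINT z|lborel. inverse s ^ (2 * m) * (indicator T z * N z * P z))"
      unfolding j_def by (simp add: mult.commute)
    also have "\<dots> = (\<integral>\<^sup>+ z. ennreal (inverse s ^ (2 * m) * (indicator T z * N z * P z)) \<partial>lborel)"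
      using Ti Tn \<sigma> by (intro nn_integral_eq_integral[symmetric] AE_I2) auto
    also have "\<dots> \<le> (\<integral>\<^sup>+ z. ennreal ((norm (\<eta> z))^2 * N z * P z) \<partial>lborel)"
    proof (intro nn_integral_mono ennreal_leI)
      fix z
      show "inverse s ^ (2 * m) * (indicator T z * N z * P z) \<le> (norm (\<eta> z))^2 * N z * P z"
      proof (cases "z \<in> T")
        case True
        then have z: "\<sigma> < norm (z - z0)" "norm (z - z0) < s" by (auto simp: T_def)
        have "norm (\<eta> z) = inverse (norm (z - z0)) ^ m" using z e rR by (intro \<eta>(2)) auto
        then have "inverse s ^ m \<le> norm (\<eta> z)" using z \<sigma> by (auto intro!: power_mono le_imp_inverse_le)
        then have "(inverse s ^ m)^2 \<le> (norm (\<eta> z))^2" using \<sigma> by (intro power_mono) auto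
        then have "inverse s ^ (2 * m) \<le> (norm (\<eta> z))^2" by (simp add: power_mult[symmetric] mult.commute)
        then have "inverse s ^ (2 * m) * (N z * P z) \<le> (norm (\<eta> z))^2 * (N z * P z)"
          using N(2)[of z] P(2)[of z] by (intro mult_right_mono) auto
        then show ?thesis using True by (simp add: mult.assoc)
      qed (use N(2)[of z] P(2)[of z] in simp)
    qed
    also have "\<dots> \<le> (\<integral>\<^sup>+ z. ennreal ((norm (\<eta>q z))^2 * N z * P z) \<partial>lborel)"
      by (rule carleman[OF \<eta>(1)])
    also have "\<dots> \<le> (\<integral>\<^sup>+ z. ennreal (?c * (indicator (ball z0 (2 * \<epsilon>)) z * N z) + ?k * N z) \<partial>lborel)"
    proof (intro nn_integral_mono ennreal_leI)
      fix z
      have "(norm (\<eta>q z))^2 * N z * P z \<le> (norm (\<eta>q z))^2 * N z * 1"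
        using N(2)[of z] P(2)[of z] by (intro mult_left_mono) auto
      also have "\<dots> \<le> (?c * indicator (ball z0 (2 * \<epsilon>)) z + ?k * 1) * N z"
      proof -
        have "?k * indicator (ball z0 R) z \<le> ?k * 1" by (intro mult_left_mono) (auto simp: indicator_def)
        then have "(norm (\<eta>q z))^2 \<le> ?c * indicator (ball z0 (2 * \<epsilon>)) z + ?k * 1" using \<eta>(3)[of z] by linarith
        then show ?thesis using N(2)[of z] by (simp add: mult_right_mono)
      qed
      finally show "(norm (\<eta>q z))^2 * N z * P z \<le> ?c * (indicator (ball z0 (2 * \<epsilon>)) z * N z) + ?k * N z"
        by (simp add: algebra_simps)
    qed
    also have "\<dots> = ennreal (LINT z|lborel. ?c * (indicator (ball z0 (2 * \<epsilon>)) z * N z) + ?k * N z)"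
      using Bi N by (intro nn_integral_eq_integral AE_I2) auto
    also have "(LINT z|lborel. ?c * (indicator (ball z0 (2 * \<epsilon>)) z * N z) + ?k * N z) = ?c * \<Phi> (2 * \<epsilon>) + ?k * n"
      using Bi N(1) by (simp add: \<Phi>_def n_def)
    finally have "ennreal (j * inverse s ^ (2 * m)) \<le> ennreal (?c * \<Phi> (2 * \<epsilon>) + ?k * n)" .
    moreover have "\<Phi> (2 * \<epsilon>) \<ge> 0" unfolding \<Phi>_def by (intro integral_nonneg_AE AE_I2) (use N(2) in simp)
    ultimately show ?thesis using n0 by (subst (asm) ennreal_le_iff) auto
  qed
  have lim: "j * inverse s ^ (2 * m) \<le> 2 * (K * inverse r ^ m)^2 * n" for m
  proof -
    have F: "((\<lambda>t. \<Phi> t / t ^ (2 * m + 2)) \<longlongrightarrow> 0) (at_right 0)"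
      unfolding \<Phi>_def by (rule flat)
    have "((\<lambda>\<epsilon>::real. 2 * \<epsilon>) \<longlongrightarrow> 2 * 0) (at_right 0)" by (intro tendsto_intros)
    then have g: "filterlim (\<lambda>\<epsilon>::real. 2 * \<epsilon>) (at_right 0) (at_right 0)"
      by (auto simp: filterlim_at eventually_at_filter)
    have "((\<lambda>\<epsilon>. 648 * 2 ^ (2 * m + 2) * (\<Phi> (2 * \<epsilon>) / (2 * \<epsilon>) ^ (2 * m + 2)) + 2 * (K * inverse r ^ m)^2 * n) \<longlongrightarrow> 648 * 2 ^ (2 * m + 2) * 0 + 2 * (K * inverse r ^ m)^2 * n) (at_right 0)"
      by (intro tendsto_intros filterlim_compose[OF F g])
    moreover have "\<forall>\<^sub>F \<epsilon> in at_right 0. j * inverse s ^ (2 * m) \<le> 648 * 2 ^ (2 * m + 2) * (\<Phi> (2 * \<epsilon>) / (2 * \<epsilon>) ^ (2 * m + 2)) + 2 * (K * inverse r ^ m)^2 * n"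
    proof -
      have "\<forall>\<^sub>F \<epsilon> in at_right 0. \<epsilon> \<in> {0<..<\<sigma> / 2}" using \<sigma> by (intro eventually_at_right_real) auto
      then show ?thesis
      proof eventually_elim
        case (elim \<epsilon>)
        then have e: "0 < \<epsilon>" "2 * \<epsilon> < \<sigma>" by auto
        have "2 * (18 / \<epsilon> * inverse \<epsilon> ^ m)^2 * \<Phi> (2 * \<epsilon>) = 648 * 2 ^ (2 * m + 2) * (\<Phi> (2 * \<epsilon>) / (2 * \<epsilon>) ^ (2 * m + 2))"
          using e(1) by (simp add: power_mult_distrib power_add power_mult power2_eq_square field_simps)
        then show ?case using key[OF e, of m] by simp
      qed
    qed
    ultimately show ?thesis by (intro tendsto_lowerbound[where F="at_right (0::real)"]) auto
  qed
  have "j \<le> 0"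
  proof -
    have b: "j \<le> 2 * K^2 * n * ((s / r)^2) ^ m" for m
    proof -
      have sp: "s ^ (2 * m) > 0" using \<sigma> by simp
      have "j = j * inverse s ^ (2 * m) * s ^ (2 * m)" using \<sigma> by (simp add: power_inverse)
      also have "\<dots> \<le> 2 * (K * inverse r ^ m)^2 * n * s ^ (2 * m)"
        using lim[of m] sp by (intro mult_right_mono) auto
      also have "\<dots> = 2 * K^2 * n * ((s / r)^2) ^ m"
      proof -
        have 1: "(inverse r ^ m)^2 = ((inverse r)^2) ^ m" by (simp add: power_mult[symmetric] mult.commute)
        have 2: "s ^ (2 * m) = (s^2) ^ m" by (simp add: power_mult)
        have 3: "(s / r)^2 = s^2 * (inverse r)^2" by (simp only: divide_inverse power_mult_distrib)
        show ?thesis unfolding power_mult_distrib[of K] 1 2 3 power_mult_distrib[of "s^2"] by (simp only: mult_ac)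
      qed
      finally show ?thesis .
    qed
    have "(s / r)^2 < 1" using rR \<sigma> by (simp add: power_less_one_iff abs_square_less_1)
    then have "(\<lambda>m. 2 * K^2 * n * ((s / r)^2) ^ m) \<longlonglongrightarrow> 2 * K^2 * n * 0"
      by (intro tendsto_intros LIMSEQ_power_zero) auto
    then show ?thesis using b by (intro LIMSEQ_le_const) auto
  qed
  with j0 have "j = 0" by simp
  then have "AE z in lborel. indicator T z * N z * P z = 0"
    using integral_nonneg_eq_0_iff_AE[OF Ti] Tn by (simp add: j_def)
  then show ?thesis
  proof eventually_elim
    case (elim z)
    then show ?case using P(2)[of z] by (auto simp: T_def indicator_def split: if_splits)
  qed
qed

text \<open>Countably many annuli exhaust the punctured disc.\<close>

lemma flat_imp_zero_ball:
  fixes f F :: "'n::finite \<Rightarrow> complex \<Rightarrow> complex" and V :: "complex \<Rightarrow> real"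
  assumes pair: "\<And>k. dbar_pair z0 R' (f k) (F k)"
    and V: "V \<in> borel_measurable borel" "integrable lborel (\<lambda>z. indicator (ball z0 R') z * (V z)^2)"
    and ineq: "AE z in lborel. z \<in> ball z0 R' \<longrightarrow> sqnorm F z \<le> (V z)^2 * sqnorm f z"
    and flat: "\<And>m::nat. ((\<lambda>r. (LINT z|lborel. indicator (ball z0 r) z * sqnorm f z) / r ^ m) \<longlongrightarrow> 0) (at_right 0)"
  shows "AE z in lborel. z \<in> ball z0 R' \<longrightarrow> (\<forall>k. f k z = 0)"
proof -
  define N where "N z = sqnorm f z" for z
  have N: "integrable lborel N" "\<And>z. N z \<ge> 0" unfolding N_def using pair by (simp_all add: sum_nonneg dbar_pair_def)
  have N0: "f k z = 0" if "N z = 0" for k z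
    using that sum_nonneg_eq_0_iff[of UNIV "\<lambda>k. (norm (f k z))^2"] by (simp add: N_def)
  obtain P :: "complex \<Rightarrow> real" where P: "P \<in> borel_measurable borel" "\<forall>z. 0 < P z \<and> P z \<le> 1"
    "\<forall>\<eta> \<eta>q. cutoff_in z0 R' \<eta> \<eta>q \<longrightarrow>
       (\<integral>\<^sup>+ z. ennreal ((norm (\<eta> z))^2 * N z * P z) \<partial>lborel) \<le> (\<integral>\<^sup>+ z. ennreal ((norm (\<eta>q z))^2 * N z * P z) \<partial>lborel)"
    using vector_carleman[OF pair V ineq, folded N_def] by (elim exE conjE) (rule that)
  \<comment> \<open>Inner radii decrease to \<open>0\<close> and outer radii increase to \<open>R'\<close>; note \<open>s i = R' - \<sigma> i\<close>.\<close>
  define \<sigma> where "\<sigma> i = R' / (real i + 3)" for i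
  define s where "s i = R' * (real i + 2) / (real i + 3)" for i
  show ?thesis
  proof (cases "R' > 0")
    case False
    then have "z \<notin> ball z0 R'" for z using zero_le_dist[of z0 z] unfolding mem_ball by linarith
    then show ?thesis by (intro AE_I2) simp
  next
    case True
    have i: "0 < \<sigma> i" "\<sigma> i < s i" "s i < R'" for i
    proof -
      show "0 < \<sigma> i" using True by (simp add: \<sigma>_def)
      have "R' * 1 < R' * (real i + 2)" using True by (intro mult_strict_left_mono) auto
      then show "\<sigma> i < s i" unfolding \<sigma>_def s_def by (intro divide_strict_right_mono) auto
      have "R' * (real i + 2) < R' * (real i + 3)" using True by (intro mult_strict_left_mono) auto
      then show "s i < R'" unfolding s_def by (subst pos_divide_less_eq) auto
    qed
    have "AE z in lborel. \<sigma> i < norm (z - z0) \<and> norm (z - z0) < s i \<longrightarrow> N z = 0" for i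
    proof (rule flat_weighted_zero[OF N P(1) _ _ _ i])
      show "0 < P z \<and> P z \<le> 1" for z using P(2) by blast
      show "((\<lambda>r. (LINT z|lborel. indicator (ball z0 r) z * N z) / r ^ m) \<longlongrightarrow> 0) (at_right 0)" for m
        unfolding N_def by (rule flat)
    qed (use P(3) in blast)
    then have "AE z in lborel. \<forall>i. \<sigma> i < norm (z - z0) \<and> norm (z - z0) < s i \<longrightarrow> N z = 0"
      by (subst AE_all_countable) (rule allI)
    moreover have "AE z in lborel. z \<noteq> z0" by (rule AE_lborel_singleton)
    ultimately show ?thesis
    proof eventually_elim
      case (elim z)
      show ?case
      proof
        assume z: "z \<in> ball z0 R'"
        define t where "t = norm (z - z0)"
        have t: "0 < t" "t < R'" using elim z by (auto simp: t_def dist_norm norm_minus_commute)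
        have "(\<lambda>i. R' / real i) \<longlonglongrightarrow> 0" by (rule lim_const_over_n)
        then have "\<sigma> \<longlonglongrightarrow> 0" using LIMSEQ_ignore_initial_segment[of "\<lambda>i. R' / real i" 0 3] by (simp add: \<sigma>_def[abs_def])
        then have "\<forall>\<^sub>F i in sequentially. \<sigma> i < min t (R' - t)" using t by (intro order_tendstoD(2)) auto
        then obtain i where "\<sigma> i < min t (R' - t)" by (meson eventually_sequentially order_refl)
        moreover have "s i = R' - \<sigma> i"
          by (simp add: s_def \<sigma>_def divide_simps) (simp add: algebra_simps)
        ultimately have "\<sigma> i < t" "t < s i" by auto
        then have "N z = 0" using elim(1) unfolding t_def by blast
        then show "\<forall>k. f k z = 0" using N0 by blast
      qed
    qed
  qed
qed

section \<open>From Sobolev functions to Borel representatives, and continuation\<close>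

text \<open>Lebesgue-measurable functions are replaced by Borel ones that vanish off \<open>K\<close>: Fubini's theorem and the
  convolutions above live on the Borel side.\<close>

lemma lborel_representative:
  fixes f :: "complex \<Rightarrow> complex"
  assumes K: "compact K" and f: "set_integrable lebesgue K f"
  obtains g where "integrable lborel g" "\<And>z. z \<notin> K \<Longrightarrow> g z = 0" "AE z in lebesgue. z \<in> K \<longrightarrow> f z = g z"
proof -
  have Kb [measurable]: "K \<in> sets borel" using K by (simp add: compact_imp_closed borel_closed)
  define h where "h z = indicator K z *\<^sub>R f z" for z
  have h: "integrable lebesgue h" using f unfolding set_integrable_def h_def .
  then have hm: "h \<in> borel_measurable lebesgue" by simp
  have "(\<lambda>z. Re (h z)) \<in> borel_measurable lebesgue" using hm by measurable
  then obtain a where a: "a \<in> borel_measurable lborel" "AE z in lborel. Re (h z) = a z"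
    using completion_ex_borel_measurable_real by blast
  have "(\<lambda>z. Im (h z)) \<in> borel_measurable lebesgue" using hm by measurable
  then obtain b where b: "b \<in> borel_measurable lborel" "AE z in lborel. Im (h z) = b z"
    using completion_ex_borel_measurable_real by blast
  define g where "g z = indicator K z *\<^sub>R (complex_of_real (a z) + \<i> * complex_of_real (b z))" for z
  note [measurable] = a(1) b(1)
  have gm: "g \<in> borel_measurable lborel" unfolding g_def by measurable
  have hg: "AE z in lborel. h z = g z"
    using a(2) b(2)
  proof eventually_elim
    case (elim z)
    then have "h z = complex_of_real (a z) + \<i> * complex_of_real (b z)" by (simp add: complex_eq_iff)
    moreover have "h z = indicator K z *\<^sub>R h z" by (simp add: h_def indicator_def)
    ultimately show ?case by (simp add: g_def)
  qed
  have hg': "AE z in lebesgue. h z = g z" using hg by (rule AE_completion)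
  have "integrable lebesgue g"
  proof (rule Bochner_Integration.integrable_cong_AE_imp[OF h])
    show "g \<in> borel_measurable lebesgue" using gm by (rule measurable_completion)
    show "AE z in lebesgue. h z = g z" by (rule hg')
  qed
  then have "integrable lborel g" using gm by (simp add: integrable_completion)
  moreover have "g z = 0" if "z \<notin> K" for z using that by (simp add: g_def)
  moreover have "AE z in lebesgue. z \<in> K \<longrightarrow> f z = g z"
    using hg' by eventually_elim (auto simp: h_def indicator_def split: if_splits)
  ultimately show ?thesis by (rule that)
qed

lemma lborel_representative_L2:
  fixes f g :: "complex \<Rightarrow> complex"
  assumes K: "compact K" and f: "set_integrable lebesgue K (\<lambda>z. (norm (f z))^2)"
    and g: "integrable lborel g" "\<And>z. z \<notin> K \<Longrightarrow> g z = 0" "AE z in lebesgue. z \<in> K \<longrightarrow> f z = g z"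
  shows "integrable lborel (\<lambda>z. (norm (g z))^2)"
proof -
  have gm [measurable]: "g \<in> borel_measurable borel" using g by auto
  have gm': "(\<lambda>z. (norm (g z))^2) \<in> borel_measurable lborel" by measurable
  have "integrable lebesgue (\<lambda>z. (norm (g z))^2)"
  proof (rule Bochner_Integration.integrable_cong_AE_imp[OF f[unfolded set_integrable_def]])
    show "(\<lambda>z. (norm (g z))^2) \<in> borel_measurable lebesgue" using gm' by (rule measurable_completion)
    show "AE z in lebesgue. indicator K z *\<^sub>R (norm (f z))^2 = (norm (g z))^2"
      using g(3) by eventually_elim (use g(2) in \<open>auto simp: indicator_def\<close>)
  qed
  then show ?thesis using gm' by (simp add: integrable_completion)
qed

lemma lborel_representative_integral:
  fixes f g \<theta> :: "complex \<Rightarrow> complex"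
  assumes K: "K \<subseteq> \<Omega>" and f: "set_integrable lebesgue K f"
    and g: "integrable lborel g" "\<And>z. z \<notin> K \<Longrightarrow> g z = 0" "AE z in lebesgue. z \<in> K \<longrightarrow> f z = g z"
    and \<theta>: "continuous_on UNIV \<theta>" "\<And>z. z \<notin> K \<Longrightarrow> \<theta> z = 0"
  shows "(LINT z:\<Omega>|lebesgue. f z * \<theta> z) = (LINT z|lborel. g z * \<theta> z)"
proof -
  have [measurable]: "\<theta> \<in> borel_measurable borel" "g \<in> borel_measurable borel"
    using \<theta> g by (auto intro: borel_measurable_continuous_onI)
  have \<theta>m: "\<theta> \<in> borel_measurable lebesgue" by (rule measurable_completion) measurable
  have gm: "(\<lambda>z. g z * \<theta> z) \<in> borel_measurable lborel" by measurable
  have hm: "(\<lambda>z. indicator K z *\<^sub>R f z) \<in> borel_measurable lebesgue"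
    using f unfolding set_integrable_def by simp
  have eq: "indicator \<Omega> z *\<^sub>R (f z * \<theta> z) = (indicator K z *\<^sub>R f z) * \<theta> z" for z
    using K \<theta>(2)[of z] by (auto simp: indicator_def)
  have "(LINT z:\<Omega>|lebesgue. f z * \<theta> z) = (LINT z|lebesgue. (indicator K z *\<^sub>R f z) * \<theta> z)"
    unfolding set_lebesgue_integral_def eq ..
  also have "\<dots> = (LINT z|lebesgue. g z * \<theta> z)"
  proof (rule integral_cong_AE)
    show "(\<lambda>z. (indicator K z *\<^sub>R f z) * \<theta> z) \<in> borel_measurable lebesgue"
      using hm \<theta>m by (rule borel_measurable_times)
    show "(\<lambda>z. g z * \<theta> z) \<in> borel_measurable lebesgue" using gm by (rule measurable_completion)
    show "AE z in lebesgue. (indicator K z *\<^sub>R f z) * \<theta> z = g z * \<theta> z"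
      using g(3) by eventually_elim (use g(2) in \<open>auto simp: indicator_def\<close>)
  qed
  also have "\<dots> = (LINT z|lborel. g z * \<theta> z)" using gm by (rule integral_completion)
  finally show ?thesis .
qed

lemma test_fun_derivative:
  fixes \<phi> :: "complex \<Rightarrow> complex"
  assumes t: "test_fun S \<phi>"
  shows "continuous_on UNIV \<phi>" "b \<in> {1, \<i>} \<Longrightarrow> continuous_on UNIV (\<lambda>z. frechet_derivative \<phi> (at z) b)"
    "z \<notin> S \<Longrightarrow> \<phi> z = 0" "z \<notin> S \<Longrightarrow> frechet_derivative \<phi> (at z) b = 0"
proof -
  have ck: "Ck k \<phi>" for k using t by (simp add: test_fun_def)
  show "continuous_on UNIV \<phi>" using ck[of 0] by simp
  show "continuous_on UNIV (\<lambda>z. frechet_derivative \<phi> (at z) b)" if "b \<in> {1, \<i>}"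
    using ck[of "Suc 0"] that by (auto simp: Basis_complex_def)
  let ?C = "closure {x. \<phi> x \<noteq> 0}"
  have C: "?C \<subseteq> S" using t by (simp add: test_fun_def)
  have 0: "\<phi> x = 0" if "x \<in> - ?C" for x using that closure_subset[of "{x. \<phi> x \<noteq> 0}"] by blast
  show "\<phi> z = 0" if "z \<notin> S" by (rule 0) (use C that in blast)
  show "frechet_derivative \<phi> (at z) b = 0" if "z \<notin> S"
  proof -
    have z: "z \<in> - ?C" using C that by blast
    have "open (- ?C)" by (rule open_Compl[OF closed_closure])
    then have D: "(\<phi> has_derivative (\<lambda>h. 0)) (at z)"
      by (rule has_derivative_transform_within_open[OF has_derivative_const[of 0] _ z]) (rule 0[symmetric])
    show ?thesis by (simp only: frechet_derivative_at[OF D, symmetric])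
  qed
qed

lemma compact_support_times_integrable:
  fixes g \<theta> :: "complex \<Rightarrow> complex"
  assumes g: "integrable lborel g" and \<theta>: "continuous_on UNIV \<theta>" "\<And>z. z \<notin> ball p R \<Longrightarrow> \<theta> z = 0"
  shows "integrable lborel (\<lambda>z. g z * \<theta> z)"
proof -
  have [measurable]: "\<theta> \<in> borel_measurable borel" "g \<in> borel_measurable borel"
    using \<theta> g by (auto intro: borel_measurable_continuous_onI)
  obtain C where C: "C > 0" "\<And>z. norm (\<theta> z) \<le> C"
  proof (rule compact_support_bounded[OF \<theta>(1), of "norm p + R"])
    fix z :: complex assume "norm p + R < norm z"
    then show "\<theta> z = 0" using \<theta>(2)[of z] norm_triangle_ineq2[of z p] by (simp add: dist_norm norm_minus_commute)
  qed (rule that)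
  show ?thesis
  proof (rule Bochner_Integration.integrable_bound)
    show "integrable lborel (\<lambda>z. of_real C * g z)" using g by simp
    show "AE z in lborel. norm (g z * \<theta> z) \<le> norm (of_real C * g z)"
      using C by (auto simp: norm_mult mult.commute[of C] intro!: AE_I2 mult_left_mono)
  qed measurable
qed

text \<open>The weak \<open>\<partial>/\<partial>\<bar>z\<close> derivative \<open>w\<close> is a priori only locally integrable. It agrees almost everywhere with the combination
  of the two square-integrable weak partial derivatives, because both have the same integrals against all test functions.\<close>

lemma weak_dbar_representative:
  fixes f w :: "complex \<Rightarrow> complex"
  assumes sub: "cball p R \<subseteq> \<Omega>" and f: "H1_loc \<Omega> f" and w: "has_weak_dbar \<Omega> f w"
  shows "\<exists>g G. dbar_pair p R g G \<and>
    (AE z in lebesgue. z \<in> cball p R \<longrightarrow> f z = g z) \<and> (AE z in lebesgue. z \<in> ball p R \<longrightarrow> w z = G z)"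
proof -
  let ?K = "cball p R"
  have K: "compact ?K" by simp
  have L1: "set_integrable lebesgue ?K h" if "L1_loc \<Omega> h" for h using that sub by (simp add: L1_loc_def)
  have L2: "set_integrable lebesgue ?K (\<lambda>z. (norm (h z))^2)" if "L2_loc \<Omega> h" for h :: "complex \<Rightarrow> complex"
    using that sub by (simp add: L2_loc_def)
  have tsub: "test_fun \<Omega> \<phi>" if "test_fun (ball p R) \<phi>" for \<phi>
    using that subset_trans[OF _ subset_trans[OF ball_subset_cball sub]] by (simp add: test_fun_def)
  have bK: "z \<notin> ?K \<Longrightarrow> z \<notin> ball p R" for z using ball_subset_cball[of p R] by blast
  have f1: "set_integrable lebesgue ?K f" "set_integrable lebesgue ?K w"
    using w L1 by (simp_all add: has_weak_dbar_def)
  have f2: "set_integrable lebesgue ?K (\<lambda>z. (norm (f z))^2)" using f L2 by (simp add: H1_loc_def)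
  obtain g1 where g1: "L2_loc \<Omega> g1" "has_weak_partial \<Omega> 1 f g1" using f by (auto simp: H1_loc_def Basis_complex_def)
  obtain g2 where g2: "L2_loc \<Omega> g2" "has_weak_partial \<Omega> \<i> f g2" using f by (auto simp: H1_loc_def Basis_complex_def)
  have gi: "set_integrable lebesgue ?K g1" "set_integrable lebesgue ?K g2"
    using g1(2) g2(2) L1 by (simp_all add: has_weak_partial_def)
  obtain g where g: "integrable lborel g" "\<And>z. z \<notin> ?K \<Longrightarrow> g z = 0" "AE z in lebesgue. z \<in> ?K \<longrightarrow> f z = g z"
    using lborel_representative[OF K f1(1)] by blast
  obtain W where W: "integrable lborel W" "\<And>z. z \<notin> ?K \<Longrightarrow> W z = 0" "AE z in lebesgue. z \<in> ?K \<longrightarrow> w z = W z"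
    using lborel_representative[OF K f1(2)] by blast
  obtain h1 where h1: "integrable lborel h1" "\<And>z. z \<notin> ?K \<Longrightarrow> h1 z = 0" "AE z in lebesgue. z \<in> ?K \<longrightarrow> g1 z = h1 z"
    using lborel_representative[OF K gi(1)] by blast
  obtain h2 where h2: "integrable lborel h2" "\<And>z. z \<notin> ?K \<Longrightarrow> h2 z = 0" "AE z in lebesgue. z \<in> ?K \<longrightarrow> g2 z = h2 z"
    using lborel_representative[OF K gi(2)] by blast
  have gL2: "integrable lborel (\<lambda>z. (norm (g z))^2)" by (rule lborel_representative_L2[OF K f2 g])
  have hL2: "integrable lborel (\<lambda>z. (norm (h1 z))^2)" "integrable lborel (\<lambda>z. (norm (h2 z))^2)"
    using lborel_representative_L2[OF K L2[OF g1(1)] h1] lborel_representative_L2[OF K L2[OF g2(1)] h2] by auto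
  have [measurable]: "h1 \<in> borel_measurable borel" "h2 \<in> borel_measurable borel" using h1 h2 by auto
  define G where "G z = (h1 z + \<i> * h2 z) / 2" for z
  have Gi: "integrable lborel G" unfolding G_def using h1(1) h2(1) by simp
  have GL2: "integrable lborel (\<lambda>z. (norm (G z))^2)"
  proof (rule Bochner_Integration.integrable_bound)
    show "integrable lborel (\<lambda>z. (norm (h1 z))^2 + (norm (h2 z))^2)" using hL2 by simp
    show "AE z in lborel. norm ((norm (G z))^2) \<le> norm ((norm (h1 z))^2 + (norm (h2 z))^2)"
    proof (rule AE_I2)
      fix z
      have "norm (G z) = norm (h1 z + \<i> * h2 z) / 2" by (simp add: G_def norm_divide)
      also have "\<dots> \<le> (norm (h1 z) + norm (h2 z)) / 2"
        using norm_triangle_ineq[of "h1 z" "\<i> * h2 z"] by (simp add: norm_mult)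
      finally have "(norm (G z))^2 \<le> ((norm (h1 z) + norm (h2 z)) / 2)^2" by (intro power_mono) auto
      also have "\<dots> = (norm (h1 z) + norm (h2 z))^2 / 4" by (simp add: power_divide)
      also have "\<dots> \<le> (2 * (norm (h1 z))^2 + 2 * (norm (h2 z))^2) / 4"
        by (intro divide_right_mono square_add_le) simp
      also have "\<dots> \<le> (norm (h1 z))^2 + (norm (h2 z))^2"
      proof -
        have "(2 * x + 2 * y) / 4 \<le> x + y" if "0 \<le> x" "0 \<le> y" for x y :: real using that by simp
        then show ?thesis by simp
      qed
      finally have "(norm (G z))^2 \<le> (norm (h1 z))^2 + (norm (h2 z))^2" .
      then show "norm ((norm (G z))^2) \<le> norm ((norm (h1 z))^2 + (norm (h2 z))^2)" by simp
    qed
    show "(\<lambda>z. (norm (G z))^2) \<in> borel_measurable lborel" unfolding G_def by measurable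
  qed
  have weak: "(LINT z|lborel. g z * dbar \<phi> z) = - (LINT z|lborel. G z * \<phi> z)"
    and weakW: "(LINT z|lborel. g z * dbar \<phi> z) = - (LINT z|lborel. W z * \<phi> z)"
    if t: "test_fun (ball p R) \<phi>" for \<phi>
  proof -
    note T = test_fun_derivative[OF t]
    let ?D = "\<lambda>b z. frechet_derivative \<phi> (at z) b"
    have D0: "z \<notin> ?K \<Longrightarrow> ?D b z = 0" "z \<notin> ?K \<Longrightarrow> \<phi> z = 0" for b z using T(3,4) bK by auto
    have dc: "continuous_on UNIV (dbar \<phi>)" unfolding dbar_def[abs_def]
      by (intro continuous_intros T(2)) auto
    have d0: "z \<notin> ?K \<Longrightarrow> dbar \<phi> z = 0" for z using D0 by (simp add: dbar_def)
    have Dc: "continuous_on UNIV (?D 1)" "continuous_on UNIV (?D \<i>)" using T(2) by auto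
    have e1: "(LINT z|lborel. g z * ?D 1 z) = - (LINT z|lborel. h1 z * \<phi> z)"
      using g1(2) tsub[OF t] lborel_representative_integral[OF sub f1(1) g Dc(1) D0(1)]
        lborel_representative_integral[OF sub gi(1) h1 T(1) D0(2)] by (simp add: has_weak_partial_def)
    have e2: "(LINT z|lborel. g z * ?D \<i> z) = - (LINT z|lborel. h2 z * \<phi> z)"
      using g2(2) tsub[OF t] lborel_representative_integral[OF sub f1(1) g Dc(2) D0(1)]
        lborel_representative_integral[OF sub gi(2) h2 T(1) D0(2)] by (simp add: has_weak_partial_def)
    have i1: "integrable lborel (\<lambda>z. g z * ?D 1 z)" "integrable lborel (\<lambda>z. g z * ?D \<i> z)"
      by (rule compact_support_times_integrable[OF g(1) Dc(1)]; use T(4) in blast)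
         (rule compact_support_times_integrable[OF g(1) Dc(2)]; use T(4) in blast)
    have i2: "integrable lborel (\<lambda>z. h1 z * \<phi> z)" "integrable lborel (\<lambda>z. h2 z * \<phi> z)"
      by (rule compact_support_times_integrable[OF h1(1) T(1)]; use T(3) in blast)
         (rule compact_support_times_integrable[OF h2(1) T(1)]; use T(3) in blast)
    have "(LINT z|lborel. g z * dbar \<phi> z) = (LINT z|lborel. (g z * ?D 1 z + \<i> * (g z * ?D \<i> z)) / 2)"
      by (intro Bochner_Integration.integral_cong refl) (simp add: dbar_def algebra_simps)
    also have "\<dots> = ((LINT z|lborel. g z * ?D 1 z) + \<i> * (LINT z|lborel. g z * ?D \<i> z)) / 2"
      using i1 by simp
    also have "\<dots> = - (((LINT z|lborel. h1 z * \<phi> z) + \<i> * (LINT z|lborel. h2 z * \<phi> z)) / 2)"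
      unfolding e1 e2 by (simp add: algebra_simps)
    also have "((LINT z|lborel. h1 z * \<phi> z) + \<i> * (LINT z|lborel. h2 z * \<phi> z)) / 2 = (LINT z|lborel. (h1 z * \<phi> z + \<i> * (h2 z * \<phi> z)) / 2)"
      using i2 by simp
    also have "\<dots> = (LINT z|lborel. G z * \<phi> z)"
      by (intro Bochner_Integration.integral_cong refl) (simp add: G_def algebra_simps)
    finally show "(LINT z|lborel. g z * dbar \<phi> z) = - (LINT z|lborel. G z * \<phi> z)" .
    show "(LINT z|lborel. g z * dbar \<phi> z) = - (LINT z|lborel. W z * \<phi> z)"
      using w tsub[OF t] lborel_representative_integral[OF sub f1(1) g dc d0]
        lborel_representative_integral[OF sub f1(2) W T(1) D0(2)] by (simp add: has_weak_dbar_def)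
  qed
  have "AE z in lborel. z \<in> ball p R \<longrightarrow> W z - G z = 0"
  proof (rule weak_zero_imp_AE_zero)
    show "integrable lborel (\<lambda>z. W z - G z)" using W(1) Gi by simp
    fix \<phi> assume t: "test_fun (ball p R) \<phi>"
    note T = test_fun_derivative[OF t]
    have "integrable lborel (\<lambda>z. W z * \<phi> z)" "integrable lborel (\<lambda>z. G z * \<phi> z)"
      by (rule compact_support_times_integrable[OF W(1) T(1)]; use T(3) in blast)
         (rule compact_support_times_integrable[OF Gi T(1)]; use T(3) in blast)
    then show "(LINT z|lborel. (W z - G z) * \<phi> z) = 0"
      using weak[OF t] weakW[OF t] by (simp add: left_diff_distrib)
  qed
  then have "AE z in lebesgue. z \<in> ball p R \<longrightarrow> W z - G z = 0" by (rule AE_completion)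
  then have wG: "AE z in lebesgue. z \<in> ball p R \<longrightarrow> w z = G z"
    using W(3) by eventually_elim auto
  show ?thesis
    unfolding dbar_pair_def
    by (intro exI[of _ g] exI[of _ G] conjI allI impI g(1) gL2 Gi GL2 weak g(3) wG)
qed

lemma norm_vec_square: "(norm (x :: complex^'n))^2 = (\<Sum>k\<in>UNIV. (norm (x $ k))^2)"
  by (simp add: norm_vec_def L2_set_def sum_nonneg)

text \<open>The size of the disc is governed by the geometry of \<open>\<Omega>\<close> alone. The continuation along chains of discs
  depends on this: it compares discs centred at different points.\<close>

lemma flat_imp_zero_near:
  fixes u dbar_u :: "complex \<Rightarrow> complex^'N" and V :: "complex \<Rightarrow> real"
  assumes "open \<Omega>" and u: "H1_loc_vec \<Omega> u" and w: "has_weak_dbar_vec \<Omega> u dbar_u" and V: "L2_loc \<Omega> V"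
    and ineq: "AE z in lebesgue_on \<Omega>. norm (dbar_u z) \<le> V z * norm (u z)"
    and sub: "cball p R \<subseteq> \<Omega>" and R: "R > 0" and flat: "flat_at u p"
  shows "AE z in lebesgue. z \<in> ball p R \<longrightarrow> u z = 0"
proof -
  let ?K = "cball p R"
  have "\<forall>k. \<exists>g G. dbar_pair p R g G \<and>
    (AE z in lebesgue. z \<in> ?K \<longrightarrow> u z $ k = g z) \<and> (AE z in lebesgue. z \<in> ball p R \<longrightarrow> dbar_u z $ k = G z)"
  proof
    fix k
    have "H1_loc \<Omega> (\<lambda>z. u z $ k)" "has_weak_dbar \<Omega> (\<lambda>z. u z $ k) (\<lambda>z. dbar_u z $ k)"
      using u w by (simp_all add: H1_loc_vec_def has_weak_dbar_vec_def)
    then show "\<exists>g G. dbar_pair p R g G \<and>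
    (AE z in lebesgue. z \<in> ?K \<longrightarrow> u z $ k = g z) \<and> (AE z in lebesgue. z \<in> ball p R \<longrightarrow> dbar_u z $ k = G z)"
      by (rule weak_dbar_representative[OF sub])
  qed
  then obtain f F where H: "\<forall>k. dbar_pair p R (f k) (F k) \<and>
    (AE z in lebesgue. z \<in> ?K \<longrightarrow> u z $ k = f k z) \<and> (AE z in lebesgue. z \<in> ball p R \<longrightarrow> dbar_u z $ k = F k z)"
    unfolding choice_iff by (elim exE) (rule that)
  then have pair: "dbar_pair p R (f k) (F k)" for k by blast
  then have f: "integrable lborel (f k)" for k by (simp add: dbar_pair_def)
  have "AE z in lebesgue. \<forall>k\<in>UNIV. z \<in> ?K \<longrightarrow> u z $ k = f k z"
    by (rule AE_finite_allI) (use H in simp_all)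
  then have uf: "AE z in lebesgue. z \<in> ?K \<longrightarrow> (\<forall>k. u z $ k = f k z)" by eventually_elim simp
  have "AE z in lebesgue. \<forall>k\<in>UNIV. z \<in> ball p R \<longrightarrow> dbar_u z $ k = F k z"
    by (rule AE_finite_allI) (use H in simp_all)
  then have wF: "AE z in lebesgue. z \<in> ball p R \<longrightarrow> (\<forall>k. dbar_u z $ k = F k z)" by eventually_elim simp
  have \<Omega>m: "\<Omega> \<in> sets lebesgue" using \<open>open \<Omega>\<close> by simp
  have bK: "z \<in> ball p R \<Longrightarrow> z \<in> ?K" "z \<in> ?K \<Longrightarrow> z \<in> \<Omega>" for z using ball_subset_cball[of p R] sub by blast+
  have VK: "set_integrable lebesgue ?K (\<lambda>z. (V z)^2)" using V sub by (simp add: L2_loc_def)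
  have "(\<lambda>z. indicator \<Omega> z *\<^sub>R V z) \<in> borel_measurable lebesgue"
    using V \<Omega>m by (subst borel_measurable_restrict_space_iff[symmetric]) (simp_all add: L2_loc_def)
  then obtain v where v: "v \<in> borel_measurable lborel" "AE z in lborel. indicator \<Omega> z *\<^sub>R V z = v z"
    using completion_ex_borel_measurable_real by blast
  have v': "AE z in lebesgue. indicator \<Omega> z *\<^sub>R V z = v z" using v(2) by (rule AE_completion)
  have vb [measurable]: "v \<in> borel_measurable borel" using v(1) by simp
  have vi: "integrable lborel (\<lambda>z. indicator (ball p R) z * (v z)^2)"
  proof -
    have [measurable]: "(indicator (ball p R) :: complex \<Rightarrow> real) \<in> borel_measurable borel"
      "(indicator ?K :: complex \<Rightarrow> real) \<in> borel_measurable borel"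
      by (intro borel_measurable_indicator borel_open open_ball, intro borel_measurable_indicator borel_closed closed_cball)
    have m: "(\<lambda>z. indicator ?K z * (v z)^2) \<in> borel_measurable lborel" by measurable
    have "integrable lebesgue (\<lambda>z. indicator ?K z * (v z)^2)"
    proof (rule Bochner_Integration.integrable_cong_AE_imp[OF VK[unfolded set_integrable_def]])
      show "(\<lambda>z. indicator ?K z * (v z)^2) \<in> borel_measurable lebesgue" using m by (rule measurable_completion)
      show "AE z in lebesgue. indicator ?K z *\<^sub>R (V z)^2 = indicator ?K z * (v z)^2"
        using v'
      proof eventually_elim
        case (elim z)
        show ?case
        proof (cases "z \<in> ?K")
          case True
          then have "v z = V z" using elim bK(2)[OF True] by simp
          then show ?thesis by simp
        qed simp
      qed
    qed
    then have "integrable lborel (\<lambda>z. indicator ?K z * (v z)^2)" using m by (simp add: integrable_completion)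
    then show ?thesis
    proof (rule Bochner_Integration.integrable_bound)
      show "AE z in lborel. norm (indicator (ball p R) z * (v z)^2) \<le> norm (indicator ?K z * (v z)^2)"
        using bK(1) by (intro AE_I2) (simp add: indicator_def)
    qed measurable
  qed
  have ineq': "AE z in lebesgue. z \<in> \<Omega> \<longrightarrow> norm (dbar_u z) \<le> V z * norm (u z)"
    using ineq \<Omega>m by (subst (asm) AE_restrict_space_iff) simp_all
  have "AE z in lebesgue. z \<in> ball p R \<longrightarrow> sqnorm F z \<le> (v z)^2 * sqnorm f z"
    using ineq' v' uf wF
  proof eventually_elim
    case (elim z)
    show ?case
    proof
      assume z: "z \<in> ball p R"
      have zK: "z \<in> ?K" "z \<in> \<Omega>" using bK z by blast+
      have "(norm (dbar_u z))^2 \<le> (V z * norm (u z))^2" using elim(1) zK by (intro power_mono) auto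
      moreover have "V z = v z" using elim(2) zK by simp
      moreover have "(norm (dbar_u z))^2 = sqnorm F z" "(norm (u z))^2 = sqnorm f z"
        using elim(3,4) z zK by (simp_all add: norm_vec_square)
      ultimately show "sqnorm F z \<le> (v z)^2 * sqnorm f z"
        by (simp add: power_mult_distrib)
    qed
  qed
  then have ineq2: "AE z in lborel. z \<in> ball p R \<longrightarrow> sqnorm F z \<le> (v z)^2 * sqnorm f z"
    by (simp only: AE_completion_iff)
  have fm [measurable]: "f k \<in> borel_measurable borel" for k using f[of k] by auto
  have int_eq: "(LINT z:ball p r|lebesgue. (norm (u z))^2) = (LINT z|lborel. indicator (ball p r) z * sqnorm f z)"
    if "r \<le> R" for r
  proof -
    have br: "z \<in> ball p r \<Longrightarrow> z \<in> ?K" for z using that by simp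
    have ib [measurable]: "(indicator (ball p r) :: complex \<Rightarrow> real) \<in> borel_measurable borel"
      by (intro borel_measurable_indicator borel_open open_ball)
    have m: "(\<lambda>z. indicator (ball p r) z * sqnorm f z) \<in> borel_measurable lborel" by measurable
    have ml: "(\<lambda>z. indicator (ball p r) z * sqnorm f z) \<in> borel_measurable lebesgue"
      using m by (rule measurable_completion)
    have ae: "AE z in lebesgue. indicator (ball p r) z * sqnorm f z = indicator (ball p r) z *\<^sub>R (norm (u z))^2"
      using uf
    proof eventually_elim
      case (elim z)
      show ?case using elim br[of z] by (cases "z \<in> ball p r") (simp_all add: norm_vec_square)
    qed
    have "(LINT z:ball p r|lebesgue. (norm (u z))^2) = (LINT z|lebesgue. indicator (ball p r) z * sqnorm f z)"
      unfolding set_lebesgue_integral_def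
    proof (rule integral_cong_AE[OF _ ml])
      show "(\<lambda>z. indicator (ball p r) z *\<^sub>R (norm (u z))^2) \<in> borel_measurable lebesgue"
        using ml ae by (rule borel_measurable_AE)
      show "AE z in lebesgue. indicator (ball p r) z *\<^sub>R (norm (u z))^2 = indicator (ball p r) z * sqnorm f z"
        using ae by eventually_elim (rule sym)
    qed
    then show ?thesis using integral_completion[OF m] by simp
  qed
  have flat2: "((\<lambda>r. (LINT z|lborel. indicator (ball p r) z * sqnorm f z) / r ^ m) \<longlongrightarrow> 0) (at_right 0)" for m
  proof (rule Lim_transform_eventually)
    show "((\<lambda>r. (LINT z:ball p r|lebesgue. (norm (u z))^2) / r ^ m) \<longlongrightarrow> 0) (at_right 0)"
      using flat by (simp add: flat_at_def)
    have "\<forall>\<^sub>F r in at_right 0. r \<in> {0<..<R}" using R by (intro eventually_at_right_real) auto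
    then show "\<forall>\<^sub>F r in at_right 0. (LINT z:ball p r|lebesgue. (norm (u z))^2) / r ^ m = (LINT z|lborel. indicator (ball p r) z * sqnorm f z) / r ^ m"
      by eventually_elim (simp add: int_eq)
  qed
  have "AE z in lborel. z \<in> ball p R \<longrightarrow> (\<forall>k. f k z = 0)"
    by (rule flat_imp_zero_ball[OF pair vb vi ineq2 flat2])
  then have "AE z in lebesgue. z \<in> ball p R \<longrightarrow> (\<forall>k. f k z = 0)" by (rule AE_completion)
  then show ?thesis using uf
  proof eventually_elim
    case (elim z)
    show ?case
    proof
      assume z: "z \<in> ball p R"
      then have "u z $ k = 0" for k using elim bK(1)[OF z] by simp
      then show "u z = 0" by (simp add: vec_eq_iff)
    qed
  qed
qed

lemma zero_near_imp_flat:
  assumes "d > 0" and z: "AE z in lebesgue. z \<in> ball p d \<longrightarrow> u z = 0"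
  shows "flat_at u p"
  unfolding flat_at_def
proof
  fix m :: nat
  have "\<forall>\<^sub>F r in at_right 0. r \<in> {0<..<d}" using assms by (intro eventually_at_right_real) auto
  then have "\<forall>\<^sub>F r in at_right 0. (LINT z:ball p r|lebesgue. (norm (u z))^2) / r ^ m = 0"
  proof eventually_elim
    case (elim r)
    have "AE z in lebesgue. indicator (ball p r) z *\<^sub>R (norm (u z))^2 = 0"
      using z by eventually_elim (use elim in \<open>auto simp: indicator_def\<close>)
    then show ?case unfolding set_lebesgue_integral_def by (simp add: integral_eq_zero_AE)
  qed
  then show "((\<lambda>r. (LINT z:ball p r|lebesgue. (norm (u z))^2) / r ^ m) \<longlongrightarrow> 0) (at_right 0)"
    by (rule tendsto_eventually)
qed

theorem theorem1p1:
  fixes \<Omega> :: "complex set"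
    and u :: "complex \<Rightarrow> complex^'N"
    and dbar_u :: "complex \<Rightarrow> complex^'N"
    and V :: "complex \<Rightarrow> real"
    and z0 :: complex
  assumes "open \<Omega>" and "connected \<Omega>"
    and "H1_loc_vec \<Omega> u"
    and "has_weak_dbar_vec \<Omega> u dbar_u"
    and "L2_loc \<Omega> V"
    and "AE z in lebesgue_on \<Omega>. norm (dbar_u z) \<le> V z * norm (u z)"
    and "z0 \<in> \<Omega>"
    and "flat_at u z0"
  shows "AE z in lebesgue_on \<Omega>. u z = 0"
proof -
  note local_zero = flat_imp_zero_near[OF assms(1,3-6)]
  define Z where "Z d z \<longleftrightarrow> (AE w in lebesgue. w \<in> ball z d \<longrightarrow> u w = 0)" for d z
  have Zmono: "Z d' z'" if "Z d z" "ball z' d' \<subseteq> ball z d" for d z d' z'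
    using that(1) unfolding Z_def by eventually_elim (use that(2) in blast)
  \<comment> \<open>The open set on which \<open>u\<close> vanishes locally; it is shown to be relatively closed as well.\<close>
  define S where "S = {z \<in> \<Omega>. \<exists>d>0. Z d z}"
  have S: "S \<subseteq> \<Omega>" by (auto simp: S_def)
  have near: "z \<in> S" if n: "z \<in> \<Omega>" "cball y R \<subseteq> \<Omega>" "z \<in> ball y R" "flat_at u y" for z y R
  proof -
    have R: "R > 0" using n(3) zero_le_dist[of y z] unfolding mem_ball by linarith
    have "Z R y" unfolding Z_def by (rule local_zero[OF n(2) R n(4)])
    moreover obtain d where "d > 0" "ball z d \<subseteq> ball y R" using openE[OF open_ball n(3)] by blast
    ultimately have "Z d z" by (blast intro: Zmono)
    then show ?thesis using \<open>d > 0\<close> n(1) unfolding S_def by blast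
  qed
  have flatS: "flat_at u z" if "z \<in> S" for z
    using that zero_near_imp_flat unfolding S_def Z_def by blast
  have "open S"
    unfolding open_contains_ball
  proof (rule ballI)
    fix z assume "z \<in> S"
    then obtain d where d: "z \<in> \<Omega>" "d > 0" "Z d z" unfolding S_def by blast
    obtain e where e: "e > 0" "ball z e \<subseteq> \<Omega>" using openE[OF assms(1) d(1)] by blast
    have "ball z (min e (d / 2)) \<subseteq> S"
    proof
      fix y assume y: "y \<in> ball z (min e (d / 2))"
      then have "y \<in> \<Omega>" using e(2) by auto
      moreover have "ball y (d / 2) \<subseteq> ball z d"
      proof
        fix x assume "x \<in> ball y (d / 2)"
        then show "x \<in> ball z d" using y dist_triangle[of z x y] by simp
      qed
      then have "Z (d / 2) y" by (rule Zmono[OF d(3)])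
      ultimately show "y \<in> S" unfolding S_def using d(2) by (blast intro: half_gt_zero)
    qed
    then show "\<exists>e>0. ball z e \<subseteq> S" using e(1) d(2) by (intro exI[of _ "min e (d / 2)"]) simp
  qed
  have "open (\<Omega> - S)"
    unfolding open_contains_ball
  proof (rule ballI)
    fix z assume z: "z \<in> \<Omega> - S"
    obtain e where e: "e > 0" "ball z e \<subseteq> \<Omega>" using openE[OF assms(1), of z] z by blast
    \<comment> \<open>A point of \<open>S\<close> within \<open>e / 4\<close> of \<open>z\<close> would be the centre of a disc of radius \<open>e / 2\<close> that contains \<open>z\<close>.\<close>
    have "ball z (e / 4) \<subseteq> \<Omega> - S"
    proof
      fix y assume y: "y \<in> ball z (e / 4)"
      have c: "cball y (e / 2) \<subseteq> \<Omega>"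
      proof
        fix x assume "x \<in> cball y (e / 2)"
        then have "dist z x < e" using y dist_triangle[of z x y] e(1) by simp
        then show "x \<in> \<Omega>" using e(2) by auto
      qed
      have "y \<notin> S"
      proof
        assume "y \<in> S"
        have "z \<in> S"
          by (rule near[OF _ c _ flatS[OF \<open>y \<in> S\<close>]]) (use z y e(1) in \<open>simp_all add: dist_commute\<close>)
        then show False using z by simp
      qed
      moreover have "y \<in> \<Omega>" using c e(1) by (meson centre_in_cball less_imp_le half_gt_zero subsetD)
      ultimately show "y \<in> \<Omega> - S" by simp
    qed
    then show "\<exists>d>0. ball z d \<subseteq> \<Omega> - S" using e(1) by (intro exI[of _ "e / 4"]) simp
  qed
  moreover have "z0 \<in> S"
  proof -
    obtain e where e: "e > 0" "cball z0 e \<subseteq> \<Omega>" using assms(1,7) open_contains_cball by blast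
    show ?thesis by (rule near[OF assms(7) e(2) _ assms(8)]) (use e(1) in simp)
  qed
  ultimately have "\<Omega> - S = {}"
    using connectedD[OF assms(2) \<open>open S\<close>, of "\<Omega> - S"] S assms(7) by blast
  then have all: "\<exists>d>0. Z d z" if "z \<in> \<Omega>" for z using that unfolding S_def by blast
  have "negligible {z \<in> \<Omega>. u z \<noteq> 0}"
  proof (subst locally_negligible_alt, rule ballI)
    fix z assume z: "z \<in> {z \<in> \<Omega>. u z \<noteq> 0}"
    then obtain d where d: "d > 0" "Z d z" using all by blast
    let ?U = "{z \<in> \<Omega>. u z \<noteq> 0} \<inter> ball z d"
    have "AE w in lebesgue. w \<notin> ?U" using d(2) unfolding Z_def by eventually_elim blast
    then obtain N where N: "N \<in> null_sets lebesgue" "{w \<in> space lebesgue. \<not> w \<notin> ?U} \<subseteq> N"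
      unfolding eventually_ae_filter by (elim bexE) (rule that)
    have "negligible ?U"
    proof (rule negligible_subset)
      show "negligible N" using N(1) by (simp add: negligible_iff_null_sets)
      show "?U \<subseteq> N" using N(2) by auto
    qed
    moreover have "openin (top_of_set {z \<in> \<Omega>. u z \<noteq> 0}) ?U" by (intro openin_open_Int open_ball)
    ultimately show "\<exists>U. openin (top_of_set {z \<in> \<Omega>. u z \<noteq> 0}) U \<and> z \<in> U \<and> negligible U"
      using z d(1) by (intro exI[of _ ?U]) simp
  qed
  then have "{z \<in> \<Omega>. u z \<noteq> 0} \<in> null_sets lebesgue" by (simp add: negligible_iff_null_sets)
  then have "AE z in lebesgue. z \<in> \<Omega> \<longrightarrow> u z = 0"
    by (rule AE_I') auto
  then show ?thesis
    using assms(1) by (subst AE_restrict_space_iff) simp_all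
qed

end
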